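(* Let $n\ge2$, $\boldsymbol\lambda\in\mathbb C^n$ with $\sum_l\lambda_l=0$, and $\mathfrak C=\max_l|\lambda_l|+1$. Let $\varsigma\in\{+,-\}$, let $\xi$ be an $n$-th root of $\varsigma1$, let $0<\vartheta<\frac12\pi$, put $$\mathbb S'_\xi(\vartheta)=\Big\{z\in\mathbb U:\ |\arg z-\arg(i\overline\xi)|<\pi+\frac\pi n-\vartheta\Big\},$$ and let $M$ be a positive integer. Then there exists a constant $c$, depending only on $M$, $\vartheta$ and $n$, such that $$J(z;\boldsymbol\lambda;\xi)=e^{in\xi z}z^{-\frac{n-1}2}\Big(\sum_{m=0}^{M-1}B_m(\boldsymbol\lambda;\xi)z^{-m}+O_{M,\vartheta,n}\big(\mathfrak C^{2M}|z|^{-M}\big)\Big)$$ for all $z\in\mathbb S'_\xi(\vartheta)$ with $|z|>c\,\mathfrak C^2$. A similar asymptotic holds for all derivatives: for each $j\ge0$, if $e^{in\xi z}z^{-\frac{n-1}2}\sum_{m\ge0}B_m^{[j]}(\boldsymbol\lambda;\xi)z^{-m}$ denotes the $j$-th formal derivative of $e^{in\xi z}z^{-\frac{n-1}2}\sum_{m\ge0}B_m(\boldsymbol\lambda;\xi)z^{-m}$, then $$J^{(j)}(z;\boldsymbol\lambda;\xi)=e^{in\xi z}z^{-\frac{n-1}2}\Big(\sum_{m=0}^{M-1}B^{[j]}_m(\boldsymbol\lambda;\xi)z^{-m}+O_{M,\vartheta,n,j}\big(\mathfrak C^{2M}|z|^{-M}\big)\Big)$$ for such $z$.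
   Context: $\mathbb U$ is the universal cover of $\mathbb C\smallsetminus\{0\}$, with elements $z=|z|e^{i\arg z}$, $\arg z\in\mathbb R$, and $z^a=e^{a\log z}$, $\log z=\log|z|+i\arg z$. The root $\xi$ is regarded as a point of $\mathbb U$ (a choice of $\arg\xi$ is fixed), and $\arg(i\overline\xi)=\frac\pi2-\arg\xi$. $O_{\dots}$: the implied constant depends only on the listed parameters. Bessel equation of index $\boldsymbol\lambda$ and sign $\varsigma$ (on $\mathbb U$): $$\sum_{j=1}^nV_{n,j}(\boldsymbol\lambda)z^jw^{(j)}+\big(V_{n,0}(\boldsymbol\lambda)-\varsigma(in)^nz^n\big)w=0,\qquad V_{n,j}(\boldsymbol\lambda)=\sum_{m=0}^{n-j}A_{j,n-j-m}\,n^m\sigma_m(\boldsymbol\lambda),$$ where $\sigma_m$ is the $m$-th elementary symmetric polynomial, $A_{0,0}=1$, $A_{0,m}=0$ ($m\ge1$), $A_{j,m}=\sum_{r=1}^j\frac{(-1)^{j-r}r^{m+j}}{r!(j-r)!}$ ($j\ge1,m\ge0$). There is a unique sequence of symmetric polynomials $B_m(\boldsymbol\lambda;\xi)$ in $\boldsymbol\lambda$ with $B_0=1$ such that $\widehat J(z;\boldsymbol\lambda;\xi)=e^{in\xi z}z^{-\frac{n-1}2}\sum_{m\ge0}B_m(\boldsymbol\lambda;\xi)z^{-m}$ is a formal solution of this equation. $J(z;\boldsymbol\lambda;\xi)$ is the unique solution on $\mathbb U$ having $\widehat J(z;\boldsymbol\lambda;\xi)$ as its asymptotic expansion (as $|z|\to\infty$)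 on the sector $\{z\in\mathbb U:|\arg z-\arg(i\overline\xi)|<\frac\pi n\}$. *)

theory Defs
  imports "HOL-Complex_Analysis.Complex_Analysis"
begin

section \<open>The universal cover of the punctured plane\<close>

text \<open>
  The universal cover of the punctured plane is modelled by the covering map
  exp from the complex plane, so that a point z of the cover is given by its
  logarithm log |z| + i arg z.  A function on the cover is a total function of
  this logarithm, and it is holomorphic on the cover iff it is entire in it.
\<close>

type_synonym ucover = complex

definition uc_proj :: "ucover \<Rightarrow> complex" where
  "uc_proj z = exp z"

definition uc_abs :: "ucover \<Rightarrow> real" where
  "uc_abs z = exp (Re z)"

definition uc_arg :: "ucover \<Rightarrow> real" where
  "uc_arg z = Im z"

definition uc_powr :: "ucover \<Rightarrow> complex \<Rightarrow> complex" where
  "uc_powr z a = exp (a * z)"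

lemma uc_proj_covering: "covering_space UNIV uc_proj (- {0})"
  using covering_space_exp_punctured_plane by (simp add: uc_proj_def [abs_def])

lemma uc_proj_polar: "uc_proj z = of_real (uc_abs z) * cis (uc_arg z)"
  by (simp add: uc_proj_def uc_abs_def uc_arg_def exp_eq_polar)

text \<open>
  Differentiation with respect to z, expressed in the coordinate log z by the
  chain rule.  The lemma below identifies it with the derivative taken along
  the local section of the covering through the given point.
\<close>

definition uc_deriv :: "(ucover \<Rightarrow> complex) \<Rightarrow> ucover \<Rightarrow> complex" where
  "uc_deriv f z = deriv f z / uc_proj z"

lemma uc_deriv_local_section:
  assumes "f field_differentiable (at z)"
  shows "((\<lambda>u. f (z + Ln (u / uc_proj z))) has_field_derivative uc_deriv f z) (at (uc_proj z))"
proof -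
  have nz: "uc_proj z \<noteq> 0"
    by (simp add: uc_proj_def)
  have f: "(f has_field_derivative deriv f z) (at (z + Ln (uc_proj z / uc_proj z)))"
    using assms nz by (simp add: field_differentiable_derivI)
  have g: "((\<lambda>u. z + Ln (u / uc_proj z)) has_field_derivative 1 / uc_proj z) (at (uc_proj z))"
    using nz by (auto intro!: derivative_eq_intros)
  show ?thesis
    using DERIV_chain2 [OF f g] by (simp add: uc_deriv_def)
qed

section \<open>The Bessel equation\<close>

text \<open>
  An index in the n-dimensional complex space is a function on the naturals of
  which only the values below n are used.
\<close>

definition esym :: "nat \<Rightarrow> nat \<Rightarrow> (nat \<Rightarrow> complex) \<Rightarrow> complex" where
  "esym n m lam = (\<Sum>S | S \<subseteq> {..<n} \<and> card S = m. \<Prod>i\<in>S. lam i)"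

definition bessel_A :: "nat \<Rightarrow> nat \<Rightarrow> complex" where
  "bessel_A j m =
     (if j = 0 then (if m = 0 then 1 else 0)
      else (\<Sum>r=1..j. (-1) ^ (j - r) * of_nat r ^ (m + j) / (fact r * fact (j - r))))"

definition bessel_V :: "nat \<Rightarrow> nat \<Rightarrow> (nat \<Rightarrow> complex) \<Rightarrow> complex" where
  "bessel_V n j lam = (\<Sum>m=0..n-j. bessel_A j (n - j - m) * of_nat n ^ m * esym n m lam)"

definition bessel_solution ::
  "nat \<Rightarrow> complex \<Rightarrow> (nat \<Rightarrow> complex) \<Rightarrow> (ucover \<Rightarrow> complex) \<Rightarrow> bool" where
  "bessel_solution n \<sigma> lam w \<longleftrightarrow>
     w holomorphic_on UNIV \<and>
     (\<forall>z. (\<Sum>j=1..n. bessel_V n j lam * uc_proj z ^ j * (uc_deriv ^^ j) w z)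
        + (bessel_V n 0 lam - \<sigma> * (\<i> * of_nat n) ^ n * uc_proj z ^ n) * w z = 0)"

section \<open>Formal solutions\<close>

text \<open>
  A formal expression exp (a z) z^b (b_0 + b_1 z^(-1) + ...) is represented by
  the power series of its last factor in the variable X = 1/z.  Its formal
  derivative with respect to z again has the factor exp (a z) z^b, and the
  series changes as follows since d/dz = - X^2 d/dX.
\<close>

definition formal_deriv :: "complex \<Rightarrow> complex \<Rightarrow> complex fps \<Rightarrow> complex fps" where
  "formal_deriv a b F = fps_const a * F + fps_const b * fps_X * F - fps_X ^ 2 * fps_deriv F"

definition bessel_rate :: "nat \<Rightarrow> complex \<Rightarrow> complex" where
  "bessel_rate n \<xi> = \<i> * of_nat n * \<xi>"

definition bessel_expo :: "nat \<Rightarrow> complex" where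
  "bessel_expo n = - (of_nat n - 1) / 2"

definition bessel_formal_deriv :: "nat \<Rightarrow> complex \<Rightarrow> nat \<Rightarrow> complex fps \<Rightarrow> complex fps" where
  "bessel_formal_deriv n \<xi> j = formal_deriv (bessel_rate n \<xi>) (bessel_expo n) ^^ j"

text \<open>
  The Bessel equation for the formal expression given by F, multiplied by
  z^(-n) = X^n in order to stay within power series in X.
\<close>

definition bessel_formal_solution ::
  "nat \<Rightarrow> complex \<Rightarrow> complex \<Rightarrow> (nat \<Rightarrow> complex) \<Rightarrow> complex fps \<Rightarrow> bool" where
  "bessel_formal_solution n \<sigma> \<xi> lam F \<longleftrightarrow>
     (\<Sum>j=1..n. fps_const (bessel_V n j lam) * fps_X ^ (n - j) * bessel_formal_deriv n \<xi> j F)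
       + (fps_const (bessel_V n 0 lam) * fps_X ^ n - fps_const (\<sigma> * (\<i> * of_nat n) ^ n)) * F = 0"

inductive_set poly_fun :: "nat \<Rightarrow> ((nat \<Rightarrow> complex) \<Rightarrow> complex) set" for n where
  const: "(\<lambda>_. c) \<in> poly_fun n"
| coord: "i < n \<Longrightarrow> (\<lambda>lam. lam i) \<in> poly_fun n"
| add: "f \<in> poly_fun n \<Longrightarrow> g \<in> poly_fun n \<Longrightarrow> (\<lambda>lam. f lam + g lam) \<in> poly_fun n"
| mult: "f \<in> poly_fun n \<Longrightarrow> g \<in> poly_fun n \<Longrightarrow> (\<lambda>lam. f lam * g lam) \<in> poly_fun n"

definition sym_poly_fun :: "nat \<Rightarrow> ((nat \<Rightarrow> complex) \<Rightarrow> complex) set" where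
  "sym_poly_fun n =
     {f \<in> poly_fun n. \<forall>p. p permutes {..<n} \<longrightarrow> (\<forall>lam. f (\<lambda>i. lam (p i)) = f lam)}"

text \<open>
  The sequence of symmetric polynomials is unique only as a sequence of
  functions on the hyperplane where the coordinates of the index add up to 0,
  hence the description of its value at an index in this hyperplane.
\<close>

definition bessel_B :: "nat \<Rightarrow> complex \<Rightarrow> complex \<Rightarrow> (nat \<Rightarrow> complex) \<Rightarrow> nat \<Rightarrow> complex" where
  "bessel_B n \<sigma> \<xi> lam = (THE b. \<exists>B.
     (\<forall>m. B m \<in> sym_poly_fun n) \<and> B 0 = (\<lambda>_. 1) \<and>
     (\<forall>\<mu>. (\<Sum>l<n. \<mu> l) = 0 \<longrightarrow> bessel_formal_solution n \<sigma> \<xi> \<mu> (Abs_fps (\<lambda>m. B m \<mu>))) \<and>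
     b = (\<lambda>m. B m lam))"

definition bessel_B_deriv ::
  "nat \<Rightarrow> complex \<Rightarrow> complex \<Rightarrow> (nat \<Rightarrow> complex) \<Rightarrow> nat \<Rightarrow> nat \<Rightarrow> complex" where
  "bessel_B_deriv n \<sigma> \<xi> lam j m =
     fps_nth (bessel_formal_deriv n \<xi> j (Abs_fps (bessel_B n \<sigma> \<xi> lam))) m"

section \<open>The solution attached to a root of unity\<close>

definition bessel_prefactor :: "nat \<Rightarrow> complex \<Rightarrow> ucover \<Rightarrow> complex" where
  "bessel_prefactor n \<xi> z = exp (bessel_rate n \<xi> * uc_proj z) * uc_powr z (bessel_expo n)"

text \<open>
  The root of unity is a point of the cover, and the argument of i times its
  conjugate is pi/2 minus its chosen argument.
\<close>

definition bessel_sector :: "ucover \<Rightarrow> real \<Rightarrow> ucover set" where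
  "bessel_sector \<xi> \<phi> = {z. \<bar>uc_arg z - (pi / 2 - uc_arg \<xi>)\<bar> < \<phi>}"

definition has_bessel_expansion ::
  "nat \<Rightarrow> complex \<Rightarrow> (ucover \<Rightarrow> complex) \<Rightarrow> (nat \<Rightarrow> complex) \<Rightarrow> ucover set \<Rightarrow> bool" where
  "has_bessel_expansion n \<xi> w b S \<longleftrightarrow>
     (\<forall>M. \<exists>K R. \<forall>z\<in>S. uc_abs z > R \<longrightarrow>
        norm (w z / bessel_prefactor n \<xi> z - (\<Sum>m<M. b m / uc_proj z ^ m)) \<le> K / uc_abs z ^ M)"

definition bessel_J :: "nat \<Rightarrow> complex \<Rightarrow> ucover \<Rightarrow> (nat \<Rightarrow> complex) \<Rightarrow> ucover \<Rightarrow> complex" where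
  "bessel_J n \<sigma> \<xi> lam = (THE w. bessel_solution n \<sigma> lam w \<and>
     has_bessel_expansion n (uc_proj \<xi>) w (bessel_B n \<sigma> (uc_proj \<xi>) lam)
       (bessel_sector \<xi> (pi / real n)))"

definition index_size :: "nat \<Rightarrow> (nat \<Rightarrow> complex) \<Rightarrow> real" where
  "index_size n lam = Max ((\<lambda>l. norm (lam l)) ` {..<n}) + 1"

end

theory Submission
  imports Defs
begin

text \<open>
  Writing w = z^(-(n - 1)/2) W removes all terms of order 1/z from the equation at once: it
  becomes W^(n) + (sum over l < n - 1 of c_l z^(l - n) W^(l)) = a^n W with a = i n xi and
  c_l = O(C^(n - l)), where C is the size of the index.  For |z| > C^2 this is W^(n) = a^n W up to
  C^2 / z^2.  The n modes of the latter are integrated backwards along straight segments.  In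
  the directions d with |arg d - arg (i cnj xi)| <= pi/n no mode grows relative to exp (a z) on
  the way back, and a ray from z in such a direction avoids 0 as soon as
  |arg z - arg d| < pi, which is where the angle pi + pi/n comes from.  Since the integral of
  C^2 / z^2 along the ray is small for |z| > c C^2, taking suprema bounds an error term by its
  size at the far end and its residual.

  This estimate gives the uniqueness of the recessive solution, its existence as the limit of
  the solutions that agree with exp (a z) to order n at points receding to infinity, and, applied
  to the difference from a truncation of the formal series, the uniform expansion.
\<close>

section \<open>Iterated derivatives on the cover\<close>

text \<open>The difficulty is uniformity: every constant has to be fixed before the index, the root
  and the solution. The factor C^2 per power of 1/z arises in the formal recursion too, where
  passing from B_i to B_m costs C^(m+1-i), which is at most C^(2(m-i)) as i < m. The estimate along
  rays needs information at the far end, whereas the definition of J gives it only for J itself,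
  without derivatives, and on an open sector on whose boundary the extreme ray directions lie. For
  this reason a solution is constructed that is close to exp (a z), with its derivatives up to order
  n - 1, on the wider range |arg z - arg (i cnj xi)| <= 3 pi/4. The expansion is proved for this
  solution, and J is identified with it afterwards; in that identification Cauchy's estimate
  supplies the missing derivatives. The estimate also stops at order n - 1; higher derivatives are
  recovered from the differentiated equation.\<close>

abbreviation entire :: "(complex \<Rightarrow> complex) \<Rightarrow> bool" where
  "entire f \<equiv> f holomorphic_on UNIV"

lemma entire_DERIV: "entire f \<Longrightarrow> (f has_field_derivative deriv f s) (at s)"
  by (simp add: holomorphic_derivI)

lemma uc_deriv_eq: "uc_deriv f s = exp (- s) * deriv f s"
  by (simp add: uc_deriv_def uc_proj_def exp_minus field_simps)

lemma entire_uc_deriv: "entire f \<Longrightarrow> entire (uc_deriv f)"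
  unfolding uc_deriv_eq [abs_def] by (intro holomorphic_intros) auto

lemma entire_uc_derivs [holomorphic_intros]: "entire f \<Longrightarrow> entire ((uc_deriv ^^ j) f)"
  by (induction j) (auto intro: entire_uc_deriv)

lemma uc_deriv_DERIV: "entire f \<Longrightarrow> (f has_field_derivative exp s * uc_deriv f s) (at s)"
  using entire_DERIV [of f s] by (simp add: uc_deriv_eq exp_minus field_simps)

lemma uc_derivI: "(f has_field_derivative D) (at s) \<Longrightarrow> uc_deriv f s = exp (- s) * D"
  by (simp add: uc_deriv_eq DERIV_imp_deriv)

lemma uc_derivs_DERIV:
  "entire f \<Longrightarrow> ((uc_deriv ^^ j) f has_field_derivative exp s * (uc_deriv ^^ Suc j) f s) (at s)"
  using uc_deriv_DERIV [OF entire_uc_derivs, of f j s] by simp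

lemma uc_derivs_lincomb:
  assumes "finite I" and "\<And>i. i \<in> I \<Longrightarrow> entire (f i)"
  shows "(uc_deriv ^^ j) (\<lambda>s. \<Sum>i\<in>I. c i * f i s) = (\<lambda>s. \<Sum>i\<in>I. c i * (uc_deriv ^^ j) (f i) s)"
proof (induction j)
  case (Suc j)
  have "uc_deriv (\<lambda>s. \<Sum>i\<in>I. c i * (uc_deriv ^^ j) (f i) s) s
      = exp (- s) * (\<Sum>i\<in>I. c i * (exp s * (uc_deriv ^^ Suc j) (f i) s))" for s
    using assms by (intro uc_derivI DERIV_sum DERIV_cmult uc_derivs_DERIV) auto
  also have "exp (- s) * (\<Sum>i\<in>I. c i * (exp s * (uc_deriv ^^ Suc j) (f i) s))
      = (\<Sum>i\<in>I. c i * (uc_deriv ^^ Suc j) (f i) s)" for s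
    by (simp add: sum_distrib_left exp_minus field_simps)
  finally have "uc_deriv (\<lambda>s. \<Sum>i\<in>I. c i * (uc_deriv ^^ j) (f i) s) s
      = (\<Sum>i\<in>I. c i * (uc_deriv ^^ Suc j) (f i) s)" for s .
  then have "uc_deriv (\<lambda>s. \<Sum>i\<in>I. c i * (uc_deriv ^^ j) (f i) s)
      = (\<lambda>s. \<Sum>i\<in>I. c i * (uc_deriv ^^ Suc j) (f i) s)" by (rule ext)
  then show ?case
    using Suc.IH by simp
qed simp

lemma uc_derivs_add:
  "entire f \<Longrightarrow> entire g \<Longrightarrow>
     (uc_deriv ^^ j) (\<lambda>s. f s + g s) = (\<lambda>s. (uc_deriv ^^ j) f s + (uc_deriv ^^ j) g s)"
  using uc_derivs_lincomb [of "{False, True}" "\<lambda>i. if i then g else f" j "\<lambda>_. 1"] by simp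

lemma uc_derivs_diff:
  "entire f \<Longrightarrow> entire g \<Longrightarrow>
     (uc_deriv ^^ j) (\<lambda>s. f s - g s) = (\<lambda>s. (uc_deriv ^^ j) f s - (uc_deriv ^^ j) g s)"
  using uc_derivs_lincomb [of "{False, True}" "\<lambda>i. if i then g else f" j "\<lambda>i. if i then -1 else 1"] by simp

lemma uc_derivs_cmult:
  "entire f \<Longrightarrow> (uc_deriv ^^ j) (\<lambda>s. c * f s) = (\<lambda>s. c * (uc_deriv ^^ j) f s)"
  using uc_derivs_lincomb [of "{()}" "\<lambda>_. f" j "\<lambda>_. c"] by simp

section \<open>Leibniz's rule for a power of z times a function\<close>

lemma DERIV_exp_power:
  "((\<lambda>s. exp (c * s) ^ k) has_field_derivative of_nat k * c * exp (c * s) ^ k) (at (s::complex))"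
proof -
  have "((\<lambda>s. exp (of_nat k * (c * s))) has_field_derivative of_nat k * c * exp (of_nat k * (c * s))) (at s)"
    by (auto intro!: derivative_eq_intros)
  then show ?thesis by (simp add: exp_of_nat_mult)
qed

text \<open>Binomial(j, i) times the falling factorial b (b - 1) ... (b - (j - i) + 1), the
  coefficient in Leibniz's rule for the j-th derivative of z^b W. The recursion is what one further
  differentiation produces.\<close>

fun leibniz_coeff :: "complex \<Rightarrow> nat \<Rightarrow> nat \<Rightarrow> complex" where
  "leibniz_coeff b 0 i = (if i = 0 then 1 else 0)"
| "leibniz_coeff b (Suc j) i = (b - (of_nat j - of_nat i)) * leibniz_coeff b j i
     + (if i = 0 then 0 else leibniz_coeff b j (i - 1))"

lemma leibniz_coeff_gt: "j < i \<Longrightarrow> leibniz_coeff b j i = 0"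
  by (induction j arbitrary: i) auto

lemma leibniz_coeff_same: "leibniz_coeff b j j = 1"
  by (induction j) (auto simp: leibniz_coeff_gt)

lemma leibniz_coeff_pred: "leibniz_coeff b (Suc j) j = of_nat (Suc j) * b"
  by (induction j) (auto simp: leibniz_coeff_same algebra_simps simp del: leibniz_coeff.simps(1))

text \<open>Differentiating a sum over the orders i yields one sum with the same orders and one with
  orders raised by one; this collects both by order.\<close>

lemma sum_shift_merge:
  fixes u v :: "nat \<Rightarrow> complex"
  assumes "u (Suc j) = 0"
  shows "(\<Sum>i\<le>j. u i) + (\<Sum>i\<le>j. v i) = (\<Sum>i\<le>Suc j. u i + (if i = 0 then 0 else v (i - 1)))"
proof -
  have "(\<Sum>i\<le>Suc j. if i = 0 then 0 else v (i - 1)) = (\<Sum>i\<le>j. v i)"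
    by (subst sum.atMost_Suc_shift) simp
  then show ?thesis
    using assms by (simp add: sum.distrib del: sum.atMost_Suc) simp
qed

lemma uc_derivs_exp_mult:
  assumes "entire W"
  shows "(uc_deriv ^^ j) (\<lambda>s. exp (b * s) * W s) s =
    exp (b * s) * (\<Sum>i\<le>j. leibniz_coeff b j i * exp (- s) ^ (j - i) * (uc_deriv ^^ i) W s)"
proof (induction j arbitrary: s)
  case (Suc j)
  define D where "D i = (uc_deriv ^^ i) W" for i
  define l where "l = leibniz_coeff b j"
  have D: "(D i has_field_derivative exp s * D (Suc i) s) (at s)" for i s
    unfolding D_def by (rule uc_derivs_DERIV [OF assms])
  have trm: "((\<lambda>s. exp (b * s) * (l i * exp (- s) ^ (j - i) * D i s)) has_field_derivative
      exp s * exp (b * s) * ((b - (of_nat j - of_nat i)) * l i * exp (- s) ^ (Suc j - i) * D i s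
         + l i * exp (- s) ^ (j - i) * D (Suc i) s)) (at s)" if "i \<le> j" for i s
  proof -
    have pw: "((\<lambda>s. exp (- s) ^ k) has_field_derivative - of_nat k * exp (- s) ^ k) (at s)" for k and s :: complex
      using DERIV_exp_power [of "-1" k s] by simp
    have e: "exp s * exp (- s) ^ (Suc j - i) = exp (- s) ^ (j - i)"
      using that by (simp add: Suc_diff_le exp_minus)
    have "((\<lambda>s. exp (b * s) * (l i * exp (- s) ^ (j - i) * D i s)) has_field_derivative
       exp (b * s) * ((b - (of_nat j - of_nat i)) * l i * exp (- s) ^ (j - i) * D i s
         + exp s * (l i * exp (- s) ^ (j - i) * D (Suc i) s))) (at s)"
      using that DERIV_mult [OF DERIV_exp_power [of b 1 s]
          DERIV_mult [OF DERIV_cmult [OF pw [of "j - i" s], of "l i"] D [of i s]]]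
      by (simp add: algebra_simps of_nat_diff)
    then show ?thesis
      by (simp add: e [symmetric] algebra_simps)
  qed
  have IH: "(uc_deriv ^^ j) (\<lambda>s. exp (b * s) * W s)
      = (\<lambda>s. \<Sum>i\<le>j. exp (b * s) * (l i * exp (- s) ^ (j - i) * D i s))"
    by (rule ext) (simp add: Suc.IH sum_distrib_left D_def l_def)
  have "(uc_deriv ^^ Suc j) (\<lambda>s. exp (b * s) * W s) s
      = uc_deriv (\<lambda>s. \<Sum>i\<le>j. exp (b * s) * (l i * exp (- s) ^ (j - i) * D i s)) s"
    by (simp add: IH)
  also have "\<dots> = exp (- s) * (\<Sum>i\<le>j. exp s * exp (b * s) * ((b - (of_nat j - of_nat i)) * l i * exp (- s) ^ (Suc j - i) * D i s
         + l i * exp (- s) ^ (j - i) * D (Suc i) s))"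
    by (intro uc_derivI DERIV_sum trm) auto
  also have "\<dots> = exp (b * s) * ((\<Sum>i\<le>j. (b - (of_nat j - of_nat i)) * l i * exp (- s) ^ (Suc j - i) * D i s)
         + (\<Sum>i\<le>j. l i * exp (- s) ^ (j - i) * D (Suc i) s))"
    by (simp add: sum_distrib_left [symmetric] sum.distrib [symmetric] mult.assoc exp_minus)
  also have "(\<Sum>i\<le>j. (b - (of_nat j - of_nat i)) * l i * exp (- s) ^ (Suc j - i) * D i s)
         + (\<Sum>i\<le>j. l i * exp (- s) ^ (j - i) * D (Suc i) s)
    = (\<Sum>i\<le>Suc j. (b - (of_nat j - of_nat i)) * l i * exp (- s) ^ (Suc j - i) * D i s
       + (if i = 0 then 0 else l (i - 1) * exp (- s) ^ (j - (i - 1)) * D (Suc (i - 1)) s))"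
    by (rule sum_shift_merge) (simp add: l_def leibniz_coeff_gt)
  also have "\<dots> = (\<Sum>i\<le>Suc j. leibniz_coeff b (Suc j) i * exp (- s) ^ (Suc j - i) * D i s)"
    by (intro sum.cong) (auto simp: l_def algebra_simps)
  finally show ?case
    by (simp add: D_def)
qed simp

text \<open>Signed Stirling numbers of the first kind: with D = d/d(log z), the operator z^j
  (d/dz)^j is D (D - 1) ... (D - j + 1), and these are the coefficients of that polynomial in
  D.\<close>

fun falling_coeff :: "nat \<Rightarrow> nat \<Rightarrow> complex" where
  "falling_coeff 0 i = (if i = 0 then 1 else 0)"
| "falling_coeff (Suc j) i = - of_nat j * falling_coeff j i
     + (if i = 0 then 0 else falling_coeff j (i - 1))"

lemma falling_coeff_gt: "j < i \<Longrightarrow> falling_coeff j i = 0"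
  by (induction j arbitrary: i) auto

lemma falling_coeff_same: "falling_coeff j j = 1"
  by (induction j) (auto simp: falling_coeff_gt)

lemma entire_derivs [holomorphic_intros]: "entire f \<Longrightarrow> entire ((deriv ^^ j) f)"
  by (simp add: holomorphic_higher_deriv)

lemma derivs_DERIV:
  "entire f \<Longrightarrow> ((deriv ^^ j) f has_field_derivative (deriv ^^ Suc j) f s) (at s)"
  using entire_DERIV [OF entire_derivs, of f j s] by simp

text \<open>Power series are used in the coordinate log z, estimates with d/dz. This triangular
  relation, with ones on the diagonal, moves initial data and convergence from one to the
  other.\<close>

lemma uc_derivs_eq_derivs:
  assumes "entire w"
  shows "exp s ^ j * (uc_deriv ^^ j) w s = (\<Sum>i\<le>j. falling_coeff j i * (deriv ^^ i) w s)"
proof (induction j arbitrary: s)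
  case (Suc j)
  have "((\<lambda>s. exp s ^ j * (uc_deriv ^^ j) w s) has_field_derivative
      of_nat j * (exp s ^ j * (uc_deriv ^^ j) w s) + exp s ^ j * (exp s * (uc_deriv ^^ Suc j) w s)) (at s)"
    using DERIV_mult [OF DERIV_exp_power [of 1 j s] uc_derivs_DERIV [OF assms, of j s]]
    by (simp add: algebra_simps del: funpow.simps)
  moreover have "((\<lambda>s. \<Sum>i\<le>j. falling_coeff j i * (deriv ^^ i) w s) has_field_derivative
      (\<Sum>i\<le>j. falling_coeff j i * (deriv ^^ Suc i) w s)) (at s)"
    by (intro DERIV_sum DERIV_cmult derivs_DERIV assms)
  ultimately have "of_nat j * (exp s ^ j * (uc_deriv ^^ j) w s) + exp s ^ j * (exp s * (uc_deriv ^^ Suc j) w s)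
      = (\<Sum>i\<le>j. falling_coeff j i * (deriv ^^ Suc i) w s)"
    using Suc.IH by (metis (no_types, lifting) DERIV_unique ext)
  then have "exp s ^ Suc j * (uc_deriv ^^ Suc j) w s =
      (\<Sum>i\<le>j. - of_nat j * falling_coeff j i * (deriv ^^ i) w s) + (\<Sum>i\<le>j. falling_coeff j i * (deriv ^^ Suc i) w s)"
    by (simp add: Suc.IH sum_distrib_left algebra_simps sum_negf del: funpow.simps)
  also have "\<dots> = (\<Sum>i\<le>Suc j. - of_nat j * falling_coeff j i * (deriv ^^ i) w s
      + (if i = 0 then 0 else falling_coeff j (i - 1) * (deriv ^^ Suc (i - 1)) w s))"
    by (rule sum_shift_merge) (simp add: falling_coeff_gt)
  also have "\<dots> = (\<Sum>i\<le>Suc j. falling_coeff (Suc j) i * (deriv ^^ i) w s)"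
    by (intro sum.cong) (auto simp: algebra_simps simp del: funpow.simps)
  finally show ?case .
qed simp

lemma uc_derivs_eq_0:
  assumes "entire w" and "\<And>i. i < n \<Longrightarrow> (deriv ^^ i) w s = 0" and "j < n"
  shows "(uc_deriv ^^ j) w s = 0"
proof -
  have "exp s ^ j * (uc_deriv ^^ j) w s = 0"
    unfolding uc_derivs_eq_derivs [OF assms(1)] using assms by (intro sum.neutral) auto
  then show ?thesis by simp
qed

section \<open>The modes of the leading equation, and straight rays\<close>

definition rate :: "nat \<Rightarrow> complex \<Rightarrow> nat \<Rightarrow> complex" where
  "rate n a k = a * cis (2 * pi * real k / real n)"

text \<open>With D = d/dz and r = \<open>rate n a k\<close> this is the quotient (D^n - r^n) / (D -
  r) applied to W. Since r^n = a^n, applying D - r to the mode gives W^(n) - a^n W, so the modes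
  split the leading equation into n equations of first order.\<close>

definition mode :: "nat \<Rightarrow> complex \<Rightarrow> nat \<Rightarrow> (complex \<Rightarrow> complex) \<Rightarrow> complex \<Rightarrow> complex" where
  "mode n a k W s = (\<Sum>j<n. rate n a k ^ (n - 1 - j) * (uc_deriv ^^ j) W s)"

lemma norm_rate [simp]: "norm (rate n a k) = norm a"
  by (simp add: rate_def norm_mult)

lemma cis_root_power: "n > 0 \<Longrightarrow> cis (2 * pi * real k / real n) ^ n = 1"
proof -
  assume "n > 0"
  then have "real n * (2 * pi * real k / real n) = 2 * pi * real k" by simp
  then show ?thesis
    using cis_multiple_2pi [OF Ints_of_nat, of k] unfolding Complex.DeMoivre by metis
qed

lemma cis_root_power_swap:
  "cis (2 * pi * real k / real n) ^ m = cis (2 * pi * real m / real n) ^ k"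
proof -
  have "real m * (2 * pi * real k / real n) = real k * (2 * pi * real m / real n)" by simp
  then show ?thesis unfolding Complex.DeMoivre by metis
qed

lemma rate_power_n: "n > 0 \<Longrightarrow> rate n a k ^ n = a ^ n"
  by (simp add: rate_def power_mult_distrib cis_root_power)

text \<open>Orthogonality of the characters of Z/n. The range of m is that of n + i - j for i, j <
  n, where n is the only multiple of n.\<close>

lemma sum_rate_power:
  assumes "0 < m" "m < 2 * n"
  shows "(\<Sum>k<n. rate n a k ^ m) = (if m = n then of_nat n * a ^ n else 0)"
proof (cases "m = n")
  case True
  then show ?thesis using assms by (simp add: rate_power_n)
next
  case False
  let ?z = "cis (2 * pi * real m / real n)"
  have n: "n > 0" using assms by simp
  have zn: "?z ^ n = 1"
    using n by (rule cis_root_power)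
  have z1: "?z \<noteq> 1"
  proof
    assume "?z = 1"
    then have "cos (2 * pi * real m / real n) = 1"
      by (metis cis.sel(1) one_complex.sel(1))
    then obtain x :: int where "2 * pi * real m / real n = of_int x * 2 * pi"
      by (auto simp: cos_one_2pi_int)
    then have "real m = of_int x * real n"
      using n by (simp add: field_simps)
    then have mx: "int m = x * int n"
      by (metis (mono_tags, lifting) of_int_eq_iff of_int_mult of_int_of_nat_eq)
    then have "0 < x * int n" "x * int n < 2 * int n"
      using assms by linarith+
    then have "0 < x" "x < 2"
      using n by (simp_all add: zero_less_mult_iff)
    then have "x = 1" by simp
    then show False using mx False by auto
  qed
  have "(\<Sum>k<n. rate n a k ^ m) = a ^ m * (\<Sum>k<n. ?z ^ k)"
    by (simp add: rate_def power_mult_distrib cis_root_power_swap [of _ _ m] sum_distrib_left)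
  also have "(\<Sum>k<n. ?z ^ k) = 0"
    using geometric_sum [OF z1, of n] zn by simp
  finally show ?thesis using False by simp
qed

text \<open>Discrete Fourier inversion: the factor r^(i+1) turns the exponents of the k-th root into
  n + i - j, and summation over k singles out j = i.\<close>

lemma mode_inverse:
  assumes "i < n"
  shows "of_nat n * a ^ n * (uc_deriv ^^ i) W s = (\<Sum>k<n. rate n a k ^ (i + 1) * mode n a k W s)"
proof -
  have "(\<Sum>k<n. rate n a k ^ (i + 1) * mode n a k W s)
      = (\<Sum>k<n. \<Sum>j<n. rate n a k ^ (n + i - j) * (uc_deriv ^^ j) W s)"
    unfolding mode_def sum_distrib_left
  proof (intro sum.cong refl)
    fix k j assume "j \<in> {..<n}"
    then have "n + i - j = (i + 1) + (n - 1 - j)" by auto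
    then show "rate n a k ^ (i + 1) * (rate n a k ^ (n - 1 - j) * (uc_deriv ^^ j) W s)
        = rate n a k ^ (n + i - j) * (uc_deriv ^^ j) W s"
      by (simp only: power_add mult.assoc)
  qed
  also have "\<dots> = (\<Sum>j<n. (\<Sum>k<n. rate n a k ^ (n + i - j)) * (uc_deriv ^^ j) W s)"
    by (subst sum.swap) (simp add: sum_distrib_right)
  also have "\<dots> = (\<Sum>j<n. if j = i then of_nat n * a ^ n * (uc_deriv ^^ j) W s else 0)"
    using assms by (intro sum.cong) (auto simp: sum_rate_power)
  also have "\<dots> = of_nat n * a ^ n * (uc_deriv ^^ i) W s"
    using assms by simp
  finally show ?thesis ..
qed

text \<open>Multiplying (D^n - r^n) / (D - r) by D - r telescopes. The factor \<open>exp s\<close>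
  is dz/d(log z).\<close>

lemma mode_DERIV:
  assumes "n > 0" "entire W"
  shows "(mode n a k W has_field_derivative
     exp s * (rate n a k * mode n a k W s + ((uc_deriv ^^ n) W s - a ^ n * W s))) (at s)"
proof -
  obtain m where n: "n = Suc m" using assms(1) by (cases n) auto
  define r where "r = rate n a k"
  define u where "u j = r ^ (n - j) * (uc_deriv ^^ j) W s" for j
  have "((\<lambda>s. \<Sum>j\<le>m. r ^ (m - j) * (uc_deriv ^^ j) W s) has_field_derivative
      (\<Sum>j\<le>m. r ^ (m - j) * (exp s * (uc_deriv ^^ Suc j) W s))) (at s)"
    by (intro DERIV_sum DERIV_cmult uc_derivs_DERIV assms)
  moreover have "(\<Sum>j\<le>m. r ^ (m - j) * (exp s * (uc_deriv ^^ Suc j) W s)) = exp s * (\<Sum>j\<le>m. u (Suc j))"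
    by (simp add: u_def n sum_distrib_left mult.left_commute)
  moreover have "(\<Sum>j\<le>m. u (Suc j)) = (\<Sum>j\<le>m. u j) + u (Suc m) - u 0"
    using sum.atMost_Suc_shift [of u m] by (simp add: algebra_simps)
  moreover have "(\<Sum>j\<le>m. u j) = r * (\<Sum>j\<le>m. r ^ (m - j) * (uc_deriv ^^ j) W s)"
    by (auto simp: u_def n sum_distrib_left mult.assoc [symmetric] Suc_diff_le intro!: sum.cong)
  moreover have "u (Suc m) - u 0 = (uc_deriv ^^ n) W s - a ^ n * W s"
    using rate_power_n [OF assms(1), of a k] by (simp add: u_def r_def n del: funpow.simps(2))
  ultimately have "((\<lambda>s. \<Sum>j\<le>m. r ^ (m - j) * (uc_deriv ^^ j) W s) has_field_derivative
      exp s * (r * (\<Sum>j\<le>m. r ^ (m - j) * (uc_deriv ^^ j) W s) + ((uc_deriv ^^ n) W s - a ^ n * W s))) (at s)"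
    by (simp only: add_diff_eq [symmetric])
  then show ?thesis
    by (simp add: mode_def [abs_def] n lessThan_Suc_atMost r_def algebra_simps del: funpow.simps(2))
qed

text \<open>Derivatives are measured relative to exp (a z), so that its decay near the axis and its
  growth in the outer parts of the sector both drop out.\<close>

definition amp :: "complex \<Rightarrow> nat \<Rightarrow> (complex \<Rightarrow> complex) \<Rightarrow> complex \<Rightarrow> real" where
  "amp a i W s = norm (exp (- (a * exp s)) * (uc_deriv ^^ i) W s)"

lemma amp_nonneg [simp]: "0 \<le> amp a i W s"
  by (simp add: amp_def)

text \<open>The constant is 1 because dividing by n a^n in the inversion gains n^(n+1), and r^(i+1)
  costs at most as much, as i < n and |r| = n >= 1.\<close>

lemma amp_le_modes:
  assumes "norm a = real n" "i < n"
  shows "amp a i W s \<le> (\<Sum>k<n. norm (exp (- (a * exp s)) * mode n a k W s))"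
proof -
  let ?e = "exp (- (a * exp s))"
  have n1: "real n \<ge> 1" using assms by simp
  have "real n * real n ^ n * amp a i W s = norm (?e * (of_nat n * a ^ n * (uc_deriv ^^ i) W s))"
    using assms by (simp add: amp_def norm_mult norm_power)
  also have "\<dots> \<le> (\<Sum>k<n. norm (?e * (rate n a k ^ (i + 1) * mode n a k W s)))"
    unfolding mode_inverse [OF assms(2)] sum_distrib_left by (rule norm_sum)
  also have "\<dots> = (\<Sum>k<n. real n ^ (i + 1) * norm (?e * mode n a k W s))"
    using assms by (simp add: norm_mult norm_power algebra_simps)
  also have "\<dots> \<le> (\<Sum>k<n. (real n * real n ^ n) * norm (?e * mode n a k W s))"
    using power_increasing [of "i + 1" "Suc n" "real n"] n1 assms
    by (intro sum_mono mult_right_mono) auto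
  finally show ?thesis
    using n1 assms by (simp add: sum_distrib_left [symmetric])
qed

lemma modes_le_amp:
  assumes "norm a = real n"
  shows "(\<Sum>k<n. norm (exp (- (a * exp s)) * mode n a k W s)) \<le> real n * (real n ^ n * (\<Sum>j<n. amp a j W s))"
proof -
  let ?e = "exp (- (a * exp s))"
  have "norm (?e * mode n a k W s) \<le> real n ^ n * (\<Sum>j<n. amp a j W s)" if "k < n" for k
  proof -
    have n1: "real n \<ge> 1" using that by simp
    have "norm (?e * mode n a k W s) \<le> (\<Sum>j<n. norm (?e * (rate n a k ^ (n - 1 - j) * (uc_deriv ^^ j) W s)))"
      unfolding mode_def sum_distrib_left by (rule norm_sum)
    also have "\<dots> = (\<Sum>j<n. real n ^ (n - 1 - j) * amp a j W s)"
      using assms by (simp add: norm_mult norm_power amp_def algebra_simps)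
    also have "\<dots> \<le> (\<Sum>j<n. real n ^ n * amp a j W s)"
      using n1 by (intro sum_mono mult_right_mono power_increasing) auto
    finally show ?thesis by (simp add: sum_distrib_left)
  qed
  then have "(\<Sum>k<n. norm (?e * mode n a k W s)) \<le> (\<Sum>k<n. real n ^ n * (\<Sum>j<n. amp a j W s))"
    by (intro sum_mono) auto
  then show ?thesis by simp
qed

text \<open>The lift to the cover of the ray from z = exp s0 in direction d. The principal logarithm
  is taken of (z + t d) / z, so the lift starts at s0 and is continuous as long as this quotient
  avoids the nonpositive reals.\<close>

definition ray :: "complex \<Rightarrow> complex \<Rightarrow> real \<Rightarrow> complex" where
  "ray s0 d t = s0 + Ln (1 + of_real t * (d * exp (- s0)))"

lemma ray_0 [simp]: "ray s0 d 0 = s0"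
  by (simp add: ray_def)

text \<open>The number q bounds minus the cosine of the angle between d and z. With x = |z|, |z + t
  d|^2 is at least x^2 + t^2 - 2 q x t = (1 - q)/2 (x + t)^2 + (1 + q)/2 (x - t)^2. The root of (1 -
  q)/2 is replaced by the smaller number (1 - q)/2.\<close>

lemma norm_ray_point:
  assumes d: "norm d = 1" and q: "- (q * norm z) \<le> Re (d * cnj z)" "0 \<le> q" "q < 1" and t: "0 \<le> t"
  shows "(1 - q) / 2 * (norm z + t) \<le> norm (z + of_real t * d)"
proof -
  let ?x = "norm z" and ?k = "(1 - q) / 2"
  have "Re d ^ 2 + Im d ^ 2 = 1"
    using d by (simp add: cmod_def)
  then have "(norm (z + of_real t * d))\<^sup>2 = ?x\<^sup>2 + t\<^sup>2 + 2 * (t * Re (d * cnj z))"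
    unfolding cmod_power2 by simp algebra
  moreover have "t * - (q * ?x) \<le> t * Re (d * cnj z)"
    using q t by (intro mult_left_mono) auto
  moreover have "?x\<^sup>2 + t\<^sup>2 + 2 * (t * - (q * ?x)) = ?k * (?x + t)\<^sup>2 + (1 + q) / 2 * (?x - t)\<^sup>2"
    by (simp add: power2_eq_square field_simps)
  moreover have "0 \<le> (1 + q) / 2 * (?x - t)\<^sup>2"
    using q by simp
  moreover have "?k\<^sup>2 * (?x + t)\<^sup>2 \<le> ?k * (?x + t)\<^sup>2"
    using q power_decreasing [of 1 2 ?k] by (intro mult_right_mono) auto
  ultimately have "(?k * (?x + t))\<^sup>2 \<le> (norm (z + of_real t * d))\<^sup>2"
    unfolding power_mult_distrib by linarith
  then show ?thesis by (rule power2_le_imp_le) simp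
qed

locale ray_direction =
  fixes s0 d :: complex and q :: real
  assumes d: "norm d = 1" and q: "- (q * norm (exp s0)) \<le> Re (d * cnj (exp s0))" "0 \<le> q" "q < 1"
begin

lemma norm_point: "0 \<le> t \<Longrightarrow> (1 - q) / 2 * (norm (exp s0) + t) \<le> norm (exp s0 + of_real t * d)"
  using norm_ray_point [OF d q] .

lemma factor_point: "1 + of_real t * (d * exp (- s0)) = (exp s0 + of_real t * d) * exp (- s0)"
  by (simp add: algebra_simps exp_minus)

lemma exp_ray: "0 \<le> t \<Longrightarrow> exp (ray s0 d t) = exp s0 + of_real t * d"
proof -
  assume t: "0 \<le> t"
  have "0 < (1 - q) / 2 * (norm (exp s0) + t)"
    using q t by (intro mult_pos_pos add_pos_nonneg) auto
  then have "exp s0 + of_real t * d \<noteq> 0"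
    using norm_point [OF t] by auto
  then have "1 + of_real t * (d * exp (- s0)) \<noteq> 0"
    by (simp add: factor_point)
  then have "exp (ray s0 d t) = exp s0 * (1 + of_real t * (d * exp (- s0)))"
    by (simp add: ray_def exp_add)
  then show ?thesis by (simp add: algebra_simps exp_minus)
qed

text \<open>If 1 + t d / z were a real x <= 0, then t d = (x - 1) z, so d would be opposite to z and
  Re (d cnj z) = -|z|, which q < 1 forbids.\<close>

lemma not_nonpos:
  assumes "0 \<le> t"
  shows "1 + of_real t * (d * exp (- s0)) \<notin> \<real>\<^sub>\<le>\<^sub>0"
proof
  assume "1 + of_real t * (d * exp (- s0)) \<in> \<real>\<^sub>\<le>\<^sub>0"
  then obtain x where x: "1 + of_real t * (d * exp (- s0)) = of_real x" "x \<le> 0"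
    by (metis nonpos_Reals_cases)
  then have "of_real t * d = of_real (x - 1) * exp s0"
    by (simp add: algebra_simps exp_minus field_simps)
  then have *: "of_real t * (d * cnj (exp s0)) = of_real (x - 1) * (exp s0 * cnj (exp s0))"
    by (simp add: mult.assoc [symmetric])
  have "norm (of_real t * d) = norm (of_real (x - 1) * exp s0)"
    using \<open>of_real t * d = _\<close> by simp
  then have t: "t = (1 - x) * norm (exp s0)"
    using d assms x by (simp add: norm_mult del: of_real_diff norm_exp_eq_Re)
  have "exp s0 * cnj (exp s0) = of_real ((norm (exp s0))\<^sup>2)"
    by (metis complex_norm_square of_real_power)
  then have "of_real t * (d * cnj (exp s0)) = of_real ((x - 1) * (norm (exp s0))\<^sup>2)"
    using * by (simp del: norm_exp_eq_Re)
  then have "Re (of_real t * (d * cnj (exp s0))) = (x - 1) * (norm (exp s0))\<^sup>2"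
    by (metis Re_complex_of_real)
  then have "t * Re (d * cnj (exp s0)) = (x - 1) * (norm (exp s0))\<^sup>2"
    by simp
  moreover have "t * - (q * norm (exp s0)) \<le> t * Re (d * cnj (exp s0))"
    using q assms by (intro mult_left_mono) auto
  ultimately have "0 \<le> (1 - x) * (norm (exp s0))\<^sup>2 * (q - 1)"
    by (simp add: t power2_eq_square algebra_simps del: norm_exp_eq_Re)
  moreover have "0 < (1 - x) * (norm (exp s0))\<^sup>2"
    using x by simp
  ultimately show False
    using q by (simp add: zero_le_mult_iff)
qed

lemma ray_vector_derivative:
  assumes "0 \<le> t"
  shows "(ray s0 d has_vector_derivative d * exp (- ray s0 d t)) (at t)"
proof -
  have "((\<lambda>x. s0 + Ln (1 + x * (d * exp (- s0)))) has_field_derivative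
      d * exp (- s0) / (1 + of_real t * (d * exp (- s0)))) (at (of_real t))"
    using not_nonpos [OF assms] by (auto intro!: derivative_eq_intros simp: field_simps)
  moreover have "d * exp (- s0) / (1 + of_real t * (d * exp (- s0))) = d * exp (- ray s0 d t)"
    unfolding exp_minus [of "ray s0 d t"] exp_ray [OF assms] factor_point by (simp add: exp_minus field_simps)
  ultimately have "((\<lambda>x. s0 + Ln (1 + x * (d * exp (- s0)))) has_field_derivative
      d * exp (- ray s0 d t)) (at (of_real t))" by simp
  from has_vector_derivative_real_field [OF this] show ?thesis
    unfolding ray_def by simp
qed

end

text \<open>
  The modes are integrated from the far end of the segment towards its origin: by the
  condition on the direction, no mode grows relative to exp (a z) on the way back.
\<close>

lemma (in ray_direction) backward_estimate:
  assumes a: "norm a = real n" and W: "entire W" and L: "0 \<le> L" and M: "M > 0"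
    and QH: "0 \<le> Q" "0 \<le> H"
    and dom: "\<And>k. k < n \<Longrightarrow> 0 \<le> Re (d * (rate n a k - a))"
    and res: "\<And>t. 0 \<le> t \<Longrightarrow> t \<le> L \<Longrightarrow>
        norm (exp (- (a * exp (ray s0 d t))) * ((uc_deriv ^^ n) W (ray s0 d t) - a ^ n * W (ray s0 d t)))
        \<le> Q * (\<Sum>i<n. amp a i W (ray s0 d t)) / norm (exp (ray s0 d t)) ^ 2
           + H / norm (exp (ray s0 d t)) ^ (M + 1)"
    and small: "2 * real n ^ 2 * Q \<le> ((1 - q) / 2) ^ 2 * norm (exp s0)"
    and i: "i < n"
  shows "amp a i W s0 \<le> 2 * real n * (real n ^ n * (\<Sum>j<n. amp a j W (ray s0 d L))
            + H / ((1 - q) / 2) ^ (M + 1) / norm (exp s0) ^ M)"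
proof -
  define p where "p = ray s0 d"
  define \<kappa> where "\<kappa> = (1 - q) / 2"
  define r where "r = norm (exp s0)"
  have r: "r > 0" and \<kappa>: "\<kappa> > 0" and n: "n > 0"
    using q i by (auto simp: r_def \<kappa>_def)
  define f where "f k t = exp (- (a * exp (p t))) * mode n a k W (p t)" for k t
  define \<rho> where "\<rho> t = exp (- (a * exp (p t))) * ((uc_deriv ^^ n) W (p t) - a ^ n * W (p t))" for t
  define S where "S t = (\<Sum>k<n. norm (f k t))" for t
  have p': "(p has_vector_derivative d * exp (- p t)) (at t)" if "0 \<le> t" for t
    unfolding p_def by (rule ray_vector_derivative [OF that])
  have f': "(f k has_vector_derivative d * ((rate n a k - a) * f k t + \<rho> t)) (at t)" if t: "0 \<le> t" for k t
  proof -
    have "((\<lambda>s. exp (- (a * exp s)) * mode n a k W s) has_field_derivative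
       exp (p t) * ((rate n a k - a) * f k t + \<rho> t)) (at (p t))"
      by (auto intro!: derivative_eq_intros mode_DERIV [OF n W] simp: f_def \<rho>_def algebra_simps)
    from field_vector_diff_chain_at [OF p' [OF t] this]
    have "(f k has_vector_derivative d * exp (- p t) * (exp (p t) * ((rate n a k - a) * f k t + \<rho> t))) (at t)"
      by (simp add: o_def f_def [abs_def])
    moreover have "d * exp (- p t) * (exp (p t) * y) = d * y" for y
      by (simp add: exp_minus)
    ultimately show ?thesis by simp
  qed
  have cont_f: "continuous_on {0..L} (f k)" for k
    by (intro continuous_at_imp_continuous_on ballI has_vector_derivative_continuous [OF f']) auto
  then have "continuous_on {0..L} S"
    unfolding S_def by (intro continuous_intros)
  \<comment> \<open>Only the part of the segment beyond the maximiser t0 is integrated. The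
    perturbation is then bounded by the supremum itself, and can be absorbed at the end.\<close>
  then obtain t0 where t0: "0 \<le> t0" "t0 \<le> L" "\<And>t. 0 \<le> t \<Longrightarrow> t \<le> L \<Longrightarrow> S t \<le> S t0"
    using continuous_attains_sup [of "{0..L}" S] L by auto
  have S0: "0 \<le> S t0" by (simp add: S_def sum_nonneg)
  define A where "A = Q * real n * S t0 / \<kappa>\<^sup>2"
  define B where "B = H / \<kappa> ^ (M + 1)"
  have AB: "0 \<le> A" "0 \<le> B"
    using QH \<kappa> S0 by (auto simp: A_def B_def)
  have \<rho>_le: "norm (\<rho> t) \<le> A / (r + t)\<^sup>2 + B / (r + t) ^ (M + 1)" if t: "0 \<le> t" "t \<le> L" for t
  proof -
    have pt: "\<kappa> * (r + t) \<le> norm (exp (p t))"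
      unfolding p_def exp_ray [OF t(1)] \<kappa>_def r_def by (rule norm_point [OF t(1)])
    have pos: "0 < \<kappa> * (r + t)"
      using r t \<kappa> by simp
    have "(\<Sum>i<n. amp a i W (p t)) \<le> (\<Sum>i<n. S t)"
      unfolding S_def f_def by (intro sum_mono amp_le_modes [OF a]) auto
    also have "\<dots> \<le> real n * S t0"
      using t0(3) [OF t] by (simp add: mult_left_mono)
    finally have "Q * (\<Sum>i<n. amp a i W (p t)) \<le> Q * (real n * S t0)"
      using QH by (intro mult_left_mono)
    then have "Q * (\<Sum>i<n. amp a i W (p t)) / norm (exp (p t)) ^ 2 \<le> Q * (real n * S t0) / (\<kappa> * (r + t))\<^sup>2"
      using pos pt S0 QH by (intro frac_le power_mono) auto
    moreover have "H / norm (exp (p t)) ^ (M + 1) \<le> H / (\<kappa> * (r + t)) ^ (M + 1)"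
      using pos pt QH by (intro frac_le power_mono) auto
    ultimately have "norm (\<rho> t) \<le> Q * (real n * S t0) / (\<kappa> * (r + t))\<^sup>2 + H / (\<kappa> * (r + t)) ^ (M + 1)"
      using res [OF t] unfolding \<rho>_def p_def by linarith
    also have "\<dots> = A / (r + t)\<^sup>2 + B / (r + t) ^ (M + 1)"
      by (simp add: A_def B_def power_mult_distrib mult.assoc)
    finally show ?thesis .
  qed
  have fk: "norm (f k t0) \<le> norm (f k L) + (A / r + B / r ^ M)" if k: "k < n" for k
  proof (cases "t0 = L")
    case True
    then show ?thesis using AB r by simp
  next
    case False
    then have tL: "t0 < L" using t0 by simp
    define \<mu> where "\<mu> = d * (rate n a k - a)"
    \<comment> \<open>Integrating factor, normalised to 1 at t0. Its modulus is at most 1 for t >=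
      t0 because Re \<mu> >= 0.\<close>
    define g where "g t = exp (- \<mu> * of_real (t - t0)) * f k t" for t
    have g': "(g has_vector_derivative exp (- \<mu> * of_real (t - t0)) * (d * \<rho> t)) (at t)" if t: "t0 < t" for t
    proof -
      have "((\<lambda>x. exp (- \<mu> * (x - of_real t0))) has_field_derivative - \<mu> * exp (- \<mu> * (of_real t - of_real t0))) (at (of_real t))"
        by (auto intro!: derivative_eq_intros)
      from has_vector_derivative_real_field [OF this]
      have "((\<lambda>t. exp (- \<mu> * of_real (t - t0))) has_vector_derivative - \<mu> * exp (- \<mu> * of_real (t - t0))) (at t)"
        by simp
      from has_vector_derivative_mult [OF this f' [of t k]] t t0
      show ?thesis
        unfolding g_def by (simp add: \<mu>_def algebra_simps)
    qed
    \<comment> \<open>A primitive of a majorant of |\<rho>|. The second term is not divided by M, so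
      its derivative carries a factor M >= 1, which only enlarges it.\<close>
    define \<phi> where "\<phi> t = - A / (r + t) - B / (r + t) ^ M" for t
    have \<phi>': "(\<phi> has_vector_derivative A / (r + t)\<^sup>2 + real M * B / (r + t) ^ (M + 1)) (at t)" if t: "t0 < t" for t
    proof -
      have nz: "r + t \<noteq> 0" using r t t0 by simp
      have "((\<lambda>t. (r + t) ^ M) has_real_derivative real M * (r + t) ^ (M - 1)) (at t)"
        by (auto intro!: derivative_eq_intros)
      from DERIV_cmult [OF DERIV_inverse_fun [OF this], of "- B"] nz
      have "((\<lambda>t. - B * inverse ((r + t) ^ M)) has_real_derivative
          - B * - (real M * (r + t) ^ (M - 1) * inverse (((r + t) ^ M) ^ Suc (Suc 0)))) (at t)"
        by simp
      moreover have "- B * - (real M * y ^ (M - 1) * inverse ((y ^ M) ^ Suc (Suc 0))) = real M * B / y ^ (M + 1)"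
        if "y \<noteq> 0" for y :: real
        using that M by (cases M) (auto simp: field_simps)
      ultimately have "((\<lambda>t. - B * inverse ((r + t) ^ M)) has_real_derivative real M * B / (r + t) ^ (M + 1)) (at t)"
        using nz by metis
      moreover have "((\<lambda>t. - A / (r + t)) has_real_derivative A / (r + t)\<^sup>2) (at t)"
        using nz by (auto intro!: derivative_eq_intros simp: power2_eq_square)
      ultimately have "(\<phi> has_real_derivative A / (r + t)\<^sup>2 + real M * B / (r + t) ^ (M + 1)) (at t)"
        using DERIV_add by (fastforce simp: \<phi>_def [abs_def] divide_inverse)
      then show ?thesis by (simp add: has_real_derivative_iff_has_vector_derivative)
    qed
    have "norm (g L - g t0) \<le> \<phi> L - \<phi> t0"
    proof (rule differentiable_bound_general [OF tL, where f' = "\<lambda>t. exp (- \<mu> * of_real (t - t0)) * (d * \<rho> t)"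
            and \<phi>' = "\<lambda>t. A / (r + t)\<^sup>2 + real M * B / (r + t) ^ (M + 1)"])
      show "continuous_on {t0..L} g"
        unfolding g_def using t0 by (intro continuous_intros continuous_on_subset [OF cont_f]) auto
      show "continuous_on {t0..L} \<phi>"
        unfolding \<phi>_def using t0 r by (intro continuous_intros) (auto simp: add_pos_nonneg)
      show "norm (exp (- \<mu> * of_real (t - t0)) * (d * \<rho> t)) \<le> A / (r + t)\<^sup>2 + real M * B / (r + t) ^ (M + 1)"
        if t: "t0 < t" "t < L" for t
      proof -
        have "0 \<le> Re \<mu> * (t - t0)"
          using dom [OF k] t by (intro mult_nonneg_nonneg) (auto simp: \<mu>_def)
        then have "norm (exp (- \<mu> * of_real (t - t0))) \<le> 1"
          by simp
        then have "norm (exp (- \<mu> * of_real (t - t0)) * (d * \<rho> t)) \<le> 1 * norm (\<rho> t)"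
          unfolding norm_mult d by (intro mult_mono) auto
        also have "\<dots> \<le> A / (r + t)\<^sup>2 + 1 * B / (r + t) ^ (M + 1)"
          using \<rho>_le [of t] t t0 by simp
        also have "\<dots> \<le> A / (r + t)\<^sup>2 + real M * B / (r + t) ^ (M + 1)"
          using M AB r t t0 by (intro add_left_mono divide_right_mono mult_right_mono) auto
        finally show ?thesis .
      qed
    qed (use g' \<phi>' in auto)
    moreover have "g t0 = f k t0" by (simp add: g_def)
    moreover have "norm (g L) \<le> norm (f k L)"
    proof -
      have "0 \<le> Re \<mu> * (L - t0)"
        using dom [OF k] tL by (intro mult_nonneg_nonneg) (auto simp: \<mu>_def)
      then have "norm (exp (- \<mu> * of_real (L - t0))) \<le> 1" by simp
      then show ?thesis
        unfolding g_def norm_mult by (intro mult_left_le_one_le) auto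
    qed
    moreover have "\<phi> L \<le> 0"
    proof -
      have "0 \<le> A / (r + L)" "0 \<le> B / (r + L) ^ M"
        using AB r L by (auto intro!: divide_nonneg_nonneg)
      then show ?thesis by (simp add: \<phi>_def)
    qed
    moreover have "- \<phi> t0 \<le> A / r + B / r ^ M"
    proof -
      have "A / (r + t0) \<le> A / r" "B / (r + t0) ^ M \<le> B / r ^ M"
        using AB r t0 by (auto intro!: divide_left_mono power_mono)
      then show ?thesis by (simp add: \<phi>_def)
    qed
    ultimately show ?thesis
      using norm_triangle_ineq2 [of "g t0" "g L"] by (simp add: norm_minus_commute)
  qed
  have "S t0 \<le> (\<Sum>k<n. norm (f k L) + (A / r + B / r ^ M))"
    unfolding S_def by (intro sum_mono fk) auto
  also have "\<dots> = S L + real n * (A / r) + real n * (B / r ^ M)"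
    by (simp add: S_def sum.distrib algebra_simps)
  \<comment> \<open>The smallness hypothesis enters here: n A / r = n^2 Q S(t0) / (\<kappa>^2 r) is
    at most half of S(t0).\<close>
  also have "real n * (A / r) \<le> S t0 / 2"
  proof -
    have "2 * real n ^ 2 * Q * S t0 \<le> (\<kappa>\<^sup>2 * r) * S t0"
      using small S0 by (intro mult_right_mono) (auto simp: \<kappa>_def r_def)
    then show ?thesis
      using \<kappa> r by (simp add: A_def field_simps power2_eq_square)
  qed
  finally have *: "S t0 \<le> 2 * (S L + real n * (B / r ^ M))" by simp
  have "amp a i W s0 \<le> S 0"
    using amp_le_modes [OF a i, of W s0] by (simp add: S_def f_def p_def)
  also have "\<dots> \<le> S t0" using t0 L by simp
  also note *
  also have "S L \<le> real n * (real n ^ n * (\<Sum>j<n. amp a j W (p L)))"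
    unfolding S_def f_def by (rule modes_le_amp [OF a])
  finally show ?thesis
    by (simp add: B_def \<kappa>_def r_def p_def algebra_simps)
qed

section \<open>Initial value problems\<close>

text \<open>Taylor coefficients of a solution of W^(n) = (sum over j < n of p_j W^(j)), from
  comparing the coefficients of order N - n. The recursion descends because N - n - i + j < N for j
  < n.\<close>

function ode_coeffs :: "nat \<Rightarrow> (nat \<Rightarrow> complex fps) \<Rightarrow> (nat \<Rightarrow> complex) \<Rightarrow> nat \<Rightarrow> complex" where
  "ode_coeffs n p c N = (if N < n then c N else
     fact (N - n) / fact N * (\<Sum>j<n. \<Sum>i\<le>N - n. fps_nth (p j) i *
        (fact (N - n - i + j) / fact (N - n - i) * ode_coeffs n p c (N - n - i + j))))"
  by pat_completeness auto
termination
  by (relation "Wellfounded.measure (\<lambda>(n, p, c, N). N)") auto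

declare ode_coeffs.simps [simp del]

lemma fps_nth_derivs: "fps_nth ((fps_deriv ^^ j) F) k = fact (k + j) / fact k * fps_nth F (k + j)"
  for F :: "complex fps"
proof (induction j arbitrary: k)
  case (Suc j)
  have "fps_nth ((fps_deriv ^^ Suc j) F) k = of_nat (Suc k) * (fact (Suc k + j) / fact (Suc k) * fps_nth F (Suc k + j))"
    using Suc.IH [of "Suc k"] by simp
  also have "\<dots> = fact (k + Suc j) / fact k * fps_nth F (k + Suc j)"
    by (simp add: divide_simps del: of_nat_Suc)
  finally show ?case .
qed simp

lemma ode_coeffs_fps:
  assumes "F = Abs_fps (ode_coeffs n p c)"
  shows "(fps_deriv ^^ n) F = (\<Sum>j<n. p j * (fps_deriv ^^ j) F)"
proof (rule fps_ext)
  fix k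
  have "fps_nth F (k + n) = fact k / fact (k + n) * (\<Sum>j<n. \<Sum>i\<le>k. fps_nth (p j) i *
        (fact (k - i + j) / fact (k - i) * fps_nth F (k - i + j)))"
    unfolding assms fps_nth_Abs_fps by (subst ode_coeffs.simps) simp
  then show "fps_nth ((fps_deriv ^^ n) F) k = fps_nth (\<Sum>j<n. p j * (fps_deriv ^^ j) F) k"
    by (simp add: fps_nth_derivs fps_sum_nth fps_mult_nth atLeast0AtMost)
qed

text \<open>The left side is largest at m = k and j = n - 1, where it equals 1/(k + n). This decay
  makes the power series converge at every radius.\<close>

lemma fact_quotient_le:
  assumes "m \<le> k" "j < n"
  shows "fact k / fact (k + n) * (fact (m + j) / fact m) \<le> 1 / real (k + n)"
proof -
  have 1: "fact (m + j) * fact k \<le> (fact m * fact (k + j) :: real)"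
  proof (induction j)
    case (Suc j)
    have "real (Suc (m + j)) * (fact (m + j) * fact k) \<le> real (Suc (k + j)) * (fact m * fact (k + j))"
      using assms Suc.IH by (rule_tac mult_mono) auto
    then show ?case by (simp add: algebra_simps)
  qed simp
  obtain n' where n': "k + n = Suc n'" "k + j \<le> n'"
    using assms by (cases "k + n") auto
  have "fact (k + j) \<le> (fact n' :: real)"
    using n' by (intro fact_mono) auto
  then have "fact m * fact (k + j) \<le> (fact m * fact n' :: real)"
    by (intro mult_left_mono) auto
  with 1 have "fact (m + j) * fact k \<le> (fact m * fact n' :: real)" by linarith
  then show ?thesis
    by (simp add: n' field_simps del: of_nat_Suc)
qed

text \<open>The recursion bounds the N-th weighted coefficient by A/N times a bound for the earlier
  ones. Once N >= A that bound is inherited, so an initial part bounds the whole sequence. A is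
  finite for every r because the p_j are entire.\<close>

lemma ode_coeffs_bounded:
  assumes p: "\<And>j. j < n \<Longrightarrow> fps_conv_radius (p j) = \<infinity>" and r: "r > 0"
  shows "\<exists>B. \<forall>N. norm (ode_coeffs n p c N) * r ^ N \<le> B"
proof -
  define F where "F = ode_coeffs n p c"
  define P where "P j = (\<Sum>i. norm (fps_nth (p j) i * of_real r ^ i))" for j
  have smb: "summable (\<lambda>i. norm (fps_nth (p j) i * of_real r ^ i))" if "j < n" for j
    using p [OF that] by (intro norm_summable_fps) auto
  have P0: "P j \<ge> 0" if "j < n" for j
    unfolding P_def by (intro suminf_nonneg smb that) auto
  define A where "A = (\<Sum>j<n. r ^ (n - j) * P j)"
  have A0: "A \<ge> 0"
    unfolding A_def using P0 r by (intro sum_nonneg mult_nonneg_nonneg) auto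
  \<comment> \<open>From K on, both N >= n, so that the recursion applies, and N >= A.\<close>
  define K where "K = nat \<lceil>A\<rceil> + n + 1"
  define B where "B = (\<Sum>N<K. norm (F N) * r ^ N)"
  have B0: "B \<ge> 0"
    unfolding B_def using r by (intro sum_nonneg) auto
  have "norm (F N) * r ^ N \<le> B" for N
  proof (induction N rule: less_induct)
    case (less N)
    show ?case
    proof (cases "N < K")
      case True
      then show ?thesis
        unfolding B_def using r by (intro member_le_sum) auto
    next
      case False
      define k where "k = N - n"
      have N: "N = k + n" and NA: "A \<le> real N"
        using False by (simp_all add: K_def k_def) linarith
      have Npos: "0 < real (k + n)"
        using False by (simp add: K_def N)
      have "F N = (\<Sum>j<n. \<Sum>i\<le>k. fact k / fact (k + n) * (fps_nth (p j) i *
        (fact (k - i + j) / fact (k - i) * F (k - i + j))))"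
        unfolding F_def by (subst ode_coeffs.simps) (simp add: N sum_distrib_left)
      then have "norm (F N) * r ^ N = norm (\<Sum>j<n. \<Sum>i\<le>k. fact k / fact (k + n) * (fps_nth (p j) i *
        (fact (k - i + j) / fact (k - i) * F (k - i + j)))) * r ^ N"
        by simp
      also have "\<dots> \<le> (\<Sum>j<n. \<Sum>i\<le>k. norm (fact k / fact (k + n) * (fps_nth (p j) i *
        (fact (k - i + j) / fact (k - i) * F (k - i + j))))) * r ^ N"
        using r by (intro mult_right_mono sum_norm_le order_refl) (auto intro: norm_sum)
      also have "\<dots> = (\<Sum>j<n. \<Sum>i\<le>k. norm (fact k / fact (k + n) * (fps_nth (p j) i *
        (fact (k - i + j) / fact (k - i) * F (k - i + j)))) * r ^ N)"
        by (simp add: sum_distrib_right)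
      also have "\<dots> \<le> (\<Sum>j<n. \<Sum>i\<le>k. 1 / real (k + n) * (r ^ (n - j) * norm (fps_nth (p j) i * of_real r ^ i) * B))"
      proof (intro sum_mono)
        fix j i assume "j \<in> {..<n}" "i \<in> {..k}"
        then have ji: "j < n" "i \<le> k" by auto
        have pw: "r ^ N = r ^ i * r ^ (n - j) * r ^ (k - i + j)"
          using ji by (simp add: N power_add [symmetric] add.commute)
        have "norm (fact k / fact (k + n) * (fps_nth (p j) i *
            (fact (k - i + j) / fact (k - i) * F (k - i + j)))) * r ^ N
          = (fact k / fact (k + n) * (fact (k - i + j) / fact (k - i))) *
            (r ^ (n - j) * norm (fps_nth (p j) i * of_real r ^ i) * (norm (F (k - i + j)) * r ^ (k - i + j)))"
          unfolding pw using r by (simp add: norm_mult norm_divide norm_power)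
        also have "\<dots> \<le> 1 / real (k + n) * (r ^ (n - j) * norm (fps_nth (p j) i * of_real r ^ i) * B)"
          using r ji N Npos by (intro mult_mono fact_quotient_le less.IH mult_nonneg_nonneg) auto
        finally show "norm (fact k / fact (k + n) * (fps_nth (p j) i *
            (fact (k - i + j) / fact (k - i) * F (k - i + j)))) * r ^ N
          \<le> 1 / real (k + n) * (r ^ (n - j) * norm (fps_nth (p j) i * of_real r ^ i) * B)" .
      qed
      also have "\<dots> = 1 / real (k + n) * ((\<Sum>j<n. r ^ (n - j) * (\<Sum>i\<le>k. norm (fps_nth (p j) i * of_real r ^ i))) * B)"
        by (simp add: sum_distrib_left sum_distrib_right mult.assoc)
      also have "\<dots> \<le> 1 / real (k + n) * (A * B)"
        unfolding A_def P_def using r Npos B0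
        by (intro mult_left_mono mult_right_mono sum_mono sum_le_suminf smb) auto
      also have "\<dots> \<le> 1 / real (k + n) * (real (k + n) * B)"
        using NA Npos B0 N by (intro mult_left_mono mult_right_mono) auto
      also have "\<dots> = B" using Npos by simp
      finally show ?thesis .
    qed
  qed
  then show ?thesis unfolding F_def by blast
qed

lemma fps_conv_radius_ode_coeffs:
  assumes "\<And>j. j < n \<Longrightarrow> fps_conv_radius (p j) = \<infinity>"
  shows "fps_conv_radius (Abs_fps (ode_coeffs n p c)) = \<infinity>"
proof -
  have "conv_radius (ode_coeffs n p c) \<ge> \<infinity>"
  proof (rule conv_radius_geI_ex)
    fix r :: real assume r: "0 < r"
    \<comment> \<open>The bound at radius 2 r gives a geometric majorant of ratio 1/2 at radius
      r.\<close>
    obtain B where B: "\<And>N. norm (ode_coeffs n p c N) * (2 * r) ^ N \<le> B"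
      using ode_coeffs_bounded [of n p "2 * r" c] assms r by auto
    have "summable (\<lambda>N. ode_coeffs n p c N * of_real r ^ N)"
    proof (rule summable_comparison_test')
      show "summable (\<lambda>N. B * (1 / 2) ^ N)" by (intro summable_mult summable_geometric) auto
      show "norm (ode_coeffs n p c N * of_real r ^ N) \<le> B * (1 / 2) ^ N" if "N \<ge> 0" for N
        using B [of N] r by (simp add: norm_mult norm_power power_mult_distrib field_simps)
    qed
    then show "\<exists>z. norm z = r \<and> summable (\<lambda>N. ode_coeffs n p c N * z ^ N)"
      using r by (intro exI [of _ "of_real r"]) auto
  qed
  then show ?thesis by (simp add: fps_conv_radius_def)
qed

lemma fps_conv_radius_derivs:
  "fps_conv_radius F = \<infinity> \<Longrightarrow> fps_conv_radius ((fps_deriv ^^ j) F) = \<infinity>" for F :: "complex fps"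
proof (induction j)
  case (Suc j)
  then show ?case
    using fps_conv_radius_deriv [of "(fps_deriv ^^ j) F"] by simp
qed simp

lemma DERIV_eval_fps_shift:
  fixes F :: "complex fps"
  assumes "fps_conv_radius F = \<infinity>"
  shows "((\<lambda>s. eval_fps F (s - s0)) has_field_derivative eval_fps (fps_deriv F) (s - s0)) (at s)"
proof -
  have "(eval_fps F has_field_derivative eval_fps (fps_deriv F) (s - s0)) (at (s - s0))"
    by (rule has_field_derivative_eval_fps) (simp add: assms)
  moreover have "((\<lambda>s. s - s0) has_field_derivative 1) (at s)"
    by (auto intro!: derivative_eq_intros)
  ultimately show ?thesis
    using DERIV_chain2 by fastforce
qed

lemma deriv_eval_fps:
  fixes F :: "complex fps"
  assumes "fps_conv_radius F = \<infinity>"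
  shows "(deriv ^^ j) (\<lambda>s. eval_fps F (s - s0)) = (\<lambda>s. eval_fps ((fps_deriv ^^ j) F) (s - s0))"
proof (induction j)
  case (Suc j)
  show ?case
    using DERIV_eval_fps_shift [OF fps_conv_radius_derivs [OF assms, of j]]
    by (auto simp: Suc.IH intro!: ext DERIV_imp_deriv)
qed simp

text \<open>In the coordinate log z the cover is a single complex plane, so an everywhere convergent
  series is a global solution.\<close>

lemma linear_ode_exists:
  assumes p: "\<And>j. j < n \<Longrightarrow> fps_conv_radius (p j) = \<infinity>"
  shows "\<exists>W. entire W \<and> (\<forall>i<n. (deriv ^^ i) W s0 = c i) \<and>
    (\<forall>s. (deriv ^^ n) W s = (\<Sum>j<n. eval_fps (p j) (s - s0) * (deriv ^^ j) W s))"
proof (intro exI conjI allI impI)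
  define F where "F = Abs_fps (ode_coeffs n p (\<lambda>i. c i / fact i))"
  define W where "W s = eval_fps F (s - s0)" for s
  have rF: "fps_conv_radius F = \<infinity>"
    unfolding F_def by (rule fps_conv_radius_ode_coeffs [OF p])
  have eq: "(fps_deriv ^^ n) F = (\<Sum>j<n. p j * (fps_deriv ^^ j) F)"
    by (rule ode_coeffs_fps [OF F_def])
  have dW: "(deriv ^^ j) W = (\<lambda>s. eval_fps ((fps_deriv ^^ j) F) (s - s0))" for j
    unfolding W_def [abs_def] by (rule deriv_eval_fps [OF rF])
  show "entire W"
    unfolding W_def [abs_def] holomorphic_on_def field_differentiable_def
    using DERIV_eval_fps_shift [OF rF] by blast
  show "(deriv ^^ i) W s0 = c i" if "i < n" for i
    using that by (simp add: dW eval_fps_at_0 fps_nth_derivs F_def ode_coeffs.simps)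
  have rp: "fps_conv_radius (p j * (fps_deriv ^^ j) F) = \<infinity>" if "j < n" for j
    using fps_conv_radius_mult [of "p j" "(fps_deriv ^^ j) F"] p [OF that] fps_conv_radius_derivs [OF rF, of j] by simp
  \<comment> \<open>Evaluating a sum of series termwise requires the radius of the partial sums, so
    both claims go through one induction.\<close>
  have ev: "fps_conv_radius (\<Sum>j\<in>J. p j * (fps_deriv ^^ j) F) = \<infinity> \<and>
     eval_fps (\<Sum>j\<in>J. p j * (fps_deriv ^^ j) F) x = (\<Sum>j\<in>J. eval_fps (p j) x * eval_fps ((fps_deriv ^^ j) F) x)"
    if "finite J" "J \<subseteq> {..<n}" for J x
    using that
  proof (induction J rule: finite_induct)
    case (insert j J)
    let ?u = "p j * (fps_deriv ^^ j) F" and ?v = "\<Sum>j\<in>J. p j * (fps_deriv ^^ j) F"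
    have "fps_conv_radius (?u + ?v) = \<infinity>"
      using fps_conv_radius_add [of ?u ?v] insert rp [of j] by simp
    then show ?case
      using insert rp [of j] p [of j] fps_conv_radius_derivs [OF rF, of j]
      by (simp add: eval_fps_add eval_fps_mult)
  qed simp
  show "(deriv ^^ n) W s = (\<Sum>j<n. eval_fps (p j) (s - s0) * (deriv ^^ j) W s)" for s
    using ev [of "{..<n}"] by (simp add: dW eq)
qed

lemma exp_power_mult_sum:
  fixes s :: complex
  shows "exp s ^ n * (\<Sum>l\<le>n. g l * exp (- s) ^ (n - l) * f l) = (\<Sum>l\<le>n. g l * (exp s ^ l * f l))"
  unfolding sum_distrib_left
proof (intro sum.cong refl)
  fix l assume "l \<in> {..n}"
  then have "exp s ^ n = exp s ^ l * exp s ^ (n - l)"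
    by (simp add: power_add [symmetric])
  then show "exp s ^ n * (g l * exp (- s) ^ (n - l) * f l) = g l * (exp s ^ l * f l)"
    by (simp add: exp_minus power_inverse)
qed

text \<open>The shape of the Bessel equation after division by z^n and removal of the power of z,
  with z = exp s. The term a^n W stands apart because it balances W^(n) at infinity.\<close>

definition euler_solution :: "nat \<Rightarrow> complex \<Rightarrow> (nat \<Rightarrow> complex) \<Rightarrow> (complex \<Rightarrow> complex) \<Rightarrow> bool" where
  "euler_solution n a g W \<longleftrightarrow> entire W \<and>
     (\<forall>s. (\<Sum>l\<le>n. g l * exp (- s) ^ (n - l) * (uc_deriv ^^ l) W s) = a ^ n * W s)"

text \<open>After multiplication by z^n and expansion in d/d(log z) all coefficients are constant,
  except that of a^n z^n W, and z^n = exp (n s) is entire in s.\<close>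

lemma euler_solution_exists:
  assumes "n > 0" "g n = 1"
  shows "\<exists>W. euler_solution n a g W \<and> (\<forall>i<n. (deriv ^^ i) W s0 = c i)"
proof -
  \<comment> \<open>\<alpha> i is minus the coefficient of the i-th derivative in log z. The series
    are centred at s0, whence the constant exp (n s0) in p.\<close>
  define \<alpha> where "\<alpha> i = - (\<Sum>l\<le>n. g l * falling_coeff l i)" for i
  define p where "p i = fps_const (\<alpha> i) +
    (if i = 0 then fps_const (a ^ n * exp (of_nat n * s0)) * fps_exp (of_nat n) else 0)" for i :: nat
  have rp0: "fps_conv_radius (fps_const (a ^ n * exp (of_nat n * s0)) * fps_exp (of_nat n)) = \<infinity>"
    using fps_conv_radius_mult [of "fps_const (a ^ n * exp (of_nat n * s0))" "fps_exp (of_nat n)"] by simp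
  have rp: "fps_conv_radius (p i) = \<infinity>" for i
    using fps_conv_radius_add [of "fps_const (\<alpha> i)" "fps_const (a ^ n * exp (of_nat n * s0)) * fps_exp (of_nat n)"] rp0
    by (cases "i = 0") (simp_all add: p_def)
  have ep: "eval_fps (p i) (s - s0) = \<alpha> i + (if i = 0 then a ^ n * exp s ^ n else 0)" for i s
    using rp0 by (simp add: p_def eval_fps_add eval_fps_mult exp_of_nat_mult [symmetric] exp_add [symmetric] algebra_simps)
  obtain W where W: "entire W" "\<forall>i<n. (deriv ^^ i) W s0 = c i"
    and eq: "\<And>s. (deriv ^^ n) W s = (\<Sum>j<n. eval_fps (p j) (s - s0) * (deriv ^^ j) W s)"
    using linear_ode_exists [of n p s0 c] rp by blast
  have "(\<Sum>l\<le>n. g l * exp (- s) ^ (n - l) * (uc_deriv ^^ l) W s) = a ^ n * W s" for s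
  proof -
    have "exp s ^ n * (\<Sum>l\<le>n. g l * exp (- s) ^ (n - l) * (uc_deriv ^^ l) W s)
        = (\<Sum>l\<le>n. g l * (exp s ^ l * (uc_deriv ^^ l) W s))"
      by (rule exp_power_mult_sum)
    also have "\<dots> = (\<Sum>l\<le>n. g l * (\<Sum>i\<le>n. falling_coeff l i * (deriv ^^ i) W s))"
    proof (intro sum.cong refl arg_cong [of _ _ "(*) _"])
      fix l assume "l \<in> {..n}"
      then show "exp s ^ l * (uc_deriv ^^ l) W s = (\<Sum>i\<le>n. falling_coeff l i * (deriv ^^ i) W s)"
        unfolding uc_derivs_eq_derivs [OF W(1)]
        by (intro sum.mono_neutral_left) (auto simp: falling_coeff_gt)
    qed
    also have "\<dots> = (\<Sum>i\<le>n. - \<alpha> i * (deriv ^^ i) W s)"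
      by (simp add: \<alpha>_def sum_distrib_left sum_distrib_right mult.assoc) (rule sum.swap)
    also have "\<dots> = (deriv ^^ n) W s - (\<Sum>i<n. \<alpha> i * (deriv ^^ i) W s)"
    proof -
      have "\<alpha> n = - (\<Sum>l\<le>n. if l = n then 1 else 0)"
        unfolding \<alpha>_def using assms by (intro arg_cong [of _ _ uminus] sum.cong) (auto simp: falling_coeff_gt falling_coeff_same)
      then have "\<alpha> n = -1" by simp
      then show ?thesis
        by (simp add: lessThan_Suc_atMost [symmetric] sum_negf)
    qed
    also have "\<dots> = (\<Sum>i<n. if i = 0 then a ^ n * exp s ^ n * W s else 0)"
      unfolding eq ep sum_subtractf [symmetric] by (intro sum.cong) (auto simp: algebra_simps)
    also have "\<dots> = exp s ^ n * (a ^ n * W s)"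
      using assms by simp
    finally show ?thesis by simp
  qed
  with W show ?thesis
    unfolding euler_solution_def by blast
qed

section \<open>Coefficients of the Bessel equation\<close>

text \<open>Stirling numbers of the second kind S(k, j) in closed form. The term r = 0 is included,
  with 0^0 = 1, so that the recurrence holds from j = 0 on.\<close>

definition stirling_sum :: "nat \<Rightarrow> nat \<Rightarrow> complex" where
  "stirling_sum j k = (\<Sum>r\<le>j. (-1) ^ (j - r) * of_nat r ^ k / (fact r * fact (j - r)))"

lemma stirling_sum_0_right: "stirling_sum j 0 = (if j = 0 then 1 else 0)"
proof -
  have "(\<Sum>r\<le>j. of_nat (j choose r) * 1 ^ r * (-1) ^ (j - r) :: complex) = (1 + (-1)) ^ j"
    by (rule binomial_ring [symmetric])
  moreover have "(\<Sum>r\<le>j. of_nat (j choose r) * 1 ^ r * (-1) ^ (j - r) :: complex) = fact j * stirling_sum j 0"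
    unfolding stirling_sum_def sum_distrib_left by (intro sum.cong) (auto simp: binomial_fact)
  ultimately have "fact j * stirling_sum j 0 = (1 + (-1)) ^ j" by simp
  then show ?thesis by (cases "j = 0") (simp_all add: power_0_left)
qed

text \<open>In the difference each term gets the factor r - (j + 1), which kills r = j + 1 and
  cancels against (j + 1 - r)! otherwise.\<close>

lemma stirling_sum_Suc:
  "stirling_sum (Suc j) (Suc k) = of_nat (Suc j) * stirling_sum (Suc j) k + stirling_sum j k"
proof -
  let ?t = "\<lambda>r. (-1) ^ (Suc j - r) * of_nat r ^ k / (fact r * fact (Suc j - r)) :: complex"
  have "stirling_sum (Suc j) (Suc k) - of_nat (Suc j) * stirling_sum (Suc j) k
      = (\<Sum>r\<le>Suc j. ?t r * (of_nat r - of_nat (Suc j)))"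
    unfolding stirling_sum_def sum_distrib_left sum_subtractf [symmetric]
    by (intro sum.cong) (simp_all add: right_diff_distrib left_diff_distrib diff_divide_distrib mult_ac)
  also have "\<dots> = (\<Sum>r\<le>j. ?t r * (of_nat r - of_nat (Suc j)))"
    by simp
  also have "\<dots> = stirling_sum j k"
    unfolding stirling_sum_def
  proof (intro sum.cong refl)
    fix r assume "r \<in> {..j}"
    then obtain i where j: "j = r + i" by (auto simp: le_iff_add)
    have "fact (Suc i) = (of_nat (Suc i) * fact i :: complex)" by simp
    then show "?t r * (of_nat r - of_nat (Suc j)) = (-1) ^ (j - r) * of_nat r ^ k / (fact r * fact (j - r))"
      unfolding j by (simp add: Suc_diff_le divide_simps del: fact_Suc of_nat_Suc) (simp add: algebra_simps)
  qed
  finally show ?thesis by (simp add: algebra_simps)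
qed

lemma stirling_sum_0_left: "stirling_sum 0 k = (if k = 0 then 1 else 0)"
  by (simp add: stirling_sum_def)

lemma stirling_sum_less: "k < j \<Longrightarrow> stirling_sum j k = 0"
proof (induction k arbitrary: j)
  case (Suc k)
  then show ?case by (cases j) (auto simp: stirling_sum_Suc)
qed (simp add: stirling_sum_0_right)

lemma stirling_sum_same: "stirling_sum j j = 1"
  by (induction j) (auto simp: stirling_sum_Suc stirling_sum_less stirling_sum_0_left)

lemma stirling_sum_Suc_same: "stirling_sum j (Suc j) = of_nat j * (of_nat j + 1) / 2"
  by (induction j) (auto simp: stirling_sum_Suc [of _ "Suc _"] stirling_sum_same stirling_sum_0_left field_simps)

text \<open>So these are the coefficients of (z d/dz)^(m+j) in terms of z^j (d/dz)^j, and the two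
  top values needed are S(n, n) and S(n, n - 1).\<close>

lemma bessel_A_eq: "bessel_A j m = stirling_sum j (m + j)"
proof (cases j)
  case (Suc i)
  have "{..j} = insert 0 {1..j}" by auto
  then show ?thesis by (simp add: bessel_A_def stirling_sum_def Suc)
qed (simp add: bessel_A_def stirling_sum_def)

section \<open>Size of the coefficients in terms of the index\<close>

lemma index_size_ge_1: "n > 0 \<Longrightarrow> 1 \<le> index_size n lam"
  and norm_le_index_size: "i < n \<Longrightarrow> norm (lam i) \<le> index_size n lam"
proof -
  have le: "norm (lam i) \<le> Max ((\<lambda>l. norm (lam l)) ` {..<n})" if "i < n" for i
    using that by (intro Max_ge) auto
  show "1 \<le> index_size n lam" if "n > 0"
    using order_trans [OF norm_ge_zero le [OF that]] by (simp add: index_size_def)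
  show "norm (lam i) \<le> index_size n lam" if "i < n"
    using le [OF that] by (simp add: index_size_def)
qed

lemma esym_0: "esym n 0 lam = 1"
proof -
  have "{S. S \<subseteq> {..<n} \<and> card S = 0} = {{}}"
    by (auto dest: finite_subset)
  then show ?thesis by (simp add: esym_def)
qed

lemma esym_1: "esym n 1 lam = (\<Sum>i<n. lam i)"
proof -
  have "{S. S \<subseteq> {..<n} \<and> card S = 1} = (\<lambda>i. {i}) ` {..<n}"
    by (auto simp: card_1_singleton_iff)
  then show ?thesis by (simp add: esym_def sum.reindex)
qed

lemma norm_esym_le:
  assumes "n > 0"
  shows "norm (esym n m lam) \<le> 2 ^ n * index_size n lam ^ m"
proof -
  have fin: "finite {S. S \<subseteq> {..<n} \<and> card S = m}"
    by (rule finite_subset [of _ "Pow {..<n}"]) auto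
  have "norm (esym n m lam) \<le> (\<Sum>S | S \<subseteq> {..<n} \<and> card S = m. index_size n lam ^ m)"
    unfolding esym_def
  proof (rule sum_norm_le)
    fix S assume S: "S \<in> {S. S \<subseteq> {..<n} \<and> card S = m}"
    have "norm (\<Prod>i\<in>S. lam i) \<le> (\<Prod>i\<in>S. index_size n lam)"
      unfolding prod_norm [symmetric] using S by (intro prod_mono) (auto intro: norm_le_index_size)
    then show "norm (\<Prod>i\<in>S. lam i) \<le> index_size n lam ^ m"
      using S by simp
  qed
  also have "\<dots> = real (card {S. S \<subseteq> {..<n} \<and> card S = m}) * index_size n lam ^ m" by simp
  also have "card {S. S \<subseteq> {..<n} \<and> card S = m} \<le> card (Pow {..<n})"
    by (intro card_mono) auto
  finally show ?thesis
    using index_size_ge_1 [OF assms, of lam] by (simp add: card_Pow mult_right_mono)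
qed

lemma bessel_V_top: "bessel_V n n lam = 1"
  by (simp add: bessel_V_def bessel_A_eq stirling_sum_same esym_0)

text \<open>The summand m = 1 is a multiple of the sum of the index, which is 0; what remains is
  S(n, n - 1).\<close>

lemma bessel_V_pred:
  assumes "n > 0" "(\<Sum>l<n. lam l) = 0"
  shows "bessel_V n (n - 1) lam = of_nat n * (of_nat n - 1) / 2"
proof -
  have "n - (n - 1) = 1" using assms by simp
  then have "bessel_V n (n - 1) lam = stirling_sum (n - 1) (Suc (n - 1))"
    using esym_1 [of n lam] assms by (simp add: bessel_V_def bessel_A_eq esym_0)
  then show ?thesis
    using assms by (simp add: stirling_sum_Suc_same of_nat_diff del: Suc_pred)
qed

text \<open>V_{n,j} has degree at most n - j in the index, and lower degrees are bounded by the top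
  one because the size is at least 1.\<close>

lemma bessel_V_bounded:
  assumes "n > 0"
  shows "\<exists>K\<ge>0. \<forall>lam. \<forall>j\<le>n. norm (bessel_V n j lam) \<le> K * index_size n lam ^ (n - j)"
proof -
  define k where "k j = (\<Sum>m=0..n-j. norm (bessel_A j (n - j - m)) * real n ^ m * 2 ^ n)" for j
  have k0: "0 \<le> k j" for j by (simp add: k_def sum_nonneg)
  have "norm (bessel_V n j lam) \<le> (\<Sum>j\<le>n. k j) * index_size n lam ^ (n - j)" if j: "j \<le> n" for j lam
  proof -
    have C: "1 \<le> index_size n lam" by (rule index_size_ge_1 [OF assms])
    have "norm (bessel_V n j lam) \<le> (\<Sum>m=0..n-j. norm (bessel_A j (n - j - m)) * real n ^ m * 2 ^ n * index_size n lam ^ (n - j))"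
      unfolding bessel_V_def
    proof (rule sum_norm_le)
      fix m assume m: "m \<in> {0..n - j}"
      have "norm (esym n m lam) \<le> 2 ^ n * index_size n lam ^ m"
        by (rule norm_esym_le [OF assms])
      also have "\<dots> \<le> 2 ^ n * index_size n lam ^ (n - j)"
        using C m by (intro mult_left_mono power_increasing) auto
      finally show "norm (bessel_A j (n - j - m) * of_nat n ^ m * esym n m lam)
          \<le> norm (bessel_A j (n - j - m)) * real n ^ m * 2 ^ n * index_size n lam ^ (n - j)"
        by (simp add: norm_mult norm_power mult.assoc mult_left_mono)
    qed
    also have "\<dots> = k j * index_size n lam ^ (n - j)"
      by (simp add: k_def sum_distrib_right)
    also have "\<dots> \<le> (\<Sum>j\<le>n. k j) * index_size n lam ^ (n - j)"
      using C k0 j by (intro mult_right_mono member_le_sum) auto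
    finally show ?thesis .
  qed
  then show ?thesis
    using k0 by (intro exI [of _ "\<Sum>j\<le>n. k j"]) (auto intro: sum_nonneg)
qed

text \<open>The coefficient of z^(i-n) W^(i) after inserting w = z^b W, b = -(n - 1)/2, into the
  equation divided by z^n.\<close>

definition euler_coeff :: "nat \<Rightarrow> (nat \<Rightarrow> complex) \<Rightarrow> nat \<Rightarrow> complex" where
  "euler_coeff n lam i = (\<Sum>j=i..n. bessel_V n j lam * leibniz_coeff (bessel_expo n) j i)"

lemma euler_coeff_top: "euler_coeff n lam n = 1"
  by (simp add: euler_coeff_def bessel_V_top leibniz_coeff_same)

text \<open>This cancellation is what the exponent of z in the formal solution is for.\<close>

lemma euler_coeff_pred:
  assumes "n > 0" "(\<Sum>l<n. lam l) = 0"
  shows "euler_coeff n lam (n - 1) = 0"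
proof -
  obtain m where n: "n = Suc m" using assms(1) by (cases n) auto
  have "{m..Suc m} = {m, Suc m}" by auto
  then have "euler_coeff n lam (n - 1) = bessel_V n (n - 1) lam + leibniz_coeff (bessel_expo n) (Suc m) m"
    by (simp add: euler_coeff_def n bessel_V_top leibniz_coeff_same del: leibniz_coeff.simps)
  also have "\<dots> = 0"
    unfolding bessel_V_pred [OF assms] leibniz_coeff_pred by (simp add: bessel_expo_def n field_simps)
  finally show ?thesis .
qed

lemma euler_coeff_bounded:
  assumes "n > 0"
  shows "\<exists>K\<ge>0. \<forall>lam. \<forall>j\<le>n. norm (euler_coeff n lam j) \<le> K * index_size n lam ^ (n - j)"
proof -
  obtain K where K: "K \<ge> 0" "\<And>lam j. j \<le> n \<Longrightarrow> norm (bessel_V n j lam) \<le> K * index_size n lam ^ (n - j)"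
    using bessel_V_bounded [OF assms] by blast
  define k where "k i = (\<Sum>j=i..n. K * norm (leibniz_coeff (bessel_expo n) j i))" for i
  have k0: "0 \<le> k i" for i using K(1) by (simp add: k_def sum_nonneg)
  have "norm (euler_coeff n lam i) \<le> (\<Sum>i\<le>n. k i) * index_size n lam ^ (n - i)" if i: "i \<le> n" for i lam
  proof -
    have C: "1 \<le> index_size n lam" by (rule index_size_ge_1 [OF assms])
    have "norm (euler_coeff n lam i) \<le> (\<Sum>j=i..n. K * norm (leibniz_coeff (bessel_expo n) j i) * index_size n lam ^ (n - i))"
      unfolding euler_coeff_def
    proof (rule sum_norm_le)
      fix j assume j: "j \<in> {i..n}"
      have "norm (bessel_V n j lam) \<le> K * index_size n lam ^ (n - j)"
        using j by (intro K(2)) auto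
      also have "\<dots> \<le> K * index_size n lam ^ (n - i)"
        using C K j by (intro mult_left_mono power_increasing) auto
      finally have "norm (bessel_V n j lam) * norm (leibniz_coeff (bessel_expo n) j i)
          \<le> K * index_size n lam ^ (n - i) * norm (leibniz_coeff (bessel_expo n) j i)"
        by (rule mult_right_mono) simp
      then show "norm (bessel_V n j lam * leibniz_coeff (bessel_expo n) j i)
          \<le> K * norm (leibniz_coeff (bessel_expo n) j i) * index_size n lam ^ (n - i)"
        by (simp add: norm_mult mult_ac)
    qed
    also have "\<dots> = k i * index_size n lam ^ (n - i)"
      by (simp add: k_def sum_distrib_right)
    also have "\<dots> \<le> (\<Sum>i\<le>n. k i) * index_size n lam ^ (n - i)"
      using C k0 i by (intro mult_right_mono member_le_sum) auto
    finally show ?thesis .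
  qed
  then show ?thesis
    using k0 by (intro exI [of _ "\<Sum>j\<le>n. k j"]) (auto intro: sum_nonneg)
qed

lemma bessel_operator_exp_mult:
  assumes "entire W"
  shows "(\<Sum>j\<le>n. bessel_V n j lam * exp (- s) ^ (n - j) * (uc_deriv ^^ j) (\<lambda>s. exp (bessel_expo n * s) * W s) s)
    = exp (bessel_expo n * s) * (\<Sum>l\<le>n. euler_coeff n lam l * exp (- s) ^ (n - l) * (uc_deriv ^^ l) W s)"
proof -
  let ?l = "leibniz_coeff (bessel_expo n)" and ?V = "\<lambda>j. bessel_V n j lam" and ?e = "exp (bessel_expo n * s)"
  have "(\<Sum>j\<le>n. ?V j * exp (- s) ^ (n - j) * (uc_deriv ^^ j) (\<lambda>s. exp (bessel_expo n * s) * W s) s)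
     = (\<Sum>j\<le>n. \<Sum>i\<le>n. ?e * (?V j * ?l j i * exp (- s) ^ (n - i) * (uc_deriv ^^ i) W s))"
  proof (intro sum.cong refl)
    fix j assume j: "j \<in> {..n}"
    have "?V j * exp (- s) ^ (n - j) * (uc_deriv ^^ j) (\<lambda>s. exp (bessel_expo n * s) * W s) s
       = (\<Sum>i\<le>j. ?e * (?V j * ?l j i * (exp (- s) ^ (n - j) * exp (- s) ^ (j - i)) * (uc_deriv ^^ i) W s))"
      unfolding uc_derivs_exp_mult [OF assms] by (simp add: sum_distrib_left mult_ac)
    also have "\<dots> = (\<Sum>i\<le>j. ?e * (?V j * ?l j i * exp (- s) ^ (n - i) * (uc_deriv ^^ i) W s))"
      using j by (intro sum.cong refl) (simp add: power_add [symmetric])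
    also have "\<dots> = (\<Sum>i\<le>n. ?e * (?V j * ?l j i * exp (- s) ^ (n - i) * (uc_deriv ^^ i) W s))"
      using j by (intro sum.mono_neutral_left) (auto simp: leibniz_coeff_gt)
    finally show "?V j * exp (- s) ^ (n - j) * (uc_deriv ^^ j) (\<lambda>s. exp (bessel_expo n * s) * W s) s = \<dots>" .
  qed
  also have "\<dots> = (\<Sum>i\<le>n. ?e * ((\<Sum>j\<le>n. ?V j * ?l j i) * exp (- s) ^ (n - i) * (uc_deriv ^^ i) W s))"
    by (subst sum.swap) (simp add: sum_distrib_left sum_distrib_right)
  also have "\<dots> = (\<Sum>i\<le>n. ?e * (euler_coeff n lam i * exp (- s) ^ (n - i) * (uc_deriv ^^ i) W s))"
  proof -
    have "(\<Sum>j\<le>n. ?V j * ?l j i) = euler_coeff n lam i" for i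
      unfolding euler_coeff_def by (intro sum.mono_neutral_right) (auto simp: leibniz_coeff_gt)
    then show ?thesis by simp
  qed
  finally show ?thesis by (simp add: sum_distrib_left)
qed

lemma bessel_solution_iff:
  assumes a: "a ^ n = \<sigma> * (\<i> * of_nat n) ^ n"
  shows "bessel_solution n \<sigma> lam w \<longleftrightarrow>
    entire w \<and> (\<forall>s. (\<Sum>j\<le>n. bessel_V n j lam * exp (- s) ^ (n - j) * (uc_deriv ^^ j) w s) = a ^ n * w s)"
proof -
  have "(\<Sum>j=1..n. bessel_V n j lam * uc_proj s ^ j * (uc_deriv ^^ j) w s)
        + (bessel_V n 0 lam - \<sigma> * (\<i> * of_nat n) ^ n * uc_proj s ^ n) * w s
     = exp s ^ n * ((\<Sum>j\<le>n. bessel_V n j lam * exp (- s) ^ (n - j) * (uc_deriv ^^ j) w s) - a ^ n * w s)" for s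
  proof -
    have "exp s ^ n * (\<Sum>j\<le>n. bessel_V n j lam * exp (- s) ^ (n - j) * (uc_deriv ^^ j) w s)
       = (\<Sum>j\<le>n. bessel_V n j lam * exp s ^ j * (uc_deriv ^^ j) w s)"
      using exp_power_mult_sum [of s n "\<lambda>j. bessel_V n j lam" "\<lambda>j. (uc_deriv ^^ j) w s"]
      by (simp only: mult.assoc)
    also have "\<dots> = bessel_V n 0 lam * w s + (\<Sum>j=1..n. bessel_V n j lam * exp s ^ j * (uc_deriv ^^ j) w s)"
    proof -
      have "{..n} = insert 0 {1..n}" by auto
      then show ?thesis by simp
    qed
    finally show ?thesis
      by (simp add: a uc_proj_def right_diff_distrib left_diff_distrib mult_ac)
  qed
  then show ?thesis
    by (simp add: bessel_solution_def)
qed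

lemma bessel_solution_euler:
  assumes a: "a ^ n = \<sigma> * (\<i> * of_nat n) ^ n" and W: "entire W"
  shows "bessel_solution n \<sigma> lam (\<lambda>s. exp (bessel_expo n * s) * W s) \<longleftrightarrow> euler_solution n a (euler_coeff n lam) W"
proof -
  have "entire (\<lambda>s. exp (bessel_expo n * s) * W s)"
    by (intro holomorphic_intros W)
  then show ?thesis
    unfolding bessel_solution_iff [OF a] bessel_operator_exp_mult [OF W] euler_solution_def
    using W by (simp add: mult.left_commute)
qed

section \<open>The formal solution\<close>

text \<open>Matrix of the j-th formal derivative in powers of X = 1/z: entry (k, m) is the
  contribution of X^m to X^k. It rests on d/dz (exp (a z) z^(b-m)) = exp (a z) (a z^(b-m) + (b - m)
  z^(b-m-1)), so the matrix is lower triangular with j subdiagonals.\<close>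

fun dcoef :: "complex \<Rightarrow> complex \<Rightarrow> nat \<Rightarrow> nat \<Rightarrow> nat \<Rightarrow> complex" where
  "dcoef a b 0 k m = (if m = k then 1 else 0)"
| "dcoef a b (Suc j) k m = a * dcoef a b j k m
     + (if k = 0 then 0 else (b - of_nat (k - 1)) * dcoef a b j (k - 1) m)"

lemma fps_nth_formal_deriv:
  "fps_nth (formal_deriv a b F) k =
     a * fps_nth F k + (if k = 0 then 0 else (b - of_nat (k - 1)) * fps_nth F (k - 1))"
proof -
  have "fps_nth (fps_X ^ 2 * fps_deriv F) k = (if k = 0 then 0 else of_nat (k - 1) * fps_nth F (k - 1))"
    by (cases k; cases "k - 1") (auto simp: fps_X_power_mult_nth)
  then show ?thesis
    by (simp add: formal_deriv_def mult.assoc left_diff_distrib)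
qed

lemma dcoef_gt: "k < m \<Longrightarrow> dcoef a b j k m = 0"
  by (induction j arbitrary: k) auto

lemma dcoef_same: "dcoef a b j k k = a ^ j"
  by (induction j) (auto simp: dcoef_gt)

lemma dcoef_Suc: "dcoef a b j (Suc k) k = of_nat j * a ^ (j - 1) * (b - of_nat k)"
proof (induction j)
  case (Suc j)
  have "a * dcoef a b j (Suc k) k = of_nat j * a ^ j * (b - of_nat k)"
    unfolding Suc.IH by (cases j) auto
  then show ?case by (simp add: dcoef_same algebra_simps)
qed simp

lemma fps_nth_formal_derivs:
  "fps_nth ((formal_deriv a b ^^ j) F) k = (\<Sum>m\<le>k. dcoef a b j k m * fps_nth F m)"
proof (induction j arbitrary: k)
  case 0
  have "(\<Sum>m\<le>k. dcoef a b 0 k m * fps_nth F m) = (\<Sum>m\<le>k. if m = k then fps_nth F m else 0)"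
    by (intro sum.cong) auto
  then show ?case by simp
next
  case (Suc j)
  have "(\<Sum>m\<le>k - 1. dcoef a b j (k - 1) m * fps_nth F m) = (\<Sum>m\<le>k. dcoef a b j (k - 1) m * fps_nth F m)" if "k > 0"
    using that by (intro sum.mono_neutral_left) (auto simp: dcoef_gt)
  then show ?case
    by (auto simp: fps_nth_formal_deriv Suc.IH sum_distrib_left distrib_right sum.distrib mult.assoc)
qed

lemma norm_dcoef_le: "norm (dcoef a b j k m) \<le> (norm a + norm b + real k) ^ j"
proof (induction j arbitrary: k)
  case (Suc j)
  let ?N = "\<lambda>k. norm a + norm b + real k"
  have "norm (dcoef a b (Suc j) k m) \<le> norm a * norm (dcoef a b j k m)
      + (if k = 0 then 0 else norm (b - of_nat (k - 1)) * norm (dcoef a b j (k - 1) m))"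
    using norm_triangle_ineq [of "a * dcoef a b j k m" "(b - of_nat (k - 1)) * dcoef a b j (k - 1) m"]
    by (auto simp: norm_mult)
  also have "\<dots> \<le> norm a * ?N k ^ j + (norm b + real k) * ?N k ^ j"
  proof (intro add_mono mult_left_mono Suc.IH)
    have "norm (b - of_nat (k - 1)) \<le> norm b + real k"
      using norm_triangle_ineq4 [of b "of_nat (k - 1)"] by simp
    moreover have "norm (dcoef a b j (k - 1) m) \<le> ?N k ^ j"
      using Suc.IH [of "k - 1"] by (rule order_trans) (auto intro: power_mono)
    ultimately show "(if k = 0 then 0 else norm (b - of_nat (k - 1)) * norm (dcoef a b j (k - 1) m)) \<le> (norm b + real k) * ?N k ^ j"
      by (auto intro: mult_mono)
  qed auto
  finally show ?case by (simp add: algebra_simps)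
qed simp

text \<open>The residual of the formal equation, with a^n in place of \<sigma> (i n)^n, so that sign
  and root enter only through a.\<close>

definition bessel_formal_op :: "nat \<Rightarrow> complex \<Rightarrow> (nat \<Rightarrow> complex) \<Rightarrow> complex fps \<Rightarrow> complex fps" where
  "bessel_formal_op n a lam F =
     (\<Sum>j\<le>n. fps_const (bessel_V n j lam) * fps_X ^ (n - j) * (formal_deriv a (bessel_expo n) ^^ j) F)
     - fps_const (a ^ n) * F"

lemma bessel_formal_solution_iff:
  assumes "bessel_rate n \<xi> ^ n = \<sigma> * (\<i> * of_nat n) ^ n"
  shows "bessel_formal_solution n \<sigma> \<xi> lam F \<longleftrightarrow> bessel_formal_op n (bessel_rate n \<xi>) lam F = 0"
proof -
  have "{..n} = insert 0 {1..n}" by auto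
  then show ?thesis
    by (simp add: bessel_formal_solution_def bessel_formal_op_def bessel_formal_deriv_def assms algebra_simps)
qed

text \<open>Matrix of \<open>bessel_formal_op\<close> in powers of X, indexed like
  \<open>dcoef\<close>. The guard reflects the factor X^(n-j), below whose order nothing
  contributes.\<close>

definition tcoef :: "nat \<Rightarrow> complex \<Rightarrow> (nat \<Rightarrow> complex) \<Rightarrow> nat \<Rightarrow> nat \<Rightarrow> complex" where
  "tcoef n a lam k m =
     (\<Sum>j\<le>n. if k < n - j then 0 else bessel_V n j lam * dcoef a (bessel_expo n) j (k - (n - j)) m)
     - (if m = k then a ^ n else 0)"

lemma fps_nth_bessel_formal_op:
  "fps_nth (bessel_formal_op n a lam F) k = (\<Sum>m\<le>k. tcoef n a lam k m * fps_nth F m)"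
proof -
  let ?V = "\<lambda>j. bessel_V n j lam" and ?d = "dcoef a (bessel_expo n)"
  have "fps_nth (bessel_formal_op n a lam F) k
    = (\<Sum>j\<le>n. ?V j * (if k < n - j then 0 else fps_nth ((formal_deriv a (bessel_expo n) ^^ j) F) (k - (n - j))))
      - a ^ n * fps_nth F k"
    by (simp add: bessel_formal_op_def fps_sum_nth mult.assoc fps_X_power_mult_nth)
  also have "(\<Sum>j\<le>n. ?V j * (if k < n - j then 0 else fps_nth ((formal_deriv a (bessel_expo n) ^^ j) F) (k - (n - j))))
    = (\<Sum>j\<le>n. \<Sum>m\<le>k. (if k < n - j then 0 else ?V j * ?d j (k - (n - j)) m) * fps_nth F m)"
  proof (intro sum.cong refl)
    fix j
    have "(\<Sum>m\<le>k - (n - j). ?d j (k - (n - j)) m * fps_nth F m) = (\<Sum>m\<le>k. ?d j (k - (n - j)) m * fps_nth F m)"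
      by (intro sum.mono_neutral_left) (auto simp: dcoef_gt)
    then show "?V j * (if k < n - j then 0 else fps_nth ((formal_deriv a (bessel_expo n) ^^ j) F) (k - (n - j)))
       = (\<Sum>m\<le>k. (if k < n - j then 0 else ?V j * ?d j (k - (n - j)) m) * fps_nth F m)"
      by (auto simp: fps_nth_formal_derivs sum_distrib_left mult.assoc)
  qed
  also have "\<dots> = (\<Sum>m\<le>k. (\<Sum>j\<le>n. if k < n - j then 0 else ?V j * ?d j (k - (n - j)) m) * fps_nth F m)"
    by (subst sum.swap) (simp add: sum_distrib_right)
  also have "a ^ n * fps_nth F k = (\<Sum>m\<le>k. if m = k then a ^ n * fps_nth F m else 0)"
    by simp
  finally show ?thesis
    unfolding tcoef_def left_diff_distrib sum_subtractf
    by (simp add: if_distrib [of "\<lambda>x. x * _"] cong: if_cong)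
qed

text \<open>exp (a z) solves the leading equation: the diagonal entry is a^n - a^n.\<close>

lemma tcoef_same:
  assumes "n > 0" shows "tcoef n a lam k k = 0"
proof -
  have "(\<Sum>j\<le>n. if k < n - j then 0 else bessel_V n j lam * dcoef a (bessel_expo n) j (k - (n - j)) k)
     = (\<Sum>j\<le>n. if j = n then a ^ n else 0)"
    by (intro sum.cong) (auto simp: dcoef_same dcoef_gt bessel_V_top)
  then show ?thesis by (simp add: tcoef_def)
qed

text \<open>The contributions of V_{n,n-1} and of the exponent -(n - 1)/2 cancel and leave a
  multiple of k. Hence the equation of order k + 1 determines the coefficient of order k for k >= 1,
  and leaves the one of order 0 free.\<close>

lemma tcoef_Suc:
  assumes "n > 0" "(\<Sum>l<n. lam l) = 0"
  shows "tcoef n a lam (Suc k) k = - (of_nat n * a ^ (n - 1) * of_nat k)"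
proof -
  let ?t = "\<lambda>j. if Suc k < n - j then 0 else bessel_V n j lam * dcoef a (bessel_expo n) j (Suc k - (n - j)) k"
  have "(\<Sum>j\<le>n. ?t j) = (\<Sum>j\<in>{n - 1, n}. ?t j)"
    using assms by (intro sum.mono_neutral_right) (auto intro!: dcoef_gt)
  also have "\<dots> = bessel_V n (n - 1) lam * a ^ (n - 1) + of_nat n * a ^ (n - 1) * (bessel_expo n - of_nat k)"
    using assms by (simp add: dcoef_same dcoef_Suc bessel_V_top)
  also have "\<dots> = - (of_nat n * a ^ (n - 1) * of_nat k)"
    unfolding bessel_V_pred [OF assms] by (simp add: bessel_expo_def field_simps)
  finally show ?thesis by (simp add: tcoef_def)
qed

text \<open>V_{n,j} reaches entry (k, m) only if n - j <= k - m, and it is O(C^(n-j)).\<close>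

lemma tcoef_bounded:
  assumes "n > 0"
  shows "\<exists>K\<ge>0. \<forall>a lam. norm a = real n \<longrightarrow> (\<forall>m<k. norm (tcoef n a lam k m) \<le> K * index_size n lam ^ (k - m))"
proof -
  obtain K where K: "K \<ge> 0" "\<And>lam j. j \<le> n \<Longrightarrow> norm (bessel_V n j lam) \<le> K * index_size n lam ^ (n - j)"
    using bessel_V_bounded [OF assms] by blast
  define N where "N = real n + norm (bessel_expo n) + real k"
  define B where "B = (\<Sum>j\<le>n. K * N ^ j)"
  have N0: "N \<ge> 0" by (simp add: N_def)
  have "norm (tcoef n a lam k m) \<le> B * index_size n lam ^ (k - m)" if a: "norm a = real n" and m: "m < k" for a lam m
  proof -
    have C: "1 \<le> index_size n lam" by (rule index_size_ge_1 [OF assms])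
    have "norm (tcoef n a lam k m) \<le> (\<Sum>j\<le>n. K * N ^ j * index_size n lam ^ (k - m))"
      unfolding tcoef_def using m
    proof (simp, intro sum_norm_le)
      fix j assume j: "j \<in> {..n}"
      show "norm (if k < n - j then 0 else bessel_V n j lam * dcoef a (bessel_expo n) j (k - (n - j)) m)
          \<le> K * N ^ j * index_size n lam ^ (k - m)"
      proof (cases "k < n - j \<or> k - (n - j) < m")
        case True
        then show ?thesis using K N0 C by (auto simp: dcoef_gt)
      next
        case False
        then have kj: "n - j \<le> k - m" by linarith
        have "norm (dcoef a (bessel_expo n) j (k - (n - j)) m) \<le> N ^ j"
          using norm_dcoef_le [of a "bessel_expo n" j "k - (n - j)" m]
          by (rule order_trans) (auto simp: N_def a intro!: power_mono)
        moreover have "norm (bessel_V n j lam) \<le> K * index_size n lam ^ (n - j)"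
          using K(2) j by simp
        then have "norm (bessel_V n j lam) \<le> K * index_size n lam ^ (k - m)"
          by (rule order_trans) (use K C kj in \<open>auto intro!: mult_left_mono power_increasing\<close>)
        ultimately have "norm (bessel_V n j lam) * norm (dcoef a (bessel_expo n) j (k - (n - j)) m) \<le> K * index_size n lam ^ (k - m) * N ^ j"
          using K C by (intro mult_mono) auto
        then show ?thesis using False by (simp add: norm_mult mult_ac)
      qed
    qed
    then show ?thesis by (simp add: B_def sum_distrib_right)
  qed
  moreover have "B \<ge> 0" using K N0 by (simp add: B_def sum_nonneg)
  ultimately show ?thesis by blast
qed

text \<open>Solves row m + 1 of the triangular system for the coefficient of order m. The divisor is
  minus the subdiagonal entry \<open>tcoef n a lam (Suc m) m\<close>.\<close>

fun bcoef :: "nat \<Rightarrow> complex \<Rightarrow> (nat \<Rightarrow> complex) \<Rightarrow> nat \<Rightarrow> complex" where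
  "bcoef n a lam m = (if m = 0 then 1 else
     (\<Sum>i<m. tcoef n a lam (Suc m) i * bcoef n a lam i) / (of_nat n * a ^ (n - 1) * of_nat m))"

declare bcoef.simps [simp del]

lemma bcoef_0 [simp]: "bcoef n a lam 0 = 1"
  by (simp add: bcoef.simps)

lemma bessel_formal_op_bcoef:
  assumes n: "n > 0" and lam: "(\<Sum>l<n. lam l) = 0" and a: "a \<noteq> 0"
  shows "bessel_formal_op n a lam (Abs_fps (bcoef n a lam)) = 0"
proof (rule fps_ext)
  fix k
  show "fps_nth (bessel_formal_op n a lam (Abs_fps (bcoef n a lam))) k = fps_nth 0 k"
  proof (cases k)
    case 0
    then show ?thesis by (simp add: fps_nth_bessel_formal_op tcoef_same n)
  next
    case (Suc m)
    have "(\<Sum>i<m. tcoef n a lam (Suc m) i * bcoef n a lam i) = of_nat n * a ^ (n - 1) * of_nat m * bcoef n a lam m"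
      by (cases "m = 0") (use n a in \<open>simp_all add: bcoef.simps [of n a lam m]\<close>)
    then show ?thesis
      by (simp add: fps_nth_bessel_formal_op Suc tcoef_same n tcoef_Suc [OF n lam] lessThan_Suc_atMost [symmetric])
  qed
qed

lemma bessel_formal_op_unique:
  assumes n: "n > 0" and lam: "(\<Sum>l<n. lam l) = 0" and a: "a \<noteq> 0"
    and F: "bessel_formal_op n a lam F = 0" "fps_nth F 0 = 1"
  shows "fps_nth F m = bcoef n a lam m"
proof (induction m rule: less_induct)
  case (less m)
  have "(\<Sum>i<m. tcoef n a lam (Suc m) i * fps_nth F i) = of_nat n * a ^ (n - 1) * of_nat m * fps_nth F m"
    using arg_cong [OF F(1), of "\<lambda>F. fps_nth F (Suc m)"]
    by (simp add: fps_nth_bessel_formal_op tcoef_same n tcoef_Suc [OF n lam] lessThan_Suc_atMost [symmetric])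
  then have "(\<Sum>i<m. tcoef n a lam (Suc m) i * bcoef n a lam i) = of_nat n * a ^ (n - 1) * of_nat m * fps_nth F m"
    using less.IH by simp
  then show ?case
    using F(2) n a by (simp add: bcoef.simps [of n a lam m] field_simps)
qed

text \<open>By induction the i-th summand is of order C^(m+1-i) C^(2i), and m + 1 + i <= 2 m since i
  < m. The divisor has modulus at least 1.\<close>

lemma bcoef_bounded:
  assumes "n > 0"
  shows "\<exists>K\<ge>0. \<forall>a lam. norm a = real n \<longrightarrow> norm (bcoef n a lam m) \<le> K * index_size n lam ^ (2 * m)"
proof (induction m rule: less_induct)
  case (less m)
  show ?case
  proof (cases "m = 0")
    case True
    then show ?thesis by (intro exI [of _ 1]) auto
  next
    case False
    obtain B where B: "\<And>i. i < m \<Longrightarrow> B i \<ge> 0"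
      "\<And>i a lam. i < m \<Longrightarrow> norm a = real n \<Longrightarrow> norm (bcoef n a lam i) \<le> B i * index_size n lam ^ (2 * i)"
      using less.IH by metis
    obtain K where K: "K \<ge> 0"
      "\<And>a lam i. norm a = real n \<Longrightarrow> i < Suc m \<Longrightarrow> norm (tcoef n a lam (Suc m) i) \<le> K * index_size n lam ^ (Suc m - i)"
      using tcoef_bounded [OF assms, of "Suc m"] by metis
    have "norm (bcoef n a lam m) \<le> (\<Sum>i<m. K * B i) * index_size n lam ^ (2 * m)" if a: "norm a = real n" for a lam
    proof -
      have C: "1 \<le> index_size n lam" by (rule index_size_ge_1 [OF assms])
      have "1 \<le> real n * real n ^ (n - 1) * real m"
        using assms False by (simp add: Suc_le_eq flip: of_nat_mult of_nat_power)
      then have "norm (bcoef n a lam m) \<le> norm (\<Sum>i<m. tcoef n a lam (Suc m) i * bcoef n a lam i)"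
        using False a by (simp add: bcoef.simps [of n a lam m] norm_divide norm_mult norm_power divide_le_eq mult_le_cancel_left1)
      also have "\<dots> \<le> (\<Sum>i<m. K * B i * index_size n lam ^ (2 * m))"
      proof (rule sum_norm_le)
        fix i assume i: "i \<in> {..<m}"
        have "norm (tcoef n a lam (Suc m) i) * norm (bcoef n a lam i)
           \<le> K * index_size n lam ^ (Suc m - i) * (B i * index_size n lam ^ (2 * i))"
          using i K B a C by (intro mult_mono) auto
        also have "\<dots> = K * B i * index_size n lam ^ (Suc m - i + 2 * i)"
          by (simp add: power_add mult_ac)
        also have "\<dots> \<le> K * B i * index_size n lam ^ (2 * m)"
          using i K B C by (intro mult_left_mono power_increasing mult_nonneg_nonneg) auto
        finally show "norm (tcoef n a lam (Suc m) i * bcoef n a lam i) \<le> K * B i * index_size n lam ^ (2 * m)"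
          by (simp add: norm_mult)
      qed
      finally show ?thesis by (simp add: sum_distrib_right)
    qed
    moreover have "(\<Sum>i<m. K * B i) \<ge> 0" using K B by (auto intro: sum_nonneg)
    ultimately show ?thesis by blast
  qed
qed

section \<open>Symmetric polynomials, and the identification of the formal coefficients\<close>

lemma sym_poly_fun_const: "(\<lambda>_. c) \<in> sym_poly_fun n"
  by (simp add: sym_poly_fun_def poly_fun.const)

lemma sym_poly_fun_add: "f \<in> sym_poly_fun n \<Longrightarrow> g \<in> sym_poly_fun n \<Longrightarrow> (\<lambda>lam. f lam + g lam) \<in> sym_poly_fun n"
  by (simp add: sym_poly_fun_def poly_fun.add)

lemma sym_poly_fun_mult: "f \<in> sym_poly_fun n \<Longrightarrow> g \<in> sym_poly_fun n \<Longrightarrow> (\<lambda>lam. f lam * g lam) \<in> sym_poly_fun n"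
  by (simp add: sym_poly_fun_def poly_fun.mult)

lemma sym_poly_fun_diff: "f \<in> sym_poly_fun n \<Longrightarrow> g \<in> sym_poly_fun n \<Longrightarrow> (\<lambda>lam. f lam - g lam) \<in> sym_poly_fun n"
  using sym_poly_fun_add [OF _ sym_poly_fun_mult [OF sym_poly_fun_const [of "-1"]], of f n g] by simp

lemma sym_poly_fun_divide: "f \<in> sym_poly_fun n \<Longrightarrow> (\<lambda>lam. f lam / c) \<in> sym_poly_fun n"
  using sym_poly_fun_mult [OF _ sym_poly_fun_const [of "1 / c"], of f n] by simp

lemma sym_poly_fun_sum:
  "(\<And>i. i \<in> I \<Longrightarrow> f i \<in> sym_poly_fun n) \<Longrightarrow> (\<lambda>lam. \<Sum>i\<in>I. f i lam) \<in> sym_poly_fun n"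
proof (induction I rule: infinite_finite_induct)
  case (insert i I)
  then show ?case using sym_poly_fun_add [of "f i" n "\<lambda>lam. \<Sum>i\<in>I. f i lam"] by simp
qed (simp_all add: sym_poly_fun_const)

lemma poly_fun_sum:
  "(\<And>i. i \<in> I \<Longrightarrow> f i \<in> poly_fun n) \<Longrightarrow> (\<lambda>lam. \<Sum>i\<in>I. f i lam) \<in> poly_fun n"
proof (induction I rule: infinite_finite_induct)
  case (insert i I)
  then show ?case using poly_fun.add [of "f i" n "\<lambda>lam. \<Sum>i\<in>I. f i lam"] by simp
qed (simp_all add: poly_fun.const)

lemma poly_fun_prod:
  "S \<subseteq> {..<n} \<Longrightarrow> (\<lambda>lam. \<Prod>i\<in>S. lam i) \<in> poly_fun n"
proof (induction S rule: infinite_finite_induct)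
  case (insert i I)
  then show ?case using poly_fun.mult [OF poly_fun.coord, of i n "\<lambda>lam. \<Prod>i\<in>I. lam i"] by simp
qed (simp_all add: poly_fun.const)

text \<open>A permutation of the coordinates permutes the subsets of a given size.\<close>

lemma sym_poly_fun_esym: "esym n m \<in> sym_poly_fun n"
proof -
  have "esym n m (\<lambda>i. lam (p i)) = esym n m lam" if p: "p permutes {..<n}" for p lam
  proof -
    let ?A = "{S. S \<subseteq> {..<n} \<and> card S = m}"
    have inj: "inj p" by (rule permutes_inj [OF p])
    have "bij_betw ((`) p) ?A ?A"
    proof (rule bij_betw_byWitness [where f' = "(`) (inv p)"])
      have "inv p permutes {..<n}" by (rule permutes_inv [OF p])
      then have sub: "p i < n" "inv p i < n" if "i < n" for i
        using that permutes_in_image [OF p, of i] permutes_in_image [of "inv p" "{..<n}" i] by auto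
      show "(`) p ` ?A \<subseteq> ?A" "(`) (inv p) ` ?A \<subseteq> ?A"
        using sub inj permutes_inj [OF permutes_inv [OF p]] by (auto simp: card_image inj_on_subset)
    qed (use permutes_inv_o [OF p] in \<open>auto simp: image_comp\<close>)
    then have "esym n m lam = (\<Sum>S\<in>?A. \<Prod>i\<in>p ` S. lam i)"
      unfolding esym_def by (rule sum.reindex_bij_betw [symmetric])
    also have "\<dots> = esym n m (\<lambda>i. lam (p i))"
      unfolding esym_def using inj by (intro sum.cong refl) (simp add: prod.reindex inj_on_subset)
    finally show ?thesis by simp
  qed
  moreover have "esym n m \<in> poly_fun n"
    unfolding esym_def [abs_def] by (intro poly_fun_sum poly_fun_prod) auto
  ultimately show ?thesis by (simp add: sym_poly_fun_def)
qed

lemma sym_poly_fun_bessel_V: "bessel_V n j \<in> sym_poly_fun n"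
  unfolding bessel_V_def [abs_def]
  by (intro sym_poly_fun_sum sym_poly_fun_mult sym_poly_fun_const sym_poly_fun_esym)

lemma sym_poly_fun_tcoef: "(\<lambda>lam. tcoef n a lam k m) \<in> sym_poly_fun n"
  unfolding tcoef_def
proof (intro sym_poly_fun_diff sym_poly_fun_sum sym_poly_fun_const)
  fix j
  show "(\<lambda>lam. if k < n - j then 0 else bessel_V n j lam * dcoef a (bessel_expo n) j (k - (n - j)) m) \<in> sym_poly_fun n"
    by (cases "k < n - j") (auto intro: sym_poly_fun_mult sym_poly_fun_const sym_poly_fun_bessel_V)
qed

text \<open>The divisor in the recursion is free of the index, so the recursion stays among
  polynomials.\<close>

lemma sym_poly_fun_bcoef: "(\<lambda>lam. bcoef n a lam m) \<in> sym_poly_fun n"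
proof (induction m rule: less_induct)
  case (less m)
  show ?case
  proof (cases "m = 0")
    case False
    then show ?thesis
      unfolding bcoef.simps [of n a _ m] by (simp, intro sym_poly_fun_divide sym_poly_fun_sum sym_poly_fun_mult sym_poly_fun_tcoef less.IH) auto
  qed (simp add: sym_poly_fun_const)
qed

text \<open>The recursion supplies a sequence of symmetric polynomials valid on the whole
  hyperplane; uniqueness of the value is read off from the triangular system at the given
  index.\<close>

lemma bessel_B_eq:
  assumes n: "n > 0" and lam: "(\<Sum>l<n. lam l) = 0" and \<xi>: "\<xi> \<noteq> 0" "\<xi> ^ n = \<sigma>"
  shows "bessel_B n \<sigma> \<xi> lam = bcoef n (bessel_rate n \<xi>) lam"
proof -
  let ?a = "bessel_rate n \<xi>"
  have a: "?a \<noteq> 0" using n \<xi> by (simp add: bessel_rate_def)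
  have an: "?a ^ n = \<sigma> * (\<i> * of_nat n) ^ n"
    using \<xi> by (simp add: bessel_rate_def power_mult_distrib)
  note iff = bessel_formal_solution_iff [OF an]
  show ?thesis
    unfolding bessel_B_def
  proof (rule the_equality)
    show "\<exists>B. (\<forall>m. B m \<in> sym_poly_fun n) \<and> B 0 = (\<lambda>_. 1) \<and>
       (\<forall>\<mu>. (\<Sum>l<n. \<mu> l) = 0 \<longrightarrow> bessel_formal_solution n \<sigma> \<xi> \<mu> (Abs_fps (\<lambda>m. B m \<mu>))) \<and>
       bcoef n ?a lam = (\<lambda>m. B m lam)"
      using bessel_formal_op_bcoef [OF n _ a]
      by (intro exI [of _ "\<lambda>m lam. bcoef n ?a lam m"]) (auto simp: sym_poly_fun_bcoef iff)
  next
    fix b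
    assume "\<exists>B. (\<forall>m. B m \<in> sym_poly_fun n) \<and> B 0 = (\<lambda>_. 1) \<and>
       (\<forall>\<mu>. (\<Sum>l<n. \<mu> l) = 0 \<longrightarrow> bessel_formal_solution n \<sigma> \<xi> \<mu> (Abs_fps (\<lambda>m. B m \<mu>))) \<and>
       b = (\<lambda>m. B m lam)"
    then have "bessel_formal_op n ?a lam (Abs_fps b) = 0" "fps_nth (Abs_fps b) 0 = 1"
      using lam by (auto simp: iff)
    from bessel_formal_op_unique [OF n lam a this] show "b = bcoef n ?a lam"
      by (simp add: fun_eq_iff)
  qed
qed

section \<open>Truncations of the formal solution\<close>

text \<open>The formal derivative on polynomials in X. Truncations have to be actual functions of z,
  by evaluation at X = exp (-s), and exp (a z) z^b times a polynomial in 1/z keeps this form under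
  d/dz.\<close>

definition poly_deriv :: "complex \<Rightarrow> complex \<Rightarrow> complex poly \<Rightarrow> complex poly" where
  "poly_deriv a b p = smult a p + smult b (pCons 0 p) - pCons 0 (pCons 0 (pderiv p))"

lemma fps_of_poly_deriv: "fps_of_poly (poly_deriv a b p) = formal_deriv a b (fps_of_poly p)"
  by (simp add: poly_deriv_def formal_deriv_def fps_of_poly_add fps_of_poly_diff fps_of_poly_smult
      fps_of_poly_pCons fps_of_poly_pderiv power2_eq_square mult_ac)

lemma fps_of_poly_derivs:
  "fps_of_poly ((poly_deriv a b ^^ j) p) = (formal_deriv a b ^^ j) (fps_of_poly p)"
  by (induction j) (simp_all add: fps_of_poly_deriv)

lemma coeff_poly_deriv:
  "coeff (poly_deriv a b p) k =
     a * coeff p k + (if k = 0 then 0 else (b - of_nat (k - 1)) * coeff p (k - 1))"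
  using fps_nth_formal_deriv [of a b "fps_of_poly p" k] by (simp flip: fps_of_poly_deriv)

lemma entire_expansion [holomorphic_intros]: "entire (\<lambda>s. exp (a * exp s) * exp (b * s) * poly p (exp (- s)))"
  by (intro holomorphic_intros)

lemma uc_derivs_expansion:
  "(uc_deriv ^^ j) (\<lambda>s. exp (a * exp s) * exp (b * s) * poly p (exp (- s)))
    = (\<lambda>s. exp (a * exp s) * exp (b * s) * poly ((poly_deriv a b ^^ j) p) (exp (- s)))"
proof (induction j)
  case (Suc j)
  define q where "q = (poly_deriv a b ^^ j) p"
  have "uc_deriv (\<lambda>s. exp (a * exp s) * exp (b * s) * poly q (exp (- s))) s
      = exp (a * exp s) * exp (b * s) * poly (poly_deriv a b q) (exp (- s))" for s
  proof -
    let ?E = "exp (a * exp s) * exp (b * s)"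
    have "((\<lambda>s. exp (a * exp s) * exp (b * s) * poly q (exp (- s))) has_field_derivative
        ?E * ((a * exp s + b) * poly q (exp (- s)) - exp (- s) * poly (pderiv q) (exp (- s)))) (at s)"
      by (auto intro!: derivative_eq_intros DERIV_chain2 [OF poly_DERIV] simp: algebra_simps)
    then have "uc_deriv (\<lambda>s. exp (a * exp s) * exp (b * s) * poly q (exp (- s))) s
      = exp (- s) * (?E * ((a * exp s + b) * poly q (exp (- s)) - exp (- s) * poly (pderiv q) (exp (- s))))"
      by (rule uc_derivI)
    also have "\<dots> = ?E * (a * (exp (- s) * exp s) * poly q (exp (- s)) + b * exp (- s) * poly q (exp (- s))
        - exp (- s) * exp (- s) * poly (pderiv q) (exp (- s)))"
      by (simp only: algebra_simps)
    also have "exp (- s) * exp s = 1" by (simp add: exp_minus)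
    finally show ?thesis
      by (simp add: poly_deriv_def algebra_simps)
  qed
  then show ?case by (simp add: Suc.IH q_def)
qed simp

definition bessel_poly_op :: "nat \<Rightarrow> complex \<Rightarrow> (nat \<Rightarrow> complex) \<Rightarrow> complex poly \<Rightarrow> complex poly" where
  "bessel_poly_op n a lam p =
     (\<Sum>j\<le>n. smult (bessel_V n j lam) (monom 1 (n - j) * (poly_deriv a (bessel_expo n) ^^ j) p))
     - smult (a ^ n) p"

lemma fps_of_poly_bessel_op: "fps_of_poly (bessel_poly_op n a lam p) = bessel_formal_op n a lam (fps_of_poly p)"
  by (simp add: bessel_poly_op_def bessel_formal_op_def fps_of_poly_diff fps_of_poly_sum fps_of_poly_smult
      fps_of_poly_mult fps_of_poly_monom fps_of_poly_derivs mult.assoc)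

text \<open>The factor z^b is multiplied in, the Bessel operator applied, and z^b divided out. Thus
  the residual of a truncation is governed by the matrix of the formal equation.\<close>

lemma euler_operator_expansion:
  "(\<Sum>l\<le>n. euler_coeff n lam l * exp (- s) ^ (n - l) * (uc_deriv ^^ l) (\<lambda>s. exp (a * exp s) * poly p (exp (- s))) s)
     - a ^ n * (exp (a * exp s) * poly p (exp (- s)))
   = exp (a * exp s) * poly (bessel_poly_op n a lam p) (exp (- s))"
proof -
  let ?W = "\<lambda>s. exp (a * exp s) * poly p (exp (- s))" and ?e = "exp (bessel_expo n * s)"
  have W: "entire ?W" by (intro holomorphic_intros)
  have eq: "(\<lambda>s. exp (bessel_expo n * s) * ?W s) = (\<lambda>s. exp (a * exp s) * exp (bessel_expo n * s) * poly p (exp (- s)))"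
    by (simp add: mult_ac)
  let ?S = "\<Sum>l\<le>n. euler_coeff n lam l * exp (- s) ^ (n - l) * (uc_deriv ^^ l) ?W s"
  let ?Q = "\<Sum>j\<le>n. bessel_V n j lam * exp (- s) ^ (n - j) * poly ((poly_deriv a (bessel_expo n) ^^ j) p) (exp (- s))"
  have "?e * ?S = (\<Sum>j\<le>n. bessel_V n j lam * exp (- s) ^ (n - j) *
      (uc_deriv ^^ j) (\<lambda>s. exp (bessel_expo n * s) * ?W s) s)"
    by (simp only: bessel_operator_exp_mult [OF W])
  also have "\<dots> = (\<Sum>j\<le>n. bessel_V n j lam * exp (- s) ^ (n - j) * (exp (a * exp s) * ?e *
      poly ((poly_deriv a (bessel_expo n) ^^ j) p) (exp (- s))))"
    by (simp only: eq uc_derivs_expansion)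
  also have "\<dots> = ?e * (exp (a * exp s) * ?Q)"
    by (simp add: sum_distrib_left mult_ac)
  finally have "?S = exp (a * exp s) * ?Q" by simp
  then show ?thesis
    by (simp add: bessel_poly_op_def poly_sum poly_monom right_diff_distrib mult_ac)
qed

definition truncation :: "nat \<Rightarrow> (nat \<Rightarrow> complex) \<Rightarrow> complex poly" where
  "truncation M c = (\<Sum>m<M. monom (c m) m)"

lemma coeff_truncation: "coeff (truncation M c) k = (if k < M then c k else 0)"
  by (simp add: truncation_def coeff_sum)

lemma poly_truncation: "poly (truncation M c) x = (\<Sum>m<M. c m * x ^ m)"
  by (simp add: truncation_def poly_sum poly_monom)

lemma coeff_truncation_formal_derivs:
  assumes "k < M"
  shows "coeff ((poly_deriv a b ^^ j) (truncation M c)) k = fps_nth ((formal_deriv a b ^^ j) (Abs_fps c)) k"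
proof -
  have "coeff ((poly_deriv a b ^^ j) (truncation M c)) k
      = fps_nth ((formal_deriv a b ^^ j) (fps_of_poly (truncation M c))) k"
    by (simp flip: fps_of_poly_derivs)
  then show ?thesis
    using assms by (simp add: fps_nth_formal_derivs coeff_truncation)
qed

text \<open>
  Coefficients in degrees v to N only, of the size expected when C is the size of the index
  and the series is in C^2 / z; w counts the powers of C that are gained.
\<close>

definition graded_bound :: "nat \<Rightarrow> nat \<Rightarrow> nat \<Rightarrow> real \<Rightarrow> real \<Rightarrow> complex poly \<Rightarrow> bool" where
  "graded_bound w v N K C p \<longleftrightarrow>
     (\<forall>k. (k < v \<or> k > N \<longrightarrow> coeff p k = 0) \<and> norm (coeff p k) \<le> K * C ^ (2 * k - w))"

text \<open>A differentiation keeps the degree or raises it by one. A higher degree allows more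
  powers of C, so only K and the top degree change.\<close>

lemma graded_bound_deriv:
  assumes p: "graded_bound w v N K C p" and C: "1 \<le> C"
  shows "graded_bound w v (Suc N) ((norm a + norm b + real N) * K) C (poly_deriv a b p)"
  unfolding graded_bound_def
proof (intro allI conjI impI)
  fix k
  \<comment> \<open>At k = 0 the truncated exponent 2 k - w is 0, so the bound there compares a norm
    with K itself.\<close>
  have K: "0 \<le> K"
    using p C order_trans [OF norm_ge_zero, of "coeff p 0" K] by (auto simp: graded_bound_def elim!: allE [of _ 0])
  show "k < v \<or> k > Suc N \<Longrightarrow> coeff (poly_deriv a b p) k = 0"
    using p by (auto simp: coeff_poly_deriv graded_bound_def)
  have 1: "norm (a * coeff p k) \<le> norm a * (K * C ^ (2 * k - w))"
    using p by (simp add: graded_bound_def norm_mult mult_left_mono)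
  have 2: "norm ((b - of_nat (k - 1)) * coeff p (k - 1)) \<le> (norm b + real N) * (K * C ^ (2 * k - w))" if k: "k > 0"
  proof (cases "k - 1 > N")
    case True
    then have "coeff p (k - 1) = 0" using p by (simp add: graded_bound_def)
    then show ?thesis using K C by simp
  next
    case False
    have "norm (b - of_nat (k - 1)) \<le> norm b + real N"
      using norm_triangle_ineq4 [of b "of_nat (k - 1)"] False by simp
    moreover have "norm (coeff p (k - 1)) \<le> K * C ^ (2 * (k - 1) - w)"
      using p by (simp add: graded_bound_def)
    moreover have "K * C ^ (2 * (k - 1) - w) \<le> K * C ^ (2 * k - w)"
      using C K by (intro mult_left_mono power_increasing) auto
    ultimately show ?thesis
      unfolding norm_mult by (intro mult_mono) auto
  qed
  have "norm (coeff (poly_deriv a b p) k) \<le> norm a * (K * C ^ (2 * k - w)) + (norm b + real N) * (K * C ^ (2 * k - w))"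
  proof (cases "k = 0")
    case True
    have "0 \<le> (norm b + real N) * (K * C ^ (2 * k - w))" using K C by simp
    then show ?thesis using 1 True by (simp add: coeff_poly_deriv)
  next
    case False
    then show ?thesis
      using 1 2 norm_triangle_ineq [of "a * coeff p k" "(b - of_nat (k - 1)) * coeff p (k - 1)"]
      by (simp add: coeff_poly_deriv)
  qed
  then show "norm (coeff (poly_deriv a b p) k) \<le> (norm a + norm b + real N) * K * C ^ (2 * k - w)"
    by (simp add: algebra_simps)
qed

lemma graded_bound_derivs:
  assumes "0 \<le> K"
  shows "\<exists>K'\<ge>0. \<forall>a p C. norm a = r \<longrightarrow> 1 \<le> C \<longrightarrow> graded_bound w v N K C p \<longrightarrow>
     graded_bound w v (N + j) K' C ((poly_deriv a b ^^ j) p)"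
proof (induction j)
  case 0
  then show ?case using assms by auto
next
  case (Suc j)
  then obtain K' where K': "K' \<ge> 0" "\<And>a p C. norm a = r \<Longrightarrow> 1 \<le> C \<Longrightarrow> graded_bound w v N K C p \<Longrightarrow>
     graded_bound w v (N + j) K' C ((poly_deriv a b ^^ j) p)"
    by blast
  show ?case
  proof (intro exI [of _ "(\<bar>r\<bar> + norm b + real (N + j)) * K'"] conjI allI impI)
    fix a :: complex and p C assume *: "norm a = r" "1 \<le> C" "graded_bound w v N K C p"
    then have "norm a = \<bar>r\<bar>" using norm_ge_zero [of a] by linarith
    with graded_bound_deriv [OF K'(2) [OF *] *(2), of a b]
    show "graded_bound w v (N + Suc j) ((\<bar>r\<bar> + norm b + real (N + j)) * K') C ((poly_deriv a b ^^ Suc j) p)"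
      by simp
  qed (use K' in auto)
qed

text \<open>Since C^2 |x| <= 1, every degree from v on is bounded like degree v. The condition w <=
  2 v makes 2 k - w a true difference for these degrees.\<close>

lemma graded_bound_eval:
  assumes p: "graded_bound w v N K C p" and C: "1 \<le> C" "C\<^sup>2 * norm x \<le> 1" and w: "w \<le> 2 * v"
  shows "norm (poly p x) \<le> real (Suc N) * K * (C ^ (2 * v - w) * norm x ^ v)"
proof -
  have K: "0 \<le> K"
    using p C order_trans [OF norm_ge_zero, of "coeff p 0" K] by (auto simp: graded_bound_def elim!: allE [of _ 0])
  have "degree p \<le> N"
    using p by (auto intro!: degree_le simp: graded_bound_def)
  then have "poly p x = (\<Sum>k\<le>N. coeff p k * x ^ k)"
    unfolding poly_altdef by (intro sum.mono_neutral_left) (auto simp: coeff_eq_0)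
  also have "norm \<dots> \<le> (\<Sum>k\<le>N. K * (C ^ (2 * v - w) * norm x ^ v))"
  proof (rule sum_norm_le)
    fix k
    show "norm (coeff p k * x ^ k) \<le> K * (C ^ (2 * v - w) * norm x ^ v)"
    proof (cases "k < v")
      case True
      then show ?thesis using p K C by (simp add: graded_bound_def)
    next
      case False
      then have k: "2 * k - w = (2 * v - w) + 2 * (k - v)" "k = v + (k - v)" using w by auto
      have "norm (coeff p k * x ^ k) \<le> K * C ^ (2 * k - w) * norm x ^ k"
        unfolding norm_mult norm_power using p by (intro mult_right_mono) (auto simp: graded_bound_def)
      also have "\<dots> = K * (C ^ (2 * v - w) * norm x ^ v) * (C\<^sup>2 * norm x) ^ (k - v)"
        by (subst k(1), subst (2) k(2)) (simp add: power_add power_mult power_mult_distrib)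
      also have "\<dots> \<le> K * (C ^ (2 * v - w) * norm x ^ v) * 1"
        using C K by (intro mult_left_mono power_le_one) auto
      finally show ?thesis by simp
    qed
  qed
  finally show ?thesis by simp
qed

section \<open>Truncations of the formal solution and their residuals\<close>

lemma dcoef_eq_0: "m + j < k \<Longrightarrow> dcoef a b j k m = 0"
  by (induction j arbitrary: k) auto

lemma tcoef_eq_0: "m + n < k \<Longrightarrow> tcoef n a lam k m = 0"
  unfolding tcoef_def by (auto intro!: sum.neutral dcoef_eq_0)

lemma truncation_bounded:
  assumes "n > 0"
  shows "\<exists>K\<ge>0. \<forall>a lam. norm a = real n \<longrightarrow> graded_bound 0 0 M K (index_size n lam) (truncation M (bcoef n a lam))"
proof -
  obtain B where B: "\<And>m. B m \<ge> 0"
    "\<And>m a lam. norm a = real n \<Longrightarrow> norm (bcoef n a lam m) \<le> B m * index_size n lam ^ (2 * m)"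
    using bcoef_bounded [OF assms] by metis
  have "graded_bound 0 0 M (\<Sum>m<M. B m) (index_size n lam) (truncation M (bcoef n a lam))" if a: "norm a = real n" for a lam
    unfolding graded_bound_def
  proof (intro allI conjI impI)
    fix k
    have C: "1 \<le> index_size n lam" by (rule index_size_ge_1 [OF assms])
    show "norm (coeff (truncation M (bcoef n a lam)) k) \<le> (\<Sum>m<M. B m) * index_size n lam ^ (2 * k - 0)"
    proof (cases "k < M")
      case True
      then have "B k \<le> (\<Sum>m<M. B m)" using B by (intro member_le_sum) auto
      then have "B k * index_size n lam ^ (2 * k) \<le> (\<Sum>m<M. B m) * index_size n lam ^ (2 * k)"
        using C by (intro mult_right_mono) auto
      then show ?thesis using True B(2) [OF a, of lam k] by (simp add: coeff_truncation)
    next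
      case False
      then show ?thesis using C B by (simp add: coeff_truncation sum_nonneg)
    qed
  qed (auto simp: coeff_truncation)
  then show ?thesis using B by (intro exI [of _ "\<Sum>m<M. B m"]) (auto intro: sum_nonneg)
qed

text \<open>As the diagonal vanishes, rows k <= M see only coefficients of order below M, so the
  residual agrees with that of the full series and starts at X^(M+1). In later rows m <= M - 1 <= k
  - 2, so the power (k - m) + 2 m of C is at most 2 k - 2, whence the weight 2.\<close>

lemma residual_bounded:
  assumes "n > 0"
  shows "\<exists>K\<ge>0. \<forall>a lam. norm a = real n \<longrightarrow> (\<Sum>l<n. lam l) = 0 \<longrightarrow>
     graded_bound 2 (Suc M) (M + n) K (index_size n lam) (bessel_poly_op n a lam (truncation M (bcoef n a lam)))"
proof -
  obtain B where B: "\<And>m. B m \<ge> 0"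
    "\<And>m a lam. norm a = real n \<Longrightarrow> norm (bcoef n a lam m) \<le> B m * index_size n lam ^ (2 * m)"
    using bcoef_bounded [OF assms] by metis
  obtain T where T: "\<And>k. T k \<ge> 0"
    "\<And>k a lam m. norm a = real n \<Longrightarrow> m < k \<Longrightarrow> norm (tcoef n a lam k m) \<le> T k * index_size n lam ^ (k - m)"
    using tcoef_bounded [OF assms] by metis
  define K where "K = (\<Sum>k\<le>M + n. \<Sum>m<M. T k * B m)"
  have K0: "K \<ge> 0" using T B by (auto simp: K_def intro!: sum_nonneg)
  have "graded_bound 2 (Suc M) (M + n) K (index_size n lam) (bessel_poly_op n a lam (truncation M (bcoef n a lam)))"
    if a: "norm a = real n" and lam: "(\<Sum>l<n. lam l) = 0" for a lam
  proof -
    let ?R = "bessel_poly_op n a lam (truncation M (bcoef n a lam))"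
    have C: "1 \<le> index_size n lam" by (rule index_size_ge_1 [OF assms])
    have a0: "a \<noteq> 0" using a assms by auto
    have R: "coeff ?R k = (\<Sum>m\<le>k. tcoef n a lam k m * (if m < M then bcoef n a lam m else 0))" for k
    proof -
      have "coeff ?R k = fps_nth (bessel_formal_op n a lam (fps_of_poly (truncation M (bcoef n a lam)))) k"
        by (simp flip: fps_of_poly_bessel_op)
      then show ?thesis by (simp add: fps_nth_bessel_formal_op coeff_truncation)
    qed
    have low: "coeff ?R k = 0" if k: "k \<le> M" for k
    proof -
      have "coeff ?R k = (\<Sum>m\<le>k. tcoef n a lam k m * bcoef n a lam m)"
        unfolding R
      proof (intro sum.cong refl)
        fix m assume "m \<in> {..k}"
        then show "tcoef n a lam k m * (if m < M then bcoef n a lam m else 0) = tcoef n a lam k m * bcoef n a lam m"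
          using k by (cases "m = k") (auto simp: tcoef_same assms)
      qed
      also have "\<dots> = fps_nth (bessel_formal_op n a lam (Abs_fps (bcoef n a lam))) k"
        by (simp add: fps_nth_bessel_formal_op)
      also have "\<dots> = 0"
        by (simp add: bessel_formal_op_bcoef [OF assms lam a0])
      finally show ?thesis .
    qed
    have high: "coeff ?R k = 0" if k: "M + n < k" for k
      unfolding R using k by (intro sum.neutral) (auto intro!: tcoef_eq_0)
    have mid: "norm (coeff ?R k) \<le> K * index_size n lam ^ (2 * k - 2)" if k: "M < k" "k \<le> M + n" for k
    proof -
      have "coeff ?R k = (\<Sum>m<M. tcoef n a lam k m * bcoef n a lam m)"
        unfolding R using k by (intro sum.mono_neutral_cong_right) auto
      also have "norm \<dots> \<le> (\<Sum>m<M. T k * B m * index_size n lam ^ (2 * k - 2))"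
      proof (rule sum_norm_le)
        fix m assume m: "m \<in> {..<M}"
        have "norm (tcoef n a lam k m) * norm (bcoef n a lam m)
          \<le> T k * index_size n lam ^ (k - m) * (B m * index_size n lam ^ (2 * m))"
          using m k T B a C by (intro mult_mono) auto
        also have "\<dots> = T k * B m * index_size n lam ^ (k - m + 2 * m)"
          by (simp add: power_add mult_ac)
        also have "\<dots> \<le> T k * B m * index_size n lam ^ (2 * k - 2)"
          using m k C T B by (intro mult_left_mono power_increasing mult_nonneg_nonneg) auto
        finally show "norm (tcoef n a lam k m * bcoef n a lam m) \<le> T k * B m * index_size n lam ^ (2 * k - 2)"
          by (simp add: norm_mult)
      qed
      also have "\<dots> = (\<Sum>m<M. T k * B m) * index_size n lam ^ (2 * k - 2)"
        by (simp add: sum_distrib_right)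
      also have "\<dots> \<le> K * index_size n lam ^ (2 * k - 2)"
        unfolding K_def using C k T B
        by (intro mult_right_mono member_le_sum [of k "{..M + n}" "\<lambda>k. \<Sum>m<M. T k * B m"]) (auto intro!: sum_nonneg)
      finally show ?thesis .
    qed
    show ?thesis
      unfolding graded_bound_def
    proof (intro allI conjI impI)
      fix k
      show "k < Suc M \<or> M + n < k \<Longrightarrow> coeff ?R k = 0" using low high by auto
      show "norm (coeff ?R k) \<le> K * index_size n lam ^ (2 * k - 2)"
        using low [of k] high [of k] mid [of k] K0 C by (cases "M < k \<and> k \<le> M + n") auto
    qed
  qed
  then show ?thesis using K0 by blast
qed

section \<open>Estimates along rays\<close>

lemma derivs_convergent:
  assumes "\<And>N. entire (w N)" and "\<And>i. i \<le> j \<Longrightarrow> convergent (\<lambda>N. (uc_deriv ^^ i) (w N) s)"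
  shows "convergent (\<lambda>N. (deriv ^^ j) (w N) s)"
  using assms(2)
proof (induction j rule: less_induct)
  case (less j)
  have "(deriv ^^ j) (w N) s = exp s ^ j * (uc_deriv ^^ j) (w N) s
      - (\<Sum>i<j. falling_coeff j i * (deriv ^^ i) (w N) s)" for N
    using uc_derivs_eq_derivs [OF assms(1), of s j]
    by (simp add: lessThan_Suc_atMost [symmetric] falling_coeff_same)
  moreover have "convergent (\<lambda>N. exp s ^ j * (uc_deriv ^^ j) (w N) s
      - (\<Sum>i<j. falling_coeff j i * (deriv ^^ i) (w N) s))"
    by (intro convergent_diff convergent_sum convergent_mult convergent_const less) auto
  ultimately show ?case by simp
qed

lemma amp_diff_le:
  assumes "entire f" "entire g"
  shows "amp a i (\<lambda>s. f s - g s) s \<le> amp a i f s + amp a i g s"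
  unfolding amp_def uc_derivs_diff [OF assms] right_diff_distrib by (rule norm_triangle_ineq4)

text \<open>What the estimates use of the Bessel equation. In the direction \<phi>, which is arg (i
  cnj xi), a z = -n |z| and exp (a z) decays fastest.\<close>

locale euler_ode =
  fixes n :: nat and a :: complex and g :: "nat \<Rightarrow> complex" and G C \<phi> :: real
  assumes n2: "2 \<le> n" and a: "norm a = real n" and g_top: "g n = 1" and g_pred: "g (n - 1) = 0"
    and G: "0 \<le> G" and C: "1 \<le> C" and g_le: "\<And>l. l \<le> n \<Longrightarrow> norm (g l) \<le> G * C ^ (n - l)"
    and \<phi>: "a * cis \<phi> = - of_nat n"
begin

definition op :: "(complex \<Rightarrow> complex) \<Rightarrow> complex \<Rightarrow> complex" where
  "op W s = (\<Sum>l\<le>n. g l * exp (- s) ^ (n - l) * (uc_deriv ^^ l) W s) - a ^ n * W s"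

definition E :: "complex \<Rightarrow> complex" where
  "E s = exp (a * exp s)"

lemma euler_solution_op: "euler_solution n a g W \<longleftrightarrow> entire W \<and> (\<forall>s. op W s = 0)"
  by (simp add: euler_solution_def op_def)

lemma op_lincomb:
  assumes "finite I" "\<And>i. i \<in> I \<Longrightarrow> entire (f i)"
  shows "op (\<lambda>s. \<Sum>i\<in>I. c i * f i s) s = (\<Sum>i\<in>I. c i * op (f i) s)"
proof -
  have "(\<Sum>l\<le>n. g l * exp (- s) ^ (n - l) * (\<Sum>i\<in>I. c i * (uc_deriv ^^ l) (f i) s))
      = (\<Sum>i\<in>I. c i * (\<Sum>l\<le>n. g l * exp (- s) ^ (n - l) * (uc_deriv ^^ l) (f i) s))"
    unfolding sum_distrib_left by (subst sum.swap) (simp add: mult_ac)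
  then show ?thesis
    using assms by (simp add: op_def uc_derivs_lincomb right_diff_distrib sum_subtractf sum_distrib_left mult_ac)
qed

lemma op_diff: "entire f \<Longrightarrow> entire h \<Longrightarrow> op (\<lambda>s. f s - h s) s = op f s - op h s"
  by (simp add: op_def uc_derivs_diff algebra_simps sum_subtractf)

lemma entire_E [holomorphic_intros]: "entire E"
  unfolding E_def [abs_def] by (intro holomorphic_intros)

lemma E_nonzero [simp]: "E s \<noteq> 0" and inverse_E: "exp (- (a * exp s)) * E s = 1"
  by (simp_all add: E_def exp_minus)

lemma uc_derivs_E: "(uc_deriv ^^ l) E = (\<lambda>s. a ^ l * E s)"
proof (induction l)
  case (Suc l)
  have "uc_deriv (\<lambda>s. a ^ l * E s) s = exp (- s) * (a ^ l * (E s * (a * exp s)))" for s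
    by (rule uc_derivI) (auto simp: E_def [abs_def] intro!: derivative_eq_intros)
  then show ?case
    by (simp add: Suc.IH fun_eq_iff exp_minus)
qed simp

lemma op_main:
  "op W s = (uc_deriv ^^ n) W s - a ^ n * W s + (\<Sum>l<n - 1. g l * exp (- s) ^ (n - l) * (uc_deriv ^^ l) W s)"
proof -
  have "{..n} = insert n (insert (n - 1) {..<n - 1})" using n2 by auto
  moreover have "n \<notin> insert (n - 1) {..<n - 1}" "n - 1 \<notin> {..<n - 1}" using n2 by auto
  ultimately show ?thesis
    using g_top g_pred by (simp add: op_def del: funpow.simps)
qed

text \<open>Here n - l >= 2, hence (C/|z|)^(n-l) <= (C/|z|)^2, which is integrable along a
  ray.\<close>

lemma coeff_le:
  assumes "l < n - 1" and s: "C \<le> norm (exp s)"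
  shows "norm (g l * exp (- s) ^ (n - l)) \<le> G * C\<^sup>2 / norm (exp s) ^ 2"
proof -
  let ?x = "C / norm (exp s)"
  have s0: "0 < norm (exp s)" by simp
  have "norm (g l * exp (- s) ^ (n - l)) \<le> G * C ^ (n - l) * norm (exp (- s)) ^ (n - l)"
    unfolding norm_mult norm_power using assms by (intro mult_right_mono g_le) auto
  also have "\<dots> = G * ?x ^ (n - l)"
  proof -
    have "norm (exp (- s)) = 1 / norm (exp s)" 
      by (simp add: exp_minus [of "Re s"] divide_inverse)
    then show ?thesis by (simp add: power_divide del: norm_exp_eq_Re)
  qed
  also have "\<dots> \<le> G * ?x ^ 2"
  proof -
    have "?x \<le> 1" using s s0 by (simp only: divide_le_eq_1_pos)
    then show ?thesis
      using assms C G by (intro mult_left_mono power_decreasing) auto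
  qed
  finally show ?thesis by (simp add: power_divide)
qed

lemma op_residual:
  assumes s: "C \<le> norm (exp s)"
  shows "norm (exp (- (a * exp s)) * ((uc_deriv ^^ n) W s - a ^ n * W s))
     \<le> G * C\<^sup>2 * (\<Sum>i<n. amp a i W s) / norm (exp s) ^ 2 + norm (exp (- (a * exp s)) * op W s)"
proof -
  define e where "e = exp (- (a * exp s))"
  define x where "x = G * C\<^sup>2 / norm (exp s) ^ 2"
  define S where "S = (\<Sum>l<n - 1. g l * exp (- s) ^ (n - l) * (e * (uc_deriv ^^ l) W s))"
  have x0: "0 \<le> x" using G by (simp add: x_def)
  have "e * (\<Sum>l<n - 1. g l * exp (- s) ^ (n - l) * (uc_deriv ^^ l) W s) = S"
    by (simp only: S_def sum_distrib_left mult.left_commute [of e])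
  then have eq: "e * ((uc_deriv ^^ n) W s - a ^ n * W s) = e * op W s - S"
    by (simp only: op_main distrib_left) simp
  have "norm S \<le> (\<Sum>l<n - 1. x * amp a l W s)"
    unfolding S_def
  proof (rule sum_norm_le)
    fix l assume "l \<in> {..<n - 1}"
    then have "norm (g l * exp (- s) ^ (n - l)) * amp a l W s \<le> x * amp a l W s"
      unfolding x_def by (intro mult_right_mono coeff_le s) auto
    then show "norm (g l * exp (- s) ^ (n - l) * (e * (uc_deriv ^^ l) W s)) \<le> x * amp a l W s"
      by (simp only: amp_def e_def norm_mult [of "g l * exp (- s) ^ (n - l)"])
  qed
  also have "\<dots> \<le> (\<Sum>l<n. x * amp a l W s)"
    using x0 by (intro sum_mono2) auto
  also have "\<dots> = x * (\<Sum>l<n. amp a l W s)"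
    by (simp only: sum_distrib_left)
  finally have "norm (e * ((uc_deriv ^^ n) W s - a ^ n * W s)) \<le> x * (\<Sum>l<n. amp a l W s) + norm (e * op W s)"
    unfolding eq using norm_triangle_ineq4 [of "e * op W s" S] by linarith
  then show ?thesis
    by (simp only: e_def x_def times_divide_eq_left)
qed

lemma op_E_le:
  assumes s: "C \<le> norm (exp s)"
  shows "norm (exp (- (a * exp s)) * op E s) \<le> real n * real n ^ n * G * C\<^sup>2 / norm (exp s) ^ 2"
proof -
  let ?e = "exp (- (a * exp s))"
  have n1: "1 \<le> real n" using n2 by simp
  have "?e * op E s = (\<Sum>l<n - 1. g l * exp (- s) ^ (n - l) * a ^ l)"
    using inverse_E [of s] by (simp add: op_main uc_derivs_E sum_distrib_left mult.left_commute [of ?e])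
  also have "norm \<dots> \<le> (\<Sum>l<n - 1. G * C\<^sup>2 / norm (exp s) ^ 2 * real n ^ n)"
  proof (rule sum_norm_le)
    fix l assume l: "l \<in> {..<n - 1}"
    have "real n ^ l \<le> real n ^ n" using n1 l by (intro power_increasing) auto
    then show "norm (g l * exp (- s) ^ (n - l) * a ^ l) \<le> G * C\<^sup>2 / norm (exp s) ^ 2 * real n ^ n"
      unfolding norm_mult [of "_ * _"] using coeff_le [OF _ s] l G
      by (intro mult_mono) (auto simp: norm_power a)
  qed
  also have "\<dots> = real (n - 1) * (G * C\<^sup>2 / norm (exp s) ^ 2 * real n ^ n)" by simp
  also have "\<dots> \<le> real n * (G * C\<^sup>2 / norm (exp s) ^ 2 * real n ^ n)"
    using G by (intro mult_right_mono) auto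
  finally show ?thesis by (simp add: mult_ac)
qed

text \<open>Points of a ray from z have modulus at least \<kappa> |z|, so the first part gives
  modulus at least C along the whole ray. The second is the smallness hypothesis of
  \<open>backward_estimate\<close> with Q = G C^2.\<close>

definition large :: "real \<Rightarrow> complex \<Rightarrow> bool" where
  "large \<kappa> s \<longleftrightarrow> C \<le> \<kappa> * norm (exp s) \<and> 2 * real n ^ 2 * (G * C\<^sup>2) \<le> \<kappa>\<^sup>2 * norm (exp s)"

lemma estimate:
  assumes "ray_direction s d q" and W: "entire W" and L: "0 \<le> L" and M: "M > 0" and H: "0 \<le> H"
    and dom: "\<And>k. k < n \<Longrightarrow> 0 \<le> Re (d * (rate n a k - a))"
    and large: "large ((1 - q) / 2) s"
    and res: "\<And>t. 0 \<le> t \<Longrightarrow> t \<le> L \<Longrightarrow> norm (exp (- (a * exp (ray s d t))) * op W (ray s d t))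
        \<le> H / norm (exp (ray s d t)) ^ (M + 1)"
    and i: "i < n"
  shows "amp a i W s \<le> 2 * real n * (real n ^ n * (\<Sum>j<n. amp a j W (ray s d L))
            + H / ((1 - q) / 2) ^ (M + 1) / norm (exp s) ^ M)"
proof -
  interpret ray_direction s d q by fact
  show ?thesis
  proof (rule backward_estimate [OF a W L M _ H dom _ _ i, where Q = "G * C\<^sup>2"])
    show "norm (exp (- (a * exp (ray s d t))) * ((uc_deriv ^^ n) W (ray s d t) - a ^ n * W (ray s d t)))
       \<le> G * C\<^sup>2 * (\<Sum>i<n. amp a i W (ray s d t)) / norm (exp (ray s d t)) ^ 2 + H / norm (exp (ray s d t)) ^ (M + 1)"
      if t: "0 \<le> t" "t \<le> L" for t
    proof -
      have "C \<le> (1 - q) / 2 * norm (exp s)"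
        using large by (simp add: large_def)
      also have "\<dots> \<le> (1 - q) / 2 * (norm (exp s) + t)"
        using q t by (intro mult_left_mono) auto
      also have "\<dots> \<le> norm (exp (ray s d t))"
        unfolding exp_ray [OF t(1)] by (rule norm_point [OF t(1)])
      finally show ?thesis
        using op_residual [of "ray s d t" W] res [OF t] by linarith
    qed
  qed (use G large in \<open>auto simp: large_def\<close>)
qed

text \<open>If W is negligible against exp (a z) at the end of the ray, the boundary term of
  \<open>estimate\<close> disappears and the residual alone controls W.\<close>

lemma estimate_limit:
  assumes "ray_direction s d q" and W: "entire W" and M: "M > 0" and H: "0 \<le> H"
    and dom: "\<And>k. k < n \<Longrightarrow> 0 \<le> Re (d * (rate n a k - a))"
    and large: "large ((1 - q) / 2) s"
    and res: "\<And>t. 0 \<le> t \<Longrightarrow> norm (exp (- (a * exp (ray s d t))) * op W (ray s d t))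
        \<le> H / norm (exp (ray s d t)) ^ (M + 1)"
    and lim: "\<And>j. j < n \<Longrightarrow> ((\<lambda>t. amp a j W (ray s d t)) \<longlongrightarrow> 0) at_top"
    and i: "i < n"
  shows "amp a i W s \<le> 2 * real n * (H / ((1 - q) / 2) ^ (M + 1)) / norm (exp s) ^ M"
proof -
  let ?B = "H / ((1 - q) / 2) ^ (M + 1) / norm (exp s) ^ M"
  have "((\<lambda>L. 2 * real n * (real n ^ n * (\<Sum>j<n. amp a j W (ray s d L)) + ?B)) \<longlongrightarrow>
     2 * real n * (real n ^ n * (\<Sum>j<n. 0) + ?B)) at_top"
    by (intro tendsto_intros lim) auto
  moreover have "\<forall>\<^sub>F L in at_top. amp a i W s \<le> 2 * real n * (real n ^ n * (\<Sum>j<n. amp a j W (ray s d L)) + ?B)"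
    using eventually_ge_at_top [of 0]
    by eventually_elim (rule estimate [OF assms(1) W _ M H dom large res i])
  ultimately have "amp a i W s \<le> 2 * real n * (real n ^ n * (\<Sum>j<n. 0) + ?B)"
    by (intro tendsto_lowerbound) auto
  then show ?thesis by simp
qed

section \<open>Admissible directions and the axis of fastest decay\<close>

lemma Re_direction: "Re (cis (\<phi> + \<beta>) * (rate n a k - a)) = real n * (cos \<beta> - cos (\<beta> + 2 * pi * real k / real n))"
proof -
  have "cis (\<phi> + \<beta>) * (rate n a k - a) = (a * cis \<phi>) * (cis \<beta> * (cis (2 * pi * real k / real n) - 1))"
    by (simp add: rate_def cis_mult [symmetric] algebra_simps)
  also have "\<dots> = of_nat n * (cis \<beta> - cis (\<beta> + 2 * pi * real k / real n))"
    by (simp add: \<phi> cis_mult [symmetric] algebra_simps)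
  finally show ?thesis by simp
qed

text \<open>With h = pi k / n the difference of cosines is 2 sin h sin (\<beta> + h). For 1 <= k <=
  n - 1 the angle h lies in [pi/n, pi - pi/n], so |\<beta>| <= pi/n keeps both sines
  nonnegative.\<close>

lemma direction_dominates:
  assumes "\<bar>\<beta>\<bar> \<le> pi / real n" "k < n"
  shows "0 \<le> Re (cis (\<phi> + \<beta>) * (rate n a k - a))"
proof -
  let ?h = "pi * real k / real n"
  have n0: "0 < real n" using n2 by simp
  have "0 \<le> sin ?h * sin (\<beta> + ?h)"
  proof (cases "k = 0")
    case False
    then have k: "pi * 1 \<le> pi * real k" "pi * real k \<le> pi * (real n - 1)"
      using assms(2) by (auto intro!: mult_left_mono)
    have "pi / real n \<le> ?h" "?h \<le> pi - pi / real n"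
      using k n0 divide_right_mono [OF k(1), of "real n"] divide_right_mono [OF k(2), of "real n"]
      by (auto simp: field_simps)
    then have "0 \<le> ?h" "?h \<le> pi" "0 \<le> \<beta> + ?h" "\<beta> + ?h \<le> pi"
      using assms(1) n0 by (auto simp: abs_le_iff)
    then show ?thesis by (intro mult_nonneg_nonneg sin_ge_zero)
  qed simp
  moreover have "cos \<beta> - cos (\<beta> + 2 * pi * real k / real n) = 2 * (sin ?h * sin (\<beta> + ?h))"
    using cos_diff_cos [of \<beta> "\<beta> + 2 * ?h"] by (simp add: algebra_simps add_divide_distrib)
  ultimately show ?thesis
    unfolding Re_direction using n0 by (intro mult_nonneg_nonneg) auto
qed

definition axis :: "real \<Rightarrow> complex" where
  "axis r = of_real (ln r) + \<i> * of_real \<phi>"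

lemma exp_axis: "r > 0 \<Longrightarrow> exp (axis r) = of_real r * cis \<phi>"
  by (simp add: axis_def exp_add exp_of_real cis_conv_exp)

lemma norm_exp_axis: "r > 0 \<Longrightarrow> norm (exp (axis r)) = r"
  by (simp add: exp_axis norm_mult)

lemma ray_direction_axis: "r > 0 \<Longrightarrow> ray_direction (axis r) (cis \<phi>) 0"
  by unfold_locales (auto simp: exp_axis norm_mult complex_cnj_mult mult.left_commute cis_cnj cis_mult)

lemma ray_axis:
  assumes "r > 0" "t \<ge> 0"
  shows "ray (axis r) (cis \<phi>) t = axis (r + t)"
proof -
  have "exp (- axis r) = of_real (1 / r) * cis (- \<phi>)"
    using assms by (simp add: axis_def exp_diff exp_minus exp_of_real cis_conv_exp field_simps)
  then have "1 + of_real t * (cis \<phi> * exp (- axis r)) = of_real (1 + t / r)"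
    by (simp add: mult.left_commute cis_mult)
  then have "ray (axis r) (cis \<phi>) t = axis r + of_real (ln (1 + t / r))"
    unfolding ray_def using assms by (simp only: Ln_of_real [of "1 + t / r"] divide_nonneg_pos add_pos_nonneg zero_less_one)
  also have "1 + t / r = (r + t) / r" using assms by (simp add: field_simps)
  also have "ln ((r + t) / r) = ln (r + t) - ln r" using assms by (simp add: ln_div)
  finally show ?thesis by (simp add: axis_def)
qed

text \<open>Made for \<kappa> >= 1/10, that is q <= 4/5: as \<kappa>^2 >= 1/100, the second part of
  \<open>large\<close> follows from |z| >= 200 n^2 G C^2, and the summand 1 gives |z| >= 10
  C.\<close>

definition r0 :: real where
  "r0 = 200 * (real n ^ 2 * G + 1) * C\<^sup>2"

lemma large_r0:
  assumes "1 / 10 \<le> \<kappa>" "r0 \<le> norm (exp s)"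
  shows "large \<kappa> s"
proof -
  have CC: "C \<le> C\<^sup>2" "0 \<le> C\<^sup>2" using C by (auto simp: power2_eq_square)
  have G0: "0 \<le> real n ^ 2 * G * C\<^sup>2" using G by simp
  have r: "r0 = 200 * (real n ^ 2 * G * C\<^sup>2) + 200 * C\<^sup>2"
    by (simp add: r0_def algebra_simps)
  have "1 / 10 * norm (exp s) \<le> \<kappa> * norm (exp s)"
    using assms(1) by (rule mult_right_mono) auto
  moreover have "1 / 100 * norm (exp s) \<le> \<kappa>\<^sup>2 * norm (exp s)"
    using power_mono [OF assms(1), of 2] by (intro mult_right_mono) (auto simp: power2_eq_square)
  moreover have "10 * C \<le> norm (exp s)" "200 * (real n ^ 2 * G * C\<^sup>2) \<le> norm (exp s)"
    using assms(2) CC G0 C unfolding r by linarith+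
  ultimately show ?thesis
    unfolding large_def mult.assoc [symmetric] by (intro conjI) linarith+
qed

lemma large_axis: "1 / 10 \<le> \<kappa> \<Longrightarrow> r0 \<le> r \<Longrightarrow> 0 < r \<Longrightarrow> large \<kappa> (axis r)"
  by (rule large_r0) (simp_all only: norm_exp_axis)

lemma r0_ge: "1 \<le> r0" "C \<le> r0"
proof -
  have CC: "C \<le> C\<^sup>2" using C by (auto simp: power2_eq_square)
  have "1 * C\<^sup>2 \<le> 200 * (real n ^ 2 * G + 1) * C\<^sup>2" using G by (intro mult_right_mono) auto
  then show "C \<le> r0" "1 \<le> r0" using CC C unfolding r0_def by linarith+
qed

text \<open>The estimates yield vanishing only on a piece of the axis; the identity theorem spreads
  it over the cover.\<close>

lemma vanishing_on_axis:
  assumes W: "entire W" and "0 < x" "x < y" and 0: "\<And>r. x \<le> r \<Longrightarrow> r \<le> y \<Longrightarrow> W (axis r) = 0"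
  shows "W s = 0"
proof (rule analytic_continuation [OF W open_UNIV connected_UNIV subset_UNIV, where U = "axis ` {x..y}" and \<xi> = "axis x"])
  show "axis x islimpt axis ` {x..y}"
    unfolding islimpt_sequential
  proof (intro exI conjI)
    let ?f = "\<lambda>k::nat. axis (x + (y - x) / real (Suc k))"
    show "\<forall>k. ?f k \<in> axis ` {x..y} - {axis x}"
    proof
      fix k
      have "(y - x) / real (Suc k) \<le> (y - x) / 1" using assms by (intro divide_left_mono) auto
      moreover have "0 < (y - x) / real (Suc k)" using assms by simp
      ultimately show "?f k \<in> axis ` {x..y} - {axis x}"
        using assms(2) by (auto simp: axis_def simp del: of_nat_Suc)
    qed
    have "(\<lambda>k. x + (y - x) / real (Suc k)) \<longlonglongrightarrow> x + 0"
      by (intro tendsto_intros LIMSEQ_Suc lim_const_over_n)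
    then show "?f \<longlonglongrightarrow> axis x"
      unfolding axis_def using assms by (intro tendsto_intros) auto
  qed
qed (use 0 in auto)

lemma ivp_unique:
  assumes W: "euler_solution n a g W" and r: "r0 < r" and 0: "\<And>j. j < n \<Longrightarrow> (deriv ^^ j) W (axis r) = 0"
  shows "W s = 0"
proof (rule vanishing_on_axis [where W = W and s = s and x = "r0" and y = r])
  show eW: "entire W" using W by (simp add: euler_solution_op)
  show "0 < r0" using r0_ge by simp
  show "r0 < r" by fact
  fix x assume x: "r0 \<le> x" "x \<le> r"
  have x0: "x > 0" using x r0_ge by simp
  have "amp a 0 W (axis x) \<le> 2 * real n * (real n ^ n * (\<Sum>j<n. amp a j W (ray (axis x) (cis \<phi>) (r - x)))
            + 0 / ((1 - 0) / 2) ^ (1 + 1) / norm (exp (axis x)) ^ 1)"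
    by (rule estimate [OF ray_direction_axis [OF x0] eW])
       (use x x0 W n2 direction_dominates [of 0] in \<open>auto simp: euler_solution_op intro!: large_axis\<close>)
  also have "\<dots> = 0"
    using x x0 uc_derivs_eq_0 [OF eW 0] by (simp add: ray_axis amp_def)
  finally show "W (axis x) = 0" by (simp add: amp_def)
qed

text \<open>The residual is 0, so once the boundary term at infinity is gone nothing remains on the
  right: no nonzero solution is smaller than exp (a z) along the axis.\<close>

lemma recessive_unique:
  assumes W: "euler_solution n a g W" and lim: "\<And>j. j < n \<Longrightarrow> ((\<lambda>r. amp a j W (axis r)) \<longlongrightarrow> 0) at_top"
  shows "W s = 0"
proof (rule vanishing_on_axis [where W = W and s = s and x = "r0" and y = "r0 + 1"])
  show eW: "entire W" using W by (simp add: euler_solution_op)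
  show "0 < r0" using r0_ge by simp
  show "r0 < r0 + 1" by simp
  fix x assume x: "r0 \<le> x"
  have x0: "x > 0" using x r0_ge by simp
  have "((\<lambda>t. amp a j W (ray (axis x) (cis \<phi>) t)) \<longlongrightarrow> 0) at_top" if "j < n" for j
  proof (rule Lim_transform_eventually)
    show "((\<lambda>t. amp a j W (axis (x + t))) \<longlongrightarrow> 0) at_top"
      by (rule filterlim_compose [OF lim [OF that]]) (rule filterlim_tendsto_add_at_top [OF tendsto_const filterlim_ident])
    show "\<forall>\<^sub>F t in at_top. amp a j W (axis (x + t)) = amp a j W (ray (axis x) (cis \<phi>) t)"
      using eventually_ge_at_top [of 0] by eventually_elim (simp add: ray_axis x0)
  qed
  then have "amp a 0 W (axis x) \<le> 2 * real n * (0 / ((1 - 0) / 2) ^ (1 + 1)) / norm (exp (axis x)) ^ 1"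
    by (intro estimate_limit [OF ray_direction_axis [OF x0] eW])
       (use x x0 W n2 direction_dominates [of 0] in \<open>auto simp: euler_solution_op intro!: large_axis\<close>)
  then show "W (axis x) = 0" by (simp add: amp_def)
qed

end

section \<open>Existence of the recessive solution\<close>

lemma derivs_lincomb:
  assumes "finite I" and "\<And>i. i \<in> I \<Longrightarrow> entire (f i)"
  shows "(deriv ^^ j) (\<lambda>s. \<Sum>i\<in>I. c i * f i s) = (\<lambda>s. \<Sum>i\<in>I. c i * (deriv ^^ j) (f i) s)"
proof (induction j)
  case (Suc j)
  have "deriv (\<lambda>s. \<Sum>i\<in>I. c i * (deriv ^^ j) (f i) s) s = (\<Sum>i\<in>I. c i * (deriv ^^ Suc j) (f i) s)" for s
    using assms by (intro DERIV_imp_deriv DERIV_sum DERIV_cmult derivs_DERIV) auto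
  then have "deriv (\<lambda>s. \<Sum>i\<in>I. c i * (deriv ^^ j) (f i) s) = (\<lambda>s. \<Sum>i\<in>I. c i * (deriv ^^ Suc j) (f i) s)"
    by (rule ext)
  then show ?case
    using Suc.IH by simp
qed simp

context euler_ode
begin

lemma amp_eq_0: "entire f \<Longrightarrow> (\<And>i. i < n \<Longrightarrow> (deriv ^^ i) f s = 0) \<Longrightarrow> i < n \<Longrightarrow> amp a i f s = 0"
  using uc_derivs_eq_0 [of f n s i] by (simp add: amp_def)

text \<open>The half-width 3 pi/4 exceeds pi/2 >= pi/n, so rays in all admissible directions end up
  strictly inside. On the other hand - cos (3 pi/4) < 4/5, so segments from any point of the range
  to far points of the axis satisfy the ray condition with q = 4/5.\<close>

definition recessive :: "(complex \<Rightarrow> complex) \<Rightarrow> bool" where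
  "recessive W \<longleftrightarrow> (\<exists>K R. \<forall>s. \<bar>Im s - \<phi>\<bar> \<le> 3 * pi / 4 \<longrightarrow> R \<le> norm (exp s) \<longrightarrow>
     (\<forall>i<n. amp a i (\<lambda>s. W s - E s) s \<le> K / norm (exp s)))"

definition H1 :: real where
  "H1 = real n * real n ^ n * G * C\<^sup>2"

lemma H1_nonneg: "0 \<le> H1"
  using G by (simp add: H1_def)

text \<open>W - exp (a z) vanishes to order n at the far end, and its residual is
  O(\<open>H1\<close> / |z|^2), so \<open>estimate\<close> with M = 1 applies. As (1 - q)/2 >= 1/10,
  the constant is 2 n (1/10)^(-2) \<open>H1\<close>.\<close>

lemma estimate_E:
  assumes "ray_direction s d q" and W: "euler_solution n a g W" and L: "0 \<le> L"
    and dom: "\<And>k. k < n \<Longrightarrow> 0 \<le> Re (d * (rate n a k - a))"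
    and qle: "q \<le> 4 / 5" and s: "r0 \<le> norm (exp s)"
    and 0: "\<And>i. i < n \<Longrightarrow> (deriv ^^ i) (\<lambda>s. W s - E s) (ray s d L) = 0" and i: "i < n"
  shows "amp a i (\<lambda>s. W s - E s) s \<le> 200 * real n * H1 / norm (exp s)"
proof -
  interpret ray_direction s d q by fact
  have W': "entire W" "\<And>s. op W s = 0"
    using W by (auto simp: euler_solution_op)
  have eW: "entire (\<lambda>s. W s - E s)"
    by (intro holomorphic_intros W')
  have l: "large ((1 - q) / 2) s"
    using qle s by (intro large_r0) auto
  have "amp a i (\<lambda>s. W s - E s) s \<le> 2 * real n * (real n ^ n * (\<Sum>j<n. amp a j (\<lambda>s. W s - E s) (ray s d L))
            + H1 / ((1 - q) / 2) ^ (1 + 1) / norm (exp s) ^ 1)"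
  proof (rule estimate [OF assms(1) eW L _ H1_nonneg dom l _ i])
    fix t assume t: "0 \<le> t" "t \<le> L"
    have "C \<le> (1 - q) / 2 * norm (exp s)" using l by (simp add: large_def)
    also have "\<dots> \<le> (1 - q) / 2 * (norm (exp s) + t)"
      using q t by (intro mult_left_mono) auto
    also have "\<dots> \<le> norm (exp (ray s d t))"
      unfolding exp_ray [OF t(1)] by (rule norm_point [OF t(1)])
    finally have "norm (exp (- (a * exp (ray s d t))) * op E (ray s d t)) \<le> H1 / norm (exp (ray s d t)) ^ 2"
      unfolding H1_def by (rule op_E_le)
    then show "norm (exp (- (a * exp (ray s d t))) * op (\<lambda>s. W s - E s) (ray s d t)) \<le> H1 / norm (exp (ray s d t)) ^ (1 + 1)"
      unfolding op_diff [OF W'(1) entire_E] W'(2) by (simp add: numeral_2_eq_2)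
  qed simp
  also have "(\<Sum>j<n. amp a j (\<lambda>s. W s - E s) (ray s d L)) = 0"
    using amp_eq_0 [OF eW 0] by simp
  also have "2 * real n * (real n ^ n * 0 + H1 / ((1 - q) / 2) ^ (1 + 1) / norm (exp s) ^ 1)
      \<le> 2 * real n * (real n ^ n * 0 + H1 / (1 / 10) ^ (1 + 1) / norm (exp s) ^ 1)"
    using qle H1_nonneg by (intro mult_left_mono add_left_mono divide_right_mono divide_left_mono power_mono) auto
  finally show ?thesis
    by (simp add: mult_ac)
qed

text \<open>The direction from z to r exp (i \<phi>) tends to exp (i \<phi>), where the inequalities
  are strict, so they hold for large r. The case k = 0 is an equality for every d.\<close>

lemma eventually_axis_direction:
  assumes s: "\<bar>Im s - \<phi>\<bar> \<le> 3 * pi / 4"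
  shows "\<forall>\<^sub>F r in at_top. \<exists>d L. ray_direction s d (4 / 5) \<and> 0 \<le> L \<and> ray s d L = axis r \<and>
     (\<forall>k<n. 0 \<le> Re (d * (rate n a k - a)))"
proof -
  define z where "z = exp s"
  define \<alpha> where "\<alpha> = Im s - \<phi>"
  define u where "u r = cis \<phi> - z * of_real (inverse r)" for r
  define d where "d r = u r / of_real (norm (u r))" for r
  have "(u \<longlongrightarrow> cis \<phi> - z * of_real 0) at_top"
    unfolding u_def by (intro tendsto_intros tendsto_inverse_0_at_top filterlim_ident)
  then have u_lim: "(u \<longlongrightarrow> cis \<phi>) at_top" by simp
  have "(d \<longlongrightarrow> cis \<phi> / of_real (norm (cis \<phi>))) at_top"
    unfolding d_def by (intro tendsto_intros u_lim) auto
  then have d_lim: "(d \<longlongrightarrow> cis \<phi>) at_top" by simp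
  have u0: "\<forall>\<^sub>F r in at_top. u r \<noteq> 0"
    using tendsto_imp_eventually_ne [OF u_lim, of 0] by simp
  have "cos (3 * pi / 4) \<le> cos \<bar>\<alpha>\<bar>"
    using s by (intro cos_monotone_0_pi_le) (auto simp: \<alpha>_def)
  moreover have "cos (3 * pi / 4) = - (sqrt 2 / 2)"
    using cos_pi_minus [of "pi / 4"] by (simp add: cos_45 field_simps)
  moreover have "sqrt 2 < 8 / 5"
    by (rule real_less_lsqrt) (auto simp: power2_eq_square)
  ultimately have cos\<alpha>: "- (4 / 5) < cos \<alpha>" by simp
  define R where "R = norm z"
  have "z = of_real R * cis (\<phi> + \<alpha>)"
    unfolding R_def z_def \<alpha>_def norm_exp_eq_Re by (simp add: exp_eq_polar)
  then have "cnj z = of_real R * cis (- (\<phi> + \<alpha>))"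
    by (simp add: cis_cnj)
  then have "cis \<phi> * cnj z = of_real R * (cis \<phi> * cis (- (\<phi> + \<alpha>)))"
    by (simp only: mult.left_commute)
  also have "\<dots> = of_real R * cis (- \<alpha>)"
    by (simp only: cis_mult) simp
  finally have "Re (cis \<phi> * cnj z) = norm z * cos \<alpha>"
    by (simp add: R_def)
  moreover have "0 < norm z" by (simp add: z_def)
  ultimately have "- (4 / 5 * norm z) < Re (cis \<phi> * cnj z)"
    using mult_strict_left_mono [OF cos\<alpha>, of "norm z"] by simp
  moreover have "((\<lambda>r. Re (d r * cnj z)) \<longlongrightarrow> Re (cis \<phi> * cnj z)) at_top"
    by (intro tendsto_intros d_lim)
  ultimately have ev1: "\<forall>\<^sub>F r in at_top. - (4 / 5 * norm z) < Re (d r * cnj z)"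
    by (rule order_tendstoD(1) [rotated])
  have "\<forall>\<^sub>F r in at_top. 0 \<le> Re (d r * (rate n a k - a))" if k: "k < n" for k
  proof (cases "k = 0")
    case True
    then show ?thesis by (simp add: rate_def)
  next
    case False
    have "((\<lambda>r. Re (d r * (rate n a k - a))) \<longlongrightarrow> Re (cis \<phi> * (rate n a k - a))) at_top"
      by (intro tendsto_intros d_lim)
    moreover have "0 < Re (cis \<phi> * (rate n a k - a))"
    proof -
      have "0 < sin (pi * real k / real n)"
        using False k by (intro sin_gt_zero) (auto simp: field_simps)
      moreover have "cos (2 * pi * real k / real n) = 1 - 2 * sin (pi * real k / real n) ^ 2"
        using cos_double_sin [of "pi * real k / real n"] by (simp add: mult.assoc)
      ultimately show ?thesis
        using Re_direction [of 0 k] n2 by simp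
    qed
    ultimately have "\<forall>\<^sub>F r in at_top. 0 < Re (d r * (rate n a k - a))"
      by (rule order_tendstoD(1))
    then show ?thesis by eventually_elim simp
  qed
  then have ev2: "\<forall>\<^sub>F r in at_top. \<forall>k\<in>{..<n}. 0 \<le> Re (d r * (rate n a k - a))"
    by (intro eventually_ball_finite) auto
  show ?thesis
    using ev1 ev2 u0 eventually_gt_at_top [of 0]
  proof eventually_elim
    case (elim r)
    have "ray_direction s (d r) (4 / 5)"
    proof
      show "norm (d r) = 1" using elim(3) by (simp add: d_def norm_divide)
      show "- (4 / 5 * norm (exp s)) \<le> Re (d r * cnj (exp s))" using elim(1) unfolding z_def by (rule less_imp_le)
    qed simp_all
    \<comment> \<open>The principal logarithm recovers \<open>axis r - s\<close> because |\<phi> -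
      Im s| < pi: the segment ends on the right sheet of the cover.\<close>
    moreover have "ray s (d r) (r * norm (u r)) = axis r"
    proof -
      have "of_real (r * norm (u r)) * (d r * exp (- s)) = of_real r * u r * exp (- s)"
        using elim by (simp add: d_def)
      also have "\<dots> = of_real r * cis \<phi> * exp (- s) - 1"
      proof -
        have "of_real r * u r * exp (- s) = of_real r * cis \<phi> * exp (- s) - (of_real r * of_real (inverse r)) * (z * exp (- s))"
          unfolding u_def by (simp only: left_diff_distrib right_diff_distrib mult_ac)
        also have "of_real r * of_real (inverse r) = (1 :: complex)" using elim by (simp flip: of_real_mult)
        also have "z * exp (- s) = 1" by (simp add: z_def exp_minus)
        finally show ?thesis by simp
      qed
      also have "\<dots> = exp (axis r - s) - 1"
        using elim by (simp only: diff_conv_add_uminus [of "axis r"] exp_add exp_axis)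
      finally have "ray s (d r) (r * norm (u r)) = s + Ln (exp (axis r - s))"
        by (simp add: ray_def)
      also have "Ln (exp (axis r - s)) = axis r - s"
      proof (rule Ln_exp)
        have "- pi < \<phi> - Im s \<and> \<phi> - Im s \<le> pi" using s pi_gt_zero by linarith
        then show "- pi < Im (axis r - s)" "Im (axis r - s) \<le> pi" by (simp_all add: axis_def)
      qed
      finally show ?thesis by simp
    qed
    moreover have "0 \<le> r * norm (u r)" using elim by simp
    ultimately show ?case using elim by blast
  qed
qed

lemma recessive_solution_exists: "\<exists>W. euler_solution n a g W \<and> recessive W"
proof -
  define r1 where "r1 = r0 + 1"
  have r1: "r0 < r1" "0 < r1" using r0_ge by (auto simp: r1_def)
  have n0: "n > 0" using n2 by simp
  \<comment> \<open>Matching points receding along the axis; w N below agrees with exp (a z) to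
    order n at the N-th of them.\<close>
  define \<rho> where "\<rho> N = r1 + real N" for N
  have \<rho>: "r1 \<le> \<rho> N" "0 < \<rho> N" "r0 \<le> \<rho> N" for N using r1 by (auto simp: \<rho>_def)
  have "\<exists>W. euler_solution n a g W \<and> (\<forall>i<n. (deriv ^^ i) W (axis (\<rho> N)) = (deriv ^^ i) E (axis (\<rho> N)))" for N
    by (rule euler_solution_exists) (use n0 g_top in auto)
  then obtain w where w: "\<And>N. euler_solution n a g (w N)"
    and wE: "\<And>N i. i < n \<Longrightarrow> (deriv ^^ i) (w N) (axis (\<rho> N)) = (deriv ^^ i) E (axis (\<rho> N))"
    by metis
  have ew: "entire (w N)" "op (w N) s = 0" for N s using w by (auto simp: euler_solution_op)
  have ewE: "entire (\<lambda>s. w N s - E s)" for N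
    by (intro holomorphic_intros ew)
  have wE0: "(deriv ^^ i) (\<lambda>s. w N s - E s) (axis (\<rho> N)) = 0" if "i < n" for i N
    using wE [OF that] by (simp add: higher_deriv_diff [OF ew(1) entire_E])
  \<comment> \<open>A fundamental system at the fixed point r1. Convergence of the n initial values
    there gives convergence of all derivatives at every point.\<close>
  obtain f where f: "\<And>j. euler_solution n a g (f j)"
    and fj: "\<And>i j. i < n \<Longrightarrow> (deriv ^^ i) (f j) (axis r1) = (if i = j then 1 else 0)"
  proof -
    have "\<exists>W. euler_solution n a g W \<and> (\<forall>i<n. (deriv ^^ i) W (axis r1) = (if i = j then 1 else 0))" for j :: nat
      by (rule euler_solution_exists) (use n0 g_top in auto)
    then show thesis using that by metis
  qed
  have ef: "entire (f j)" "op (f j) s = 0" for j s using f by (auto simp: euler_solution_op)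
  have w_eq: "w N s = (\<Sum>j<n. (deriv ^^ j) (w N) (axis r1) * f j s)" for N s
  proof -
    define v where "v s = (\<Sum>j<n. (deriv ^^ j) (w N) (axis r1) * f j s)" for s
    have ev: "entire v" unfolding v_def [abs_def] by (intro holomorphic_intros ef)
    have "op v s = 0" for s
      unfolding v_def [abs_def] by (simp add: op_lincomb ef)
    then have "euler_solution n a g (\<lambda>s. w N s - v s)"
      unfolding euler_solution_op op_diff [OF ew(1) ev] using ew ev by (auto intro: holomorphic_intros)
    moreover have "(deriv ^^ i) (\<lambda>s. w N s - v s) (axis r1) = 0" if "i < n" for i
    proof -
      have "(deriv ^^ i) v (axis r1) = (\<Sum>j<n. (deriv ^^ j) (w N) (axis r1) * (if i = j then 1 else 0))"
        unfolding v_def [abs_def] by (simp add: derivs_lincomb ef fj [OF that])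
      also have "\<dots> = (deriv ^^ i) (w N) (axis r1)"
        using that by (simp add: if_distrib [of "\<lambda>x. _ * x"] cong: if_cong)
      finally show ?thesis
        by (simp add: higher_deriv_diff [OF ew(1) ev])
    qed
    ultimately have "w N s - v s = 0"
      using ivp_unique [of "\<lambda>s. w N s - v s" r1 s] r1 by blast
    then show ?thesis by (simp add: v_def)
  qed
  define A where "A = 400 * real n ^ 3 * real n ^ n * H1"
  have A0: "A \<ge> 0" using H1_nonneg by (simp add: A_def)
  \<comment> \<open>At the N-th matching point w N is exp (a z) to order n, so the difference is w
    N' - exp (a z), which is O(1/\<rho> N) by \<open>estimate_E\<close>. The estimate with zero
    residual carries this back to r1; A is the product of both constants.\<close>
  have amp_diff: "amp a i (\<lambda>s. w N' s - w N s) (axis r1) \<le> A / \<rho> N"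
    if N: "N \<le> N'" and i: "i < n" for N N' i
  proof -
    define D where "D s = w N' s - w N s" for s
    have eD: "entire D" unfolding D_def [abs_def] by (intro holomorphic_intros ew)
    have D_eq: "D = (\<lambda>s. (w N' s - E s) - (w N s - E s))" by (simp add: D_def fun_eq_iff)
    have ax: "ray (axis r1) (cis \<phi>) (\<rho> N - r1) = axis (\<rho> N)" "ray (axis (\<rho> N)) (cis \<phi>) (\<rho> N' - \<rho> N) = axis (\<rho> N')"
      using N r1 \<rho>(1,2) by (simp_all add: ray_axis \<rho>_def)
    have Dj: "amp a j D (axis (\<rho> N)) \<le> 200 * real n * H1 / \<rho> N" if j: "j < n" for j
    proof -
      have "amp a j D (axis (\<rho> N)) \<le> amp a j (\<lambda>s. w N' s - E s) (axis (\<rho> N)) + amp a j (\<lambda>s. w N s - E s) (axis (\<rho> N))"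
        unfolding D_eq by (rule amp_diff_le [OF ewE ewE])
      also have "amp a j (\<lambda>s. w N s - E s) (axis (\<rho> N)) = 0"
        by (rule amp_eq_0 [OF ewE wE0 j])
      also have "amp a j (\<lambda>s. w N' s - E s) (axis (\<rho> N)) \<le> 200 * real n * H1 / norm (exp (axis (\<rho> N)))"
      proof (rule estimate_E [OF ray_direction_axis [OF \<rho>(2)] w _ _ _ _ _ j])
        show "0 \<le> \<rho> N' - \<rho> N" using N by (simp add: \<rho>_def)
        show "r0 \<le> norm (exp (axis (\<rho> N)))" using \<rho> by (simp only: norm_exp_axis)
        show "(deriv ^^ i) (\<lambda>s. w N' s - E s) (ray (axis (\<rho> N)) (cis \<phi>) (\<rho> N' - \<rho> N)) = 0" if "i < n" for i
          unfolding ax by (rule wE0 [OF that])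
        show "0 \<le> Re (cis \<phi> * (rate n a k - a))" if "k < n" for k
          using direction_dominates [of 0 k] that by simp
      qed simp
      finally show ?thesis
        unfolding norm_exp_axis [OF \<rho>(2)] by simp
    qed
    have "amp a i D (axis r1) \<le> 2 * real n * (real n ^ n * (\<Sum>j<n. amp a j D (ray (axis r1) (cis \<phi>) (\<rho> N - r1)))
            + 0 / ((1 - 0) / 2) ^ (1 + 1) / norm (exp (axis r1)) ^ 1)"
    proof (rule estimate [OF ray_direction_axis [OF r1(2)] eD _ _ _ _ _ _ i])
      show "0 \<le> \<rho> N - r1" by (simp add: \<rho>_def)
      show "large ((1 - 0) / 2) (axis r1)" using r1 by (intro large_axis) auto
      show "0 \<le> Re (cis \<phi> * (rate n a k - a))" if "k < n" for k
        using direction_dominates [of 0 k] that by simp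
      show "norm (exp (- (a * exp (ray (axis r1) (cis \<phi>) t))) * op D (ray (axis r1) (cis \<phi>) t))
        \<le> 0 / norm (exp (ray (axis r1) (cis \<phi>) t)) ^ (1 + 1)" for t
        unfolding D_def [abs_def] op_diff [OF ew(1) ew(1)] ew(2) by simp
    qed auto
    also have "\<dots> = 2 * real n * (real n ^ n * (\<Sum>j<n. amp a j D (axis (\<rho> N))))"
      by (simp add: ax)
    also have "\<dots> \<le> 2 * real n * (real n ^ n * (\<Sum>j<n. 200 * real n * H1 / \<rho> N))"
      by (intro mult_left_mono sum_mono Dj) auto
    also have "\<dots> = A / \<rho> N"
      by (simp add: A_def power3_eq_cube)
    finally show ?thesis by (simp add: D_def [abs_def])
  qed
  have conv: "convergent (\<lambda>N. (uc_deriv ^^ i) (w N) (axis r1))" if i: "i < n" for i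
  proof -
    have "Cauchy (\<lambda>N. (uc_deriv ^^ i) (w N) (axis r1))"
    proof (rule CauchyI')
      fix \<epsilon> :: real assume \<epsilon>: "0 < \<epsilon>"
      define B where "B = norm (E (axis r1)) * A"
      obtain M :: nat where M: "B / \<epsilon> < real M" using reals_Archimedean2 by blast
      have "dist ((uc_deriv ^^ i) (w m) (axis r1)) ((uc_deriv ^^ i) (w N') (axis r1)) < \<epsilon>" if "m \<ge> M" "N' > m" for m N'
      proof -
        have "(uc_deriv ^^ i) (w N') (axis r1) - (uc_deriv ^^ i) (w m) (axis r1)
           = E (axis r1) * (exp (- (a * exp (axis r1))) * (uc_deriv ^^ i) (\<lambda>s. w N' s - w m s) (axis r1))"
          using inverse_E [of "axis r1"] by (simp add: uc_derivs_diff [OF ew(1) ew(1)] mult.assoc [symmetric] mult.commute)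
        then have "dist ((uc_deriv ^^ i) (w m) (axis r1)) ((uc_deriv ^^ i) (w N') (axis r1))
           = norm (E (axis r1)) * amp a i (\<lambda>s. w N' s - w m s) (axis r1)"
          by (simp add: dist_norm norm_minus_commute amp_def norm_mult)
        also have "\<dots> \<le> norm (E (axis r1)) * (A / \<rho> m)"
          using that i by (intro mult_left_mono amp_diff) auto
        also have "\<dots> = B / \<rho> m" by (simp add: B_def)
        also have "\<dots> < \<epsilon>"
        proof -
          have "B / \<epsilon> < \<rho> m" using M that(1) r1 by (simp add: \<rho>_def)
          then show ?thesis using \<epsilon> \<rho>(2) [of m] by (simp add: field_simps)
        qed
        finally show ?thesis .
      qed
      then show "\<exists>M. \<forall>m\<ge>M. \<forall>N'>m. dist ((uc_deriv ^^ i) (w m) (axis r1)) ((uc_deriv ^^ i) (w N') (axis r1)) < \<epsilon>"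
        by blast
    qed
    then show ?thesis by (simp add: Cauchy_convergent_iff)
  qed
  define c where "c j = lim (\<lambda>N. (deriv ^^ j) (w N) (axis r1))" for j
  have c: "(\<lambda>N. (deriv ^^ j) (w N) (axis r1)) \<longlonglongrightarrow> c j" if "j < n" for j
    unfolding c_def convergent_LIMSEQ_iff [symmetric]
    by (rule derivs_convergent [OF ew(1) conv]) (use that in auto)
  define W where "W s = (\<Sum>j<n. c j * f j s)" for s
  have eW: "entire W" and opW: "op W s = 0" for s
    unfolding W_def by (intro holomorphic_intros ef) (simp add: op_lincomb ef)
  have lim: "(\<lambda>N. (uc_deriv ^^ i) (w N) s) \<longlonglongrightarrow> (uc_deriv ^^ i) W s" for i s
  proof -
    have "(uc_deriv ^^ i) (w N) s = (\<Sum>j<n. (deriv ^^ j) (w N) (axis r1) * (uc_deriv ^^ i) (f j) s)" for N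
      by (subst w_eq [abs_def]) (simp add: uc_derivs_lincomb ef)
    then show ?thesis
      unfolding W_def by (simp add: uc_derivs_lincomb ef) (intro tendsto_intros c, auto)
  qed
  \<comment> \<open>The bound for w N is free of N, so it passes to the limit pointwise, although
    the ray used depends on N.\<close>
  have "amp a i (\<lambda>s. W s - E s) s \<le> 200 * real n * H1 / norm (exp s)"
    if s: "\<bar>Im s - \<phi>\<bar> \<le> 3 * pi / 4" "r0 \<le> norm (exp s)" and i: "i < n" for i s
  proof (rule tendsto_upperbound)
    show "(\<lambda>N. amp a i (\<lambda>s. w N s - E s) s) \<longlonglongrightarrow> amp a i (\<lambda>s. W s - E s) s"
      unfolding amp_def uc_derivs_diff [OF ew(1) entire_E] uc_derivs_diff [OF eW entire_E]
      by (intro tendsto_intros lim)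
    have "filterlim \<rho> at_top sequentially"
      unfolding \<rho>_def by (intro filterlim_tendsto_add_at_top [OF tendsto_const] filterlim_real_sequentially)
    from eventually_compose_filterlim [OF eventually_axis_direction [OF s(1)] this]
    show "\<forall>\<^sub>F N in sequentially. amp a i (\<lambda>s. w N s - E s) s \<le> 200 * real n * H1 / norm (exp s)"
    proof eventually_elim
      case (elim N)
      then obtain d L where dL: "ray_direction s d (4 / 5)" "0 \<le> L" "ray s d L = axis (\<rho> N)"
         "\<forall>k<n. 0 \<le> Re (d * (rate n a k - a))" by blast
      show ?case
        by (rule estimate_E [OF dL(1) w dL(2) _ _ s(2) _ i]) (use dL wE0 in auto)
    qed
  qed simp
  then have "recessive W" unfolding recessive_def by blast
  then show ?thesis using eW opW by (auto simp: euler_solution_op)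
qed

end

section \<open>The recessive solution in the large sector\<close>

text \<open>An angle of at most pi - \<theta> between d and z has cosine at least - cos \<theta>, so
  q = cos \<theta> serves for all z at once.\<close>

lemma ray_direction_cis:
  assumes "\<bar>\<psi> - Im s\<bar> \<le> pi - \<theta>" "0 < \<theta>" "\<theta> < pi / 2"
  shows "ray_direction s (cis \<psi>) (cos \<theta>)"
proof
  have "cos (pi - \<theta>) \<le> cos \<bar>\<psi> - Im s\<bar>"
    using assms by (intro cos_monotone_0_pi_le) auto
  then have "- cos \<theta> \<le> cos (\<psi> - Im s)"
    by simp
  then have "norm (exp s) * - cos \<theta> \<le> norm (exp s) * cos (\<psi> - Im s)"
    by (rule mult_left_mono) simp
  moreover have "Re (cis \<psi> * cnj (exp s)) = norm (exp s) * cos (\<psi> - Im s)"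
    by (simp add: cos_diff Re_exp Im_exp algebra_simps)
  ultimately show "- (cos \<theta> * norm (exp s)) \<le> Re (cis \<psi> * cnj (exp s))"
    by (simp add: mult.commute)
  show "0 \<le> cos \<theta>" using assms by (intro cos_ge_zero) auto
  show "cos \<theta> < 1" using assms cos_monotone_0_pi [of 0 \<theta>] by simp
qed simp

text \<open>With w = i \<psi> - s, taking t out of 1 + t exp w leaves Ln (1/t + exp w), which tends
  to w as |Im w| < pi. So the argument tends to \<psi> itself, not merely modulo 2 pi.\<close>

lemma Im_ray_tendsto:
  assumes "\<bar>\<psi> - Im s\<bar> < pi"
  shows "((\<lambda>t. Im (ray s (cis \<psi>) t)) \<longlongrightarrow> \<psi>) at_top"
proof -
  define w where "w = \<i> * of_real \<psi> - s"
  have u: "cis \<psi> * exp (- s) = exp w"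
    by (simp add: w_def cis_conv_exp exp_diff exp_minus divide_inverse)
  have Imw: "Im w = \<psi> - Im s" by (simp add: w_def)
  have Lnw: "Ln (exp w) = w" using assms Imw by (intro Ln_exp) auto
  have nn: "exp w \<notin> \<real>\<^sub>\<le>\<^sub>0"
  proof
    assume "exp w \<in> \<real>\<^sub>\<le>\<^sub>0"
    then have "\<not> (Im (Ln (exp w)) < pi \<and> 0 < Re (exp w) \<or> Im (exp w) \<noteq> 0)"
      by (auto simp: complex_nonpos_Reals_iff)
    moreover have "Im (Ln (exp w)) = pi"
      using \<open>exp w \<in> \<real>\<^sub>\<le>\<^sub>0\<close> by (simp add: Im_Ln_eq_pi complex_nonpos_Reals_iff complex_neq_0) (metis exp_not_eq_zero complex_eq_iff less_eq_real_def zero_complex.sel)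
    ultimately show False using Lnw Imw assms by simp
  qed
  have "((\<lambda>t. Im (s + (of_real (ln t) + Ln (of_real (inverse t) + exp w)))) \<longlongrightarrow> Im s + Im w) at_top"
  proof -
    have "((\<lambda>t. of_real (inverse t) + exp w) \<longlongrightarrow> of_real 0 + exp w) at_top"
      by (intro tendsto_intros tendsto_inverse_0_at_top filterlim_ident)
    then have "((\<lambda>t. Ln (of_real (inverse t) + exp w)) \<longlongrightarrow> Ln (of_real 0 + exp w)) at_top"
      using nn by (intro tendsto_Ln) simp_all
    then have "((\<lambda>t. Im s + Im (Ln (of_real (inverse t) + exp w))) \<longlongrightarrow> Im s + Im (Ln (of_real 0 + exp w))) at_top"
      by (intro tendsto_add tendsto_const tendsto_Im)
    then show ?thesis by (simp add: Lnw)
  qed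
  moreover have "\<forall>\<^sub>F t in at_top. Im (s + (of_real (ln t) + Ln (of_real (inverse t) + exp w))) = Im (ray s (cis \<psi>) t)"
  proof -
    have "((\<lambda>t. of_real (inverse t) + exp w) \<longlongrightarrow> of_real 0 + exp w) at_top"
      by (intro tendsto_intros tendsto_inverse_0_at_top filterlim_ident)
    then have "\<forall>\<^sub>F t in at_top. of_real (inverse t) + exp w \<noteq> 0"
      using tendsto_imp_eventually_ne by fastforce
    then show ?thesis
      using eventually_gt_at_top [of 0]
    proof eventually_elim
      case (elim t)
      have "1 + of_real t * (cis \<psi> * exp (- s)) = of_real t * (of_real (inverse t) + exp w)"
        unfolding u distrib_left using elim by (simp flip: of_real_mult)
      then have "Ln (1 + of_real t * (cis \<psi> * exp (- s))) = of_real (ln t) + Ln (of_real (inverse t) + exp w)"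
        using elim by (simp add: Ln_times_of_real Ln_of_real)
      then show ?case unfolding ray_def by simp
    qed
  qed
  ultimately have "((\<lambda>t. Im (ray s (cis \<psi>) t)) \<longlongrightarrow> Im s + Im w) at_top"
    by (rule Lim_transform_eventually)
  then show ?thesis by (simp add: Imw)
qed

lemma (in ray_direction) norm_exp_ray_at_top: "filterlim (\<lambda>t. norm (exp (ray s0 d t))) at_top at_top"
proof (rule filterlim_at_top_mono)
  show "filterlim (\<lambda>t. (1 - q) / 2 * t) at_top at_top"
    using q by (intro filterlim_tendsto_pos_mult_at_top [OF tendsto_const _ filterlim_ident]) auto
  show "\<forall>\<^sub>F t in at_top. (1 - q) / 2 * t \<le> norm (exp (ray s0 d t))"
    using eventually_ge_at_top [of 0]
  proof eventually_elim
    case (elim t)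
    have "(1 - q) / 2 * t \<le> (1 - q) / 2 * (norm (exp s0) + t)"
      using q by (intro mult_left_mono) auto
    also have "\<dots> \<le> norm (exp (ray s0 d t))"
      unfolding exp_ray [OF elim] by (rule norm_point [OF elim])
    finally show ?case .
  qed
qed

lemma poly_derivs_coeff_0: "coeff q 0 = 0 \<Longrightarrow> coeff ((poly_deriv a b ^^ j) q) 0 = 0"
  by (induction j) (auto simp: coeff_poly_deriv)

context euler_ode
begin

lemma amp_E_poly: "amp a j (\<lambda>s. E s * poly q (exp (- s))) s = norm (poly ((poly_deriv a 0 ^^ j) q) (exp (- s)))"
proof -
  have "(uc_deriv ^^ j) (\<lambda>s. E s * poly q (exp (- s))) s = E s * poly ((poly_deriv a 0 ^^ j) q) (exp (- s))"
    using uc_derivs_expansion [of j a 0 q] by (simp add: E_def fun_eq_iff)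
  then have "exp (- (a * exp s)) * (uc_deriv ^^ j) (\<lambda>s. E s * poly q (exp (- s))) s = poly ((poly_deriv a 0 ^^ j) q) (exp (- s))"
    using inverse_E [of s] by (simp add: mult.assoc [symmetric])
  then show ?thesis by (simp add: amp_def)
qed

lemma entire_E_poly: "entire (\<lambda>s. E s * poly q (exp (- s)))"
  by (intro holomorphic_intros)

text \<open>Relative to exp (a z), both W and the truncation tend to 1 at the end of the ray, with
  matching derivatives. Their difference therefore meets the limit hypothesis, and only the residual
  of the truncation remains.\<close>

lemma recessive_estimate:
  assumes W: "euler_solution n a g W" "recessive W" and p: "coeff p 0 = 1"
    and \<beta>: "\<bar>\<beta>\<bar> \<le> pi / real n" "\<bar>\<phi> + \<beta> - Im s\<bar> \<le> pi - \<theta>" and \<theta>: "0 < \<theta>" "\<theta> < pi / 2"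
    and large: "large ((1 - cos \<theta>) / 2) s" "C\<^sup>2 \<le> (1 - cos \<theta>) / 2 * norm (exp s)" and M: "M > 0" and H: "0 \<le> H"
    and res: "\<And>t. C\<^sup>2 \<le> norm (exp t) \<Longrightarrow>
       norm (exp (- (a * exp t)) * op (\<lambda>s. E s * poly p (exp (- s))) t) \<le> H / norm (exp t) ^ (M + 1)"
    and i: "i < n"
  shows "amp a i (\<lambda>s. W s - E s * poly p (exp (- s))) s \<le> 2 * real n * (H / ((1 - cos \<theta>) / 2) ^ (M + 1)) / norm (exp s) ^ M"
proof -
  interpret ray_direction s "cis (\<phi> + \<beta>)" "cos \<theta>"
    by (rule ray_direction_cis [OF \<beta>(2) \<theta>])
  let ?ray = "ray s (cis (\<phi> + \<beta>))"
  have eW: "entire W" "\<And>s. op W s = 0" using W by (auto simp: euler_solution_op)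
  have eD: "entire (\<lambda>s. W s - E s * poly p (exp (- s)))"
    by (intro holomorphic_on_diff eW entire_E_poly)
  show ?thesis
  proof (rule estimate_limit [OF ray_direction_axioms eD M H _ large(1) _ _ i])
    show "0 \<le> Re (cis (\<phi> + \<beta>) * (rate n a k - a))" if "k < n" for k
      by (rule direction_dominates [OF \<beta>(1) that])
    fix t :: real assume t: "0 \<le> t"
    have "C\<^sup>2 \<le> (1 - cos \<theta>) / 2 * (norm (exp s) + t)"
      by (rule order_trans [OF large(2) mult_left_mono]) (use q t in auto)
    also have "\<dots> \<le> norm (exp (?ray t))"
      unfolding exp_ray [OF t] by (rule norm_point [OF t])
    finally show "norm (exp (- (a * exp (?ray t))) * op (\<lambda>s. W s - E s * poly p (exp (- s))) (?ray t)) \<le> H / norm (exp (?ray t)) ^ (M + 1)"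
      using res [of "?ray t"] unfolding op_diff [OF eW(1) entire_E_poly] eW(2) by simp
  next
    fix j assume j: "j < n"
    have inf: "filterlim (\<lambda>t. norm (exp (?ray t))) at_top at_top"
      by (rule norm_exp_ray_at_top)
    obtain K R where KR: "\<And>s i. \<bar>Im s - \<phi>\<bar> \<le> 3 * pi / 4 \<Longrightarrow> R \<le> norm (exp s) \<Longrightarrow> i < n \<Longrightarrow>
        amp a i (\<lambda>s. W s - E s) s \<le> K / norm (exp s)"
      using W(2) unfolding recessive_def by metis
    have lim0: "((\<lambda>t. x / norm (exp (?ray t))) \<longlongrightarrow> 0) at_top" for x :: real
      by (rule real_tendsto_divide_at_top [OF tendsto_const inf])
    have "((\<lambda>t. Im (?ray t)) \<longlongrightarrow> \<phi> + \<beta>) at_top"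
      using \<beta> \<theta> by (intro Im_ray_tendsto) auto
    then have "((\<lambda>t. \<bar>Im (?ray t) - \<phi>\<bar>) \<longlongrightarrow> \<bar>\<phi> + \<beta> - \<phi>\<bar>) at_top"
      by (intro tendsto_intros)
    moreover have "pi / real n \<le> pi / 2"
      using n2 by (intro divide_left_mono) auto
    then have "\<bar>\<beta>\<bar> < 3 * pi / 4" using \<beta>(1) pi_gt_zero by linarith
    then have "\<bar>\<phi> + \<beta> - \<phi>\<bar> < 3 * pi / 4" by simp
    ultimately have "\<forall>\<^sub>F t in at_top. \<bar>Im (?ray t) - \<phi>\<bar> < 3 * pi / 4"
      by (rule order_tendstoD(2))
    moreover have "\<forall>\<^sub>F t in at_top. R \<le> norm (exp (?ray t))"
      using inf by (simp add: filterlim_at_top)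
    ultimately have ev: "\<forall>\<^sub>F t in at_top. norm (amp a j (\<lambda>s. W s - E s) (?ray t)) \<le> K / norm (exp (?ray t))"
    proof eventually_elim
      case (elim t)
      have "amp a j (\<lambda>s. W s - E s) (?ray t) \<le> K / norm (exp (?ray t))"
        by (rule KR [OF less_imp_le [OF elim(1)] elim(2) j])
      then show ?case by (simp only: real_norm_def abs_of_nonneg [OF amp_nonneg])
    qed
    have 1: "((\<lambda>t. amp a j (\<lambda>s. W s - E s) (?ray t)) \<longlongrightarrow> 0) at_top"
      by (rule Lim_null_comparison [OF ev lim0])
    \<comment> \<open>Without its constant term 1 the truncation, with all its derivatives, is
      negligible against exp (a z).\<close>
    define q where "q = p - 1"
    have q0: "coeff ((poly_deriv a 0 ^^ j) q) 0 = 0"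
      by (rule poly_derivs_coeff_0) (simp add: q_def p)
    have "((\<lambda>t. 1 / norm (exp (?ray t))) \<longlongrightarrow> 0) at_top" by (rule lim0)
    moreover have "1 / norm (exp z) = norm (exp (- z))" for z :: complex
      by (simp add: exp_minus [of "Re z"] divide_inverse)
    ultimately have "((\<lambda>t. norm (exp (- ?ray t))) \<longlongrightarrow> 0) at_top" by (simp only:)
    then have X0: "((\<lambda>t. exp (- ?ray t)) \<longlongrightarrow> 0) at_top"
      by (rule tendsto_norm_zero_cancel)
    have "((\<lambda>t. norm (poly ((poly_deriv a 0 ^^ j) q) (exp (- ?ray t)))) \<longlongrightarrow> norm (poly ((poly_deriv a 0 ^^ j) q) 0)) at_top"
      by (intro tendsto_intros X0)
    then have 2: "((\<lambda>t. amp a j (\<lambda>s. E s * poly q (exp (- s))) (?ray t)) \<longlongrightarrow> 0) at_top"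
      by (simp add: amp_E_poly poly_0_coeff_0 q0)
    have eq: "(\<lambda>s. W s - E s * poly p (exp (- s))) = (\<lambda>s. (W s - E s) - E s * poly q (exp (- s)))"
      by (simp add: q_def algebra_simps)
    have le: "norm (amp a j (\<lambda>s. W s - E s * poly p (exp (- s))) u)
        \<le> amp a j (\<lambda>s. W s - E s) u + amp a j (\<lambda>s. E s * poly q (exp (- s))) u" for u
      unfolding eq real_norm_def abs_of_nonneg [OF amp_nonneg]
      by (rule amp_diff_le [OF holomorphic_on_diff [OF eW(1) entire_E] entire_E_poly])
    show "((\<lambda>t. amp a j (\<lambda>s. W s - E s * poly p (exp (- s))) (?ray t)) \<longlongrightarrow> 0) at_top"
    proof (rule Lim_null_comparison [OF always_eventually])
      show "((\<lambda>t. amp a j (\<lambda>s. W s - E s) (?ray t) + amp a j (\<lambda>s. E s * poly q (exp (- s))) (?ray t)) \<longlongrightarrow> 0) at_top"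
        using tendsto_add [OF 1 2] by (simp only: add_0_left)
    qed (use le in blast)
  qed
qed

text \<open>The equation, solved for the n-th derivative, is differentiated j times. The
  coefficients z^(l-n) are treated by Leibniz's rule with b = -(n - l), and the powers of 1/z that
  it adds are bounded by 1.\<close>

lemma amp_recurrence:
  assumes R: "entire R" and s: "C \<le> norm (exp s)"
  shows "amp a (j + n) R s \<le> real n ^ n * amp a j R s
    + (\<Sum>l<n - 1. G * (\<Sum>i\<le>j. norm (leibniz_coeff (- of_nat (n - l)) j i) * amp a (i + l) R s))
    + amp a j (op R) s"
proof -
  define e where "e = exp (- (a * exp s))"
  have X1: "norm (exp (- s)) \<le> 1" 
  proof -
    have "1 \<le> norm (exp s)" using C s by linarith
    then show ?thesis by simp
  qed
  have X: "exp (- s) ^ k = exp (- of_nat k * s)" for k and s :: complex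
    by (simp add: exp_of_nat_mult [symmetric])
  have eT: "entire (\<lambda>s. exp (- of_nat (n - l) * s) * (uc_deriv ^^ l) R s)" for l
    by (intro holomorphic_intros R)
  have eop: "entire (op R)"
    unfolding op_def [abs_def] by (intro holomorphic_intros R)
  have "(uc_deriv ^^ n) R = (\<lambda>s. (a ^ n * R s - (\<Sum>l<n - 1. g l * (exp (- of_nat (n - l) * s) * (uc_deriv ^^ l) R s))) + op R s)"
    by (simp add: op_main X fun_eq_iff mult.assoc)
  then have "(uc_deriv ^^ (j + n)) R = (\<lambda>s. (a ^ n * (uc_deriv ^^ j) R s -
      (\<Sum>l<n - 1. g l * (uc_deriv ^^ j) (\<lambda>s. exp (- of_nat (n - l) * s) * (uc_deriv ^^ l) R s) s)) + (uc_deriv ^^ j) (op R) s)"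
    unfolding funpow_add o_apply
    by (simp only: uc_derivs_add uc_derivs_diff uc_derivs_cmult uc_derivs_lincomb eT R eop finite_lessThan
        holomorphic_on_sum holomorphic_on_mult holomorphic_on_const holomorphic_on_diff)
  then have "amp a (j + n) R s = norm (e * (a ^ n * (uc_deriv ^^ j) R s) -
      e * (\<Sum>l<n - 1. g l * (uc_deriv ^^ j) (\<lambda>s. exp (- of_nat (n - l) * s) * (uc_deriv ^^ l) R s) s) + e * (uc_deriv ^^ j) (op R) s)"
    by (simp only: amp_def e_def distrib_left right_diff_distrib)
  also have "\<dots> \<le> norm (e * (a ^ n * (uc_deriv ^^ j) R s)) +
      norm (e * (\<Sum>l<n - 1. g l * (uc_deriv ^^ j) (\<lambda>s. exp (- of_nat (n - l) * s) * (uc_deriv ^^ l) R s) s)) + norm (e * (uc_deriv ^^ j) (op R) s)"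
    by (intro order_trans [OF norm_triangle_ineq] add_right_mono norm_triangle_ineq4)
  also have "norm (e * (a ^ n * (uc_deriv ^^ j) R s)) = real n ^ n * amp a j R s"
    by (simp add: amp_def e_def norm_mult norm_power a)
  also have "norm (e * (uc_deriv ^^ j) (op R) s) = amp a j (op R) s"
    by (simp add: amp_def e_def)
  also have "norm (e * (\<Sum>l<n - 1. g l * (uc_deriv ^^ j) (\<lambda>s. exp (- of_nat (n - l) * s) * (uc_deriv ^^ l) R s) s))
     \<le> (\<Sum>l<n - 1. G * (\<Sum>i\<le>j. norm (leibniz_coeff (- of_nat (n - l)) j i) * amp a (i + l) R s))"
    unfolding sum_distrib_left [of e]
  proof (rule sum_norm_le)
    fix l assume l: "l \<in> {..<n - 1}"
    let ?S = "\<Sum>i\<le>j. leibniz_coeff (- of_nat (n - l)) j i * exp (- s) ^ (j - i) * (e * (uc_deriv ^^ (i + l)) R s)"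
    have "e * (g l * (uc_deriv ^^ j) (\<lambda>s. exp (- of_nat (n - l) * s) * (uc_deriv ^^ l) R s) s)
       = (g l * exp (- s) ^ (n - l)) * ?S"
    proof -
      have "(uc_deriv ^^ j) (\<lambda>s. exp (- of_nat (n - l) * s) * (uc_deriv ^^ l) R s) s = exp (- s) ^ (n - l) *
          (\<Sum>i\<le>j. leibniz_coeff (- of_nat (n - l)) j i * exp (- s) ^ (j - i) * (uc_deriv ^^ (i + l)) R s)"
        using uc_derivs_exp_mult [OF entire_uc_derivs [OF R], of j "- of_nat (n - l)" l s]
        by (simp only: X funpow_add o_apply)
      then show ?thesis
        by (simp only: sum_distrib_left mult_ac)
    qed
    also have "norm \<dots> \<le> G * (\<Sum>i\<le>j. norm (leibniz_coeff (- of_nat (n - l)) j i) * amp a (i + l) R s)"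
      unfolding norm_mult [of _ ?S]
    proof (rule mult_mono)
      have "norm (g l * exp (- s) ^ (n - l)) \<le> G * C\<^sup>2 / norm (exp s) ^ 2"
        using l s by (intro coeff_le) auto
      also have "\<dots> \<le> G * norm (exp s) ^ 2 / norm (exp s) ^ 2"
        using s C G by (intro divide_right_mono mult_left_mono power_mono) auto
      also have "\<dots> = G" by simp
      finally show "norm (g l * exp (- s) ^ (n - l)) \<le> G" .
      show "norm ?S \<le> (\<Sum>i\<le>j. norm (leibniz_coeff (- of_nat (n - l)) j i) * amp a (i + l) R s)"
      proof (rule sum_norm_le)
        fix i
        have "norm (exp (- s)) ^ (j - i) \<le> 1" using X1 by (intro power_le_one) auto
        then have "norm (leibniz_coeff (- of_nat (n - l)) j i) * norm (exp (- s)) ^ (j - i) * amp a (i + l) R s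
          \<le> norm (leibniz_coeff (- of_nat (n - l)) j i) * 1 * amp a (i + l) R s"
          by (intro mult_right_mono mult_left_mono) auto
        then show "norm (leibniz_coeff (- of_nat (n - l)) j i * exp (- s) ^ (j - i) * (e * (uc_deriv ^^ (i + l)) R s))
           \<le> norm (leibniz_coeff (- of_nat (n - l)) j i) * amp a (i + l) R s"
          by (simp only: amp_def e_def [symmetric] norm_mult [of _ "e * _"] norm_mult [of _ "exp (- s) ^ _"] norm_power mult_1_right)
      qed
    qed (use G in auto)
    finally show "norm (e * (g l * (uc_deriv ^^ j) (\<lambda>s. exp (- of_nat (n - l) * s) * (uc_deriv ^^ l) R s) s))
       \<le> G * (\<Sum>i\<le>j. norm (leibniz_coeff (- of_nat (n - l)) j i) * amp a (i + l) R s)" .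
  qed
  finally show ?thesis by simp
qed

end

text \<open>The ray estimates stop at order n - 1; from there the differentiated equation is a
  recursion. K is chosen before the equation and the function, given n, G and j.\<close>

lemma amp_higher:
  assumes n2: "2 \<le> n" and G: "0 \<le> G"
  shows "\<exists>K\<ge>0. \<forall>a g C \<phi> R s A. euler_ode n a g G C \<phi> \<longrightarrow> entire R \<longrightarrow> C \<le> norm (exp s) \<longrightarrow>
    (\<forall>i<n. amp a i R s \<le> A) \<longrightarrow> (\<forall>i\<le>j. amp a i (euler_ode.op n a g R) s \<le> A) \<longrightarrow> amp a j R s \<le> K * A"
proof (induction j rule: less_induct)
  case (less j)
  show ?case
  proof (cases "j < n")
    case True
    then show ?thesis by (intro exI [of _ 1]) auto
  next
    case False
    define k where "k = j - n"
    have j: "j = k + n" using False by (simp add: k_def)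
    obtain B where B: "\<And>i. i < j \<Longrightarrow> B i \<ge> 0"
      "\<And>i a g C \<phi> R s A. i < j \<Longrightarrow> euler_ode n a g G C \<phi> \<Longrightarrow> entire R \<Longrightarrow> C \<le> norm (exp s) \<Longrightarrow>
        (\<forall>i<n. amp a i R s \<le> A) \<Longrightarrow> (\<forall>i'\<le>i. amp a i' (euler_ode.op n a g R) s \<le> A) \<Longrightarrow> amp a i R s \<le> B i * A"
      using less.IH by metis
    define K where "K = real n ^ n * B k + (\<Sum>l<n - 1. G * (\<Sum>i\<le>k. norm (leibniz_coeff (- of_nat (n - l)) k i) * B (i + l))) + 1"
    have lt: "k < j" "\<And>i l. i \<le> k \<Longrightarrow> l < n - 1 \<Longrightarrow> i + l < j" using j n2 by auto
    have "K \<ge> 0"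
      unfolding K_def using B(1) lt G by (intro add_nonneg_nonneg mult_nonneg_nonneg sum_nonneg) auto
    moreover have "amp a j R s \<le> K * A"
      if *: "euler_ode n a g G C \<phi>" "entire R" "C \<le> norm (exp s)" "\<forall>i<n. amp a i R s \<le> A"
        "\<forall>i\<le>j. amp a i (euler_ode.op n a g R) s \<le> A" for a g C \<phi> R s A
    proof -
      have B': "amp a i R s \<le> B i * A" if "i < j" for i
        using B(2) [OF that *(1-4)] *(5) that by simp
      have "amp a j R s \<le> real n ^ n * amp a k R s
        + (\<Sum>l<n - 1. G * (\<Sum>i\<le>k. norm (leibniz_coeff (- of_nat (n - l)) k i) * amp a (i + l) R s))
        + amp a k (euler_ode.op n a g R) s"
        unfolding j by (rule euler_ode.amp_recurrence [OF *(1-3)])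
      also have "\<dots> \<le> real n ^ n * (B k * A)
        + (\<Sum>l<n - 1. G * (\<Sum>i\<le>k. norm (leibniz_coeff (- of_nat (n - l)) k i) * (B (i + l) * A))) + A"
        using *(5) lt G by (intro add_mono mult_left_mono sum_mono B') auto
      also have "\<dots> = K * A"
        by (simp add: K_def sum_distrib_left distrib_left distrib_right mult_ac)
      finally show ?thesis .
    qed
    ultimately show ?thesis by blast
  qed
qed

section \<open>Uniform expansions\<close>

lemma euler_ode_bessel:
  assumes "2 \<le> n" "norm a = real n" "(\<Sum>l<n. lam l) = 0" "a * cis \<phi> = - of_nat n"
    and "0 \<le> G" "\<And>lam j. j \<le> n \<Longrightarrow> norm (euler_coeff n lam j) \<le> G * index_size n lam ^ (n - j)"
  shows "euler_ode n a (euler_coeff n lam) G (index_size n lam) \<phi>"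
  using assms euler_coeff_top euler_coeff_pred [of n lam] index_size_ge_1 [of n lam]
  by unfold_locales auto

text \<open>Fixes the order of quantifiers: c and K come before the root, the index and the
  solution.\<close>

definition uniform_expansion :: "nat \<Rightarrow> real \<Rightarrow> real \<Rightarrow> nat \<Rightarrow> nat \<Rightarrow> real \<Rightarrow> bool" where
  "uniform_expansion n \<theta> c M j K \<longleftrightarrow> (\<forall>a lam \<phi> W s.
    norm a = real n \<longrightarrow> (\<Sum>l<n. lam l) = 0 \<longrightarrow> a * cis \<phi> = - of_nat n \<longrightarrow>
    euler_solution n a (euler_coeff n lam) W \<longrightarrow> euler_ode.recessive n a \<phi> W \<longrightarrow>
    \<bar>Im s - \<phi>\<bar> < pi + pi / real n - \<theta> \<longrightarrow> c * index_size n lam ^ 2 < norm (exp s) \<longrightarrow>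
    (\<exists>e. norm e \<le> K * (index_size n lam ^ (2 * M) / norm (exp s) ^ M) \<and>
       (uc_deriv ^^ j) (\<lambda>s. exp (bessel_expo n * s) * W s) s = exp (a * exp s) * exp (bessel_expo n * s) *
         ((\<Sum>m<M. fps_nth ((formal_deriv a (bessel_expo n) ^^ j) (Abs_fps (bcoef n a lam))) m / exp s ^ m) + e)))"

text \<open>One c serves all M and j, because it only expresses the smallness required along
  rays.\<close>

lemma solution_expansion:
  assumes n2: "2 \<le> n" and \<theta>: "0 < \<theta>" "\<theta> < pi / 2"
  shows "\<exists>c>0. \<forall>M>0. \<forall>j. \<exists>K. uniform_expansion n \<theta> c M j K"
proof -
  have n0: "n > 0" using n2 by simp
  obtain G where G: "0 \<le> G" "\<And>lam j. j \<le> n \<Longrightarrow> norm (euler_coeff n lam j) \<le> G * index_size n lam ^ (n - j)"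
    using euler_coeff_bounded [OF n0] by blast
  define \<kappa> where "\<kappa> = (1 - cos \<theta>) / 2"
  have \<kappa>: "0 < \<kappa>" "\<kappa> \<le> 1"
  proof -
    have "cos \<theta> < cos 0" using \<theta> by (intro cos_monotone_0_pi) auto
    then show "0 < \<kappa>" by (simp add: \<kappa>_def)
    have "(1 - cos \<theta>) / 2 \<le> (1 - (- 1)) / 2"
      by (intro divide_right_mono diff_left_mono cos_ge_minus_one) simp
    then show "\<kappa> \<le> 1" by (simp add: \<kappa>_def)
  qed
  have \<kappa>2: "\<kappa>\<^sup>2 \<le> \<kappa>" using \<kappa> by (simp add: power2_eq_square mult_le_cancel_left1)
  \<comment> \<open>Secures 2 n^2 G C^2 <= \<kappa>^2 |z| and C^2 <= \<kappa>^2 |z|; as \<kappa> <=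
    1, the latter keeps the ray where its points have modulus at least C^2.\<close>
  define c where "c = (2 * real n ^ 2 * G + 1) / \<kappa>\<^sup>2"
  let ?b = "bessel_expo n"
  have c0: "c > 0" using G \<kappa> by (auto simp: c_def intro!: divide_pos_pos add_nonneg_pos)
  have "\<exists>K. uniform_expansion n \<theta> c M j K"
    if M: "M > 0" for M j
  proof -
    obtain KR where KR: "0 \<le> KR" "\<And>a lam. norm a = real n \<Longrightarrow> (\<Sum>l<n. lam l) = 0 \<Longrightarrow>
       graded_bound 2 (Suc M) (M + n) KR (index_size n lam) (bessel_poly_op n a lam (truncation M (bcoef n a lam)))"
      using residual_bounded [OF n0, of M] by blast
    obtain KD where KD: "\<And>i. 0 \<le> KD i" "\<And>i a p C. norm a = real n \<Longrightarrow> 1 \<le> C \<Longrightarrow> graded_bound 2 (Suc M) (M + n) KR C p \<Longrightarrow>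
       graded_bound 2 (Suc M) (M + n + i) (KD i) C ((poly_deriv a 0 ^^ i) p)"
      using graded_bound_derivs [OF KR(1), of "real n" 2 "Suc M" "M + n" _ 0] by metis
    obtain KT0 where KT0: "0 \<le> KT0" "\<And>a lam. norm a = real n \<Longrightarrow> graded_bound 0 0 M KT0 (index_size n lam) (truncation M (bcoef n a lam))"
      using truncation_bounded [OF n0, of M] by blast
    obtain KT where KT: "0 \<le> KT" "\<And>a p C. norm a = real n \<Longrightarrow> 1 \<le> C \<Longrightarrow> graded_bound 0 0 M KT0 C p \<Longrightarrow>
       graded_bound 0 0 (M + j) KT C ((poly_deriv a ?b ^^ j) p)"
      using graded_bound_derivs [OF KT0(1), of "real n" 0 0 M j ?b] by metis
    obtain KA where KA: "\<And>i. 0 \<le> KA i" "\<And>i a g C \<phi> R s A. euler_ode n a g G C \<phi> \<Longrightarrow> entire R \<Longrightarrow> C \<le> norm (exp s) \<Longrightarrow>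
       (\<forall>i<n. amp a i R s \<le> A) \<Longrightarrow> (\<forall>i'\<le>i. amp a i' (euler_ode.op n a g R) s \<le> A) \<Longrightarrow> amp a i R s \<le> KA i * A"
      using amp_higher [OF n2 G(1)] by metis
    \<comment> \<open>K1 bounds the remainder up to order n - 1, K2 the derivatives of its residual.
      K then adds the Leibniz factors for z^b and the degrees from M on in the differentiated
      truncation.\<close>
    define K1 where "K1 = 2 * real n * (real (Suc (M + n)) * KR / \<kappa> ^ (M + 1))"
    define K2 where "K2 = (\<Sum>i\<le>j. real (Suc (M + n + i)) * KD i)"
    have K12: "0 \<le> K1" "0 \<le> K2" using KR KD \<kappa> by (auto simp: K1_def K2_def intro!: sum_nonneg)
    define K where "K = (\<Sum>i\<le>j. norm (leibniz_coeff ?b j i) * (KA i * (K1 + K2))) + real (Suc (M + j)) * KT"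
    have "\<exists>e. norm e \<le> K * (index_size n lam ^ (2 * M) / norm (exp s) ^ M) \<and>
       (uc_deriv ^^ j) (\<lambda>s. exp (?b * s) * W s) s = exp (a * exp s) * exp (?b * s) *
         ((\<Sum>m<M. fps_nth ((formal_deriv a ?b ^^ j) (Abs_fps (bcoef n a lam))) m / exp s ^ m) + e)"
      if a: "norm a = real n" and lam: "(\<Sum>l<n. lam l) = 0" and \<phi>: "a * cis \<phi> = - of_nat n"
        and W: "euler_solution n a (euler_coeff n lam) W" "euler_ode.recessive n a \<phi> W"
        and s: "\<bar>Im s - \<phi>\<bar> < pi + pi / real n - \<theta>" "c * index_size n lam ^ 2 < norm (exp s)"
      for a lam \<phi> W s
    proof -
      define C where "C = index_size n lam"
      define z where "z = norm (exp s)"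
      interpret euler_ode n a "euler_coeff n lam" G C \<phi>
        unfolding C_def by (rule euler_ode_bessel [OF n2 a lam \<phi> G])
      have CC: "C \<le> C\<^sup>2" "1 \<le> C\<^sup>2" using C by (auto simp: power2_eq_square intro: order_trans mult_mono [of 1 C 1 C, simplified])
      have z0: "0 < z" by (simp add: z_def)
      have cz: "(2 * real n ^ 2 * G + 1) * C\<^sup>2 \<le> \<kappa>\<^sup>2 * z"
        using s(2) \<kappa> by (simp add: c_def C_def z_def field_simps)
      have n2G: "0 \<le> 2 * real n ^ 2 * (G * C\<^sup>2)" using G by simp
      have cz1: "C\<^sup>2 \<le> \<kappa>\<^sup>2 * z" "2 * real n ^ 2 * (G * C\<^sup>2) \<le> \<kappa>\<^sup>2 * z"
      proof -
        have "(2 * real n ^ 2 * G + 1) * C\<^sup>2 = 2 * real n ^ 2 * (G * C\<^sup>2) + C\<^sup>2" by (simp add: algebra_simps)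
        then show "C\<^sup>2 \<le> \<kappa>\<^sup>2 * z" "2 * real n ^ 2 * (G * C\<^sup>2) \<le> \<kappa>\<^sup>2 * z"
          using cz n2G CC by linarith+
      qed
      have cz2: "C\<^sup>2 \<le> \<kappa> * z"
        using order_trans [OF cz1(1) mult_right_mono [OF \<kappa>2]] z0 by simp
      have cz3: "C\<^sup>2 \<le> z"
        using order_trans [OF cz2 mult_right_mono [OF \<kappa>(2)]] z0 by simp
      have large: "large \<kappa> s"
        using cz1 cz2 CC by (simp add: large_def z_def)
      have normX: "norm (exp (- t)) = 1 / norm (exp t)" for t :: complex
        by (simp add: exp_minus [of "Re t"] divide_inverse)
      define p where "p = truncation M (bcoef n a lam)"
      define r where "r = bessel_poly_op n a lam p"
      have p0: "coeff p 0 = 1" using M by (simp add: p_def coeff_truncation)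
      have opF: "op (\<lambda>s. E s * poly p (exp (- s))) t = E t * poly r (exp (- t))" for t
        unfolding op_def E_def r_def by (rule euler_operator_expansion)
      have r: "graded_bound 2 (Suc M) (M + n) KR C r"
        unfolding r_def p_def C_def by (rule KR(2) [OF a lam])
      define H where "H = real (Suc (M + n)) * KR * C ^ (2 * M)"
      have H0: "0 \<le> H" using KR C by (simp add: H_def)
      have res: "norm (exp (- (a * exp t)) * op (\<lambda>s. E s * poly p (exp (- s))) t) \<le> H / norm (exp t) ^ (M + 1)"
        if t: "C\<^sup>2 \<le> norm (exp t)" for t
      proof -
        have "0 < norm (exp t)" by simp
        then have "C\<^sup>2 * norm (exp (- t)) \<le> 1"
          unfolding normX using t by (simp only: times_divide_eq_right mult_1_right divide_le_eq_1_pos)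
        from graded_bound_eval [OF r C this]
        have "norm (poly r (exp (- t))) \<le> H / norm (exp t) ^ (M + 1)"
          unfolding normX by (simp add: H_def power_divide del: norm_exp_eq_Re of_nat_Suc of_nat_add)
        moreover have "exp (- (a * exp t)) * op (\<lambda>s. E s * poly p (exp (- s))) t = poly r (exp (- t))"
          unfolding opF using inverse_E [of t] by (simp only: mult.assoc [symmetric] mult_1_left)
        ultimately show ?thesis by simp
      qed
      \<comment> \<open>Im s - \<phi> clipped to [-pi/n, pi/n]; what is cut off is at most pi -
        \<theta>, just the room that the sector leaves.\<close>
      define \<beta> where "\<beta> = max (- (pi / real n)) (min (pi / real n) (Im s - \<phi>))"
      have pin: "0 < pi / real n" using n0 by simp
      have \<beta>: "\<bar>\<beta>\<bar> \<le> pi / real n" "\<bar>\<phi> + \<beta> - Im s\<bar> \<le> pi - \<theta>"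
        using s(1) \<theta> pin by (auto simp: \<beta>_def max_def min_def abs_if split: if_splits)
      define R where "R s = W s - E s * poly p (exp (- s))" for s
      have eW: "entire W" "\<And>s. op W s = 0" using W by (auto simp: euler_solution_op)
      have eR: "entire R" unfolding R_def [abs_def] by (intro holomorphic_on_diff eW entire_E_poly)
      define Q where "Q = C ^ (2 * M) / z ^ M"
      have Q0: "0 \<le> Q" using C z0 by (simp add: Q_def)
      have ampR: "amp a i R s \<le> (K1 + K2) * Q" if i: "i < n" for i
      proof -
        have "amp a i R s \<le> 2 * real n * (H / \<kappa> ^ (M + 1)) / norm (exp s) ^ M"
          unfolding R_def [abs_def] \<kappa>_def
          by (rule recessive_estimate [OF W p0 \<beta> \<theta> _ _ M H0 res i]) (use large cz2 in \<open>auto simp: \<kappa>_def z_def\<close>)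
        also have "\<dots> = K1 * Q"
          by (simp add: K1_def H_def Q_def z_def)
        also have "\<dots> \<le> (K1 + K2) * Q"
          using K12 Q0 by (intro mult_right_mono) auto
        finally show ?thesis .
      qed
      have opR: "op R = (\<lambda>t. (-1) * (E t * poly r (exp (- t))))"
        unfolding R_def [abs_def] by (rule ext) (simp add: op_diff [OF eW(1) entire_E_poly] eW(2) opF)
      have CX: "C\<^sup>2 * norm (exp (- s)) \<le> 1"
        unfolding normX using cz3 z0 by (simp add: z_def)
      have zM: "1 / z ^ (M + 1) \<le> 1 / z ^ M"
        using cz3 CC z0 by (intro divide_left_mono power_increasing mult_pos_pos) auto
      have ampop: "amp a i (op R) s \<le> (K1 + K2) * Q" if i: "i \<le> j" for i
      proof -
        have "amp a i (op R) s = amp a i (\<lambda>t. E t * poly r (exp (- t))) s"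
          unfolding opR amp_def uc_derivs_cmult [OF entire_E_poly] by simp
        also have "\<dots> = norm (poly ((poly_deriv a 0 ^^ i) r) (exp (- s)))"
          by (rule amp_E_poly)
        also have "\<dots> \<le> real (Suc (M + n + i)) * KD i * (C ^ (2 * Suc M - 2) * norm (exp (- s)) ^ Suc M)"
          by (rule graded_bound_eval [OF KD(2) [OF a C r] C CX]) simp
        also have "\<dots> = real (Suc (M + n + i)) * KD i * (C ^ (2 * M) * (1 / z ^ (M + 1)))"
          unfolding normX z_def by (simp add: power_divide)
        also have "\<dots> \<le> real (Suc (M + n + i)) * KD i * (C ^ (2 * M) * (1 / z ^ M))"
          using KD C by (intro mult_left_mono zM) auto
        also have "\<dots> = real (Suc (M + n + i)) * KD i * Q" by (simp add: Q_def)
        also have "\<dots> \<le> K2 * Q"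
          unfolding K2_def using i KD(1) by (intro mult_right_mono Q0 member_le_sum [of i "{..j}" "\<lambda>i. real (Suc (M + n + i)) * KD i"]) auto
        also have "\<dots> \<le> (K1 + K2) * Q"
          using K12 Q0 by (intro mult_right_mono) auto
        finally show ?thesis .
      qed
      have amp_all: "amp a i R s \<le> KA i * ((K1 + K2) * Q)" if "i \<le> j" for i
      proof (rule KA(2) [OF euler_ode_axioms eR])
        show "C \<le> norm (exp s)" using cz3 CC by (simp add: z_def)
      qed (use ampR ampop that in auto)
      define e1 where "e1 = exp (- (a * exp s)) * (\<Sum>i\<le>j. leibniz_coeff ?b j i * exp (- s) ^ (j - i) * (uc_deriv ^^ i) R s)"
      define Bd where "Bd = fps_nth ((formal_deriv a ?b ^^ j) (Abs_fps (bcoef n a lam)))"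
      \<comment> \<open>Truncation and formal differentiation agree below degree M; q is the
        discrepancy, in degrees M to M + j.\<close>
      define q where "q = (poly_deriv a ?b ^^ j) p - truncation M Bd"
      have "1 \<le> z" using cz3 CC by simp
      then have X1: "norm (exp (- s)) \<le> 1" unfolding normX z_def by simp
      have e1: "norm e1 \<le> (\<Sum>i\<le>j. norm (leibniz_coeff ?b j i) * (KA i * (K1 + K2))) * Q"
        unfolding e1_def sum_distrib_left sum_distrib_right
      proof (rule sum_norm_le)
        fix i assume i: "i \<in> {..j}"
        have "norm (exp (- (a * exp s)) * (leibniz_coeff ?b j i * exp (- s) ^ (j - i) * (uc_deriv ^^ i) R s))
           = norm (leibniz_coeff ?b j i) * norm (exp (- s)) ^ (j - i) * amp a i R s"
          by (simp only: amp_def norm_mult norm_power mult_ac)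
        also have "\<dots> \<le> norm (leibniz_coeff ?b j i) * 1 * (KA i * ((K1 + K2) * Q))"
          using X1 i amp_all by (intro mult_mono mult_left_mono power_le_one) auto
        finally show "norm (exp (- (a * exp s)) * (leibniz_coeff ?b j i * exp (- s) ^ (j - i) * (uc_deriv ^^ i) R s))
          \<le> norm (leibniz_coeff ?b j i) * (KA i * (K1 + K2)) * Q"
          by (simp only: mult_1_right mult.assoc)
      qed
      have pj: "graded_bound 0 0 (M + j) KT C ((poly_deriv a ?b ^^ j) p)"
        unfolding p_def by (rule KT(2) [OF a C]) (unfold C_def, rule KT0(2) [OF a])
      have "graded_bound 0 M (M + j) KT C q"
        unfolding graded_bound_def
      proof (intro allI conjI impI)
        fix k
        have low: "coeff q k = 0" if "k < M"
          using coeff_truncation_formal_derivs [OF that] that by (simp add: q_def p_def Bd_def coeff_truncation)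
        have high: "coeff q k = coeff ((poly_deriv a ?b ^^ j) p) k" if "\<not> k < M"
          using that by (simp add: q_def coeff_truncation)
        show "k < M \<or> M + j < k \<Longrightarrow> coeff q k = 0"
          using low high pj by (cases "k < M") (auto simp: graded_bound_def)
        show "norm (coeff q k) \<le> KT * C ^ (2 * k - 0)"
          using low high pj KT(1) C by (cases "k < M") (auto simp: graded_bound_def)
      qed
      from graded_bound_eval [OF this C CX]
      have e2: "norm (poly q (exp (- s))) \<le> real (Suc (M + j)) * KT * Q"
        unfolding normX by (simp add: Q_def z_def power_divide)
      have W_eq: "(\<lambda>s. exp (?b * s) * W s) = (\<lambda>s. exp (?b * s) * R s + exp (a * exp s) * exp (?b * s) * poly p (exp (- s)))"
        by (simp add: R_def E_def algebra_simps)
      have "(uc_deriv ^^ j) (\<lambda>s. exp (?b * s) * W s) s =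
          (uc_deriv ^^ j) (\<lambda>s. exp (?b * s) * R s) s + (uc_deriv ^^ j) (\<lambda>s. exp (a * exp s) * exp (?b * s) * poly p (exp (- s))) s"
        unfolding W_eq by (subst uc_derivs_add) (intro holomorphic_intros eR | simp)+
      also have "(uc_deriv ^^ j) (\<lambda>s. exp (?b * s) * R s) s = exp (a * exp s) * exp (?b * s) * e1"
        unfolding uc_derivs_exp_mult [OF eR] e1_def by (simp add: exp_minus)
      also have "(uc_deriv ^^ j) (\<lambda>s. exp (a * exp s) * exp (?b * s) * poly p (exp (- s))) s
          = exp (a * exp s) * exp (?b * s) * (poly (truncation M Bd) (exp (- s)) + poly q (exp (- s)))"
        unfolding uc_derivs_expansion q_def by simp
      also have "poly (truncation M Bd) (exp (- s)) = (\<Sum>m<M. Bd m / exp s ^ m)"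
        by (simp add: poly_truncation exp_minus power_inverse divide_inverse)
      finally have "(uc_deriv ^^ j) (\<lambda>s. exp (?b * s) * W s) s
          = exp (a * exp s) * exp (?b * s) * ((\<Sum>m<M. Bd m / exp s ^ m) + (e1 + poly q (exp (- s))))"
        by (simp add: algebra_simps)
      moreover have "norm (e1 + poly q (exp (- s))) \<le> K * Q"
        using norm_triangle_ineq [of e1 "poly q (exp (- s))"] e1 e2 by (simp add: K_def distrib_right)
      ultimately show ?thesis
        unfolding Bd_def Q_def C_def z_def by blast
    qed
    then show ?thesis unfolding uniform_expansion_def by blast
  qed
  then show ?thesis using c0 by blast
qed

lemma uniform_expansionD:
  assumes "uniform_expansion n \<theta> c M j K" "norm a = real n" "(\<Sum>l<n. lam l) = 0" "a * cis \<phi> = - of_nat n"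
    "euler_solution n a (euler_coeff n lam) W" "euler_ode.recessive n a \<phi> W"
    "\<bar>Im s - \<phi>\<bar> < pi + pi / real n - \<theta>" "c * index_size n lam ^ 2 < norm (exp s)"
  obtains e where "norm e \<le> K * (index_size n lam ^ (2 * M) / norm (exp s) ^ M)"
    "(uc_deriv ^^ j) (\<lambda>s. exp (bessel_expo n * s) * W s) s = exp (a * exp s) * exp (bessel_expo n * s) *
         ((\<Sum>m<M. fps_nth ((formal_deriv a (bessel_expo n) ^^ j) (Abs_fps (bcoef n a lam))) m / exp s ^ m) + e)"
  using assms unfolding uniform_expansion_def by blast

section \<open>The solution attached to a root of unity\<close>

text \<open>Cauchy's estimate on narrower strips carries smallness over to the derivatives.\<close>

lemma (in euler_ode) strip_decay:
  assumes V: "entire V" and \<delta>: "0 < \<delta>"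
    and V0: "\<And>s. \<bar>Im s - \<phi>\<bar> < \<delta> \<Longrightarrow> R < Re s \<Longrightarrow> amp a 0 V s \<le> K * exp (- Re s)"
  shows "\<exists>K R \<delta>. 0 < \<delta> \<and> (\<forall>s. \<bar>Im s - \<phi>\<bar> < \<delta> \<longrightarrow> R < Re s \<longrightarrow> amp a j V s \<le> K * exp (- Re s))"
proof (induction j)
  case 0
  then show ?case using \<delta> V0 by blast
next
  case (Suc j)
  then obtain K R \<delta> where \<delta>: "0 < \<delta>"
    and le: "\<And>s. \<bar>Im s - \<phi>\<bar> < \<delta> \<Longrightarrow> R < Re s \<Longrightarrow> amp a j V s \<le> K * exp (- Re s)" by blast
  define h where "h s = exp (- (a * exp s)) * (uc_deriv ^^ j) V s" for s
  have eh: "entire h" unfolding h_def [abs_def] by (intro holomorphic_intros V)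
  \<comment> \<open>A disc of radius r about a point of the strip of half-width r stays in the old
    strip, as 2 r <= \<delta>; as r <= 1, exp (- Re s) changes on it by a factor of at most
    e.\<close>
  define r where "r = min (\<delta> / 2) 1"
  have r: "0 < r" "r \<le> 1" "2 * r \<le> \<delta>" using \<delta> by (auto simp: r_def)
  have step: "exp (- (a * exp s)) * (uc_deriv ^^ Suc j) V s = a * h s + exp (- s) * deriv h s" for s
  proof -
    have "(h has_field_derivative exp (- (a * exp s)) * (exp s * (uc_deriv ^^ Suc j) V s)
        - a * exp s * h s) (at s)"
      unfolding h_def [abs_def]
      by (rule derivative_eq_intros uc_derivs_DERIV V refl)+ (simp add: algebra_simps)
    then have "exp (- s) * deriv h s = exp (- s) * exp s * (exp (- (a * exp s)) * (uc_deriv ^^ Suc j) V s - a * h s)"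
      by (simp add: DERIV_imp_deriv algebra_simps del: funpow.simps)
    then show ?thesis by (simp add: exp_minus del: funpow.simps)
  qed
  have "amp a (Suc j) V s \<le> (real n * \<bar>K\<bar> + \<bar>K\<bar> * exp 1 / r) * exp (- Re s)"
    if s: "\<bar>Im s - \<phi>\<bar> < r" "\<bar>R\<bar> + 1 < Re s" for s
  proof -
    have h_le: "norm (h s') \<le> \<bar>K\<bar> * exp (- Re s')" if "\<bar>Im s' - \<phi>\<bar> < \<delta>" "R < Re s'" for s'
      using order_trans [OF le [OF that] mult_right_mono [OF abs_ge_self]] by (simp add: h_def amp_def)
    have "norm (h s') \<le> \<bar>K\<bar> * exp (1 - Re s)" if "norm (s - s') = r" for s'
    proof -
      have "\<bar>Re (s - s')\<bar> \<le> r" "\<bar>Im (s - s')\<bar> \<le> r"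
        using that abs_Re_le_cmod [of "s - s'"] abs_Im_le_cmod [of "s - s'"] by auto
      then have *: "\<bar>Im s' - \<phi>\<bar> < \<delta>" "Re s - 1 \<le> Re s'" "R < Re s'"
        using s r by auto
      have "\<bar>K\<bar> * exp (- Re s') \<le> \<bar>K\<bar> * exp (1 - Re s)"
        using * by (intro mult_left_mono) auto
      then show ?thesis using h_le [OF *(1,3)] by linarith
    qed
    then have "norm ((deriv ^^ 1) h s) \<le> fact 1 * (\<bar>K\<bar> * exp (1 - Re s)) / r ^ 1"
      using r by (intro Cauchy_inequality holomorphic_on_subset [OF eh] holomorphic_on_imp_continuous_on) auto
    then have d: "norm (deriv h s) \<le> \<bar>K\<bar> * exp 1 / r * exp (- Re s)"
      by (simp add: exp_diff exp_minus divide_inverse mult_ac)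
    have "norm (exp (- s)) \<le> 1" using s by simp
    then have "norm (exp (- s)) * norm (deriv h s) \<le> 1 * norm (deriv h s)"
      by (rule mult_right_mono) simp
    moreover have "norm (h s) \<le> \<bar>K\<bar> * exp (- Re s)"
      using s r by (intro h_le) auto
    then have "real n * norm (h s) \<le> real n * (\<bar>K\<bar> * exp (- Re s))"
      by (intro mult_left_mono) auto
    moreover have "amp a (Suc j) V s \<le> real n * norm (h s) + norm (exp (- s)) * norm (deriv h s)"
      unfolding amp_def step using norm_triangle_ineq [of "a * h s" "exp (- s) * deriv h s"]
      by (simp add: norm_mult a)
    ultimately have "amp a (Suc j) V s \<le> real n * (\<bar>K\<bar> * exp (- Re s)) + \<bar>K\<bar> * exp 1 / r * exp (- Re s)"
      using d by linarith
    then show ?thesis by (simp only: distrib_right mult.assoc)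
  qed
  then show ?case using r(1) by blast
qed

text \<open>Meant for the difference of two solutions with the same leading term: it is O(1/z)
  relative to exp (a z) on a strip, its derivatives are so on narrower ones, and each of these
  contains the axis.\<close>

lemma (in euler_ode) small_solution_eq_0:
  assumes V: "euler_solution n a g V" and \<delta>: "0 < \<delta>"
    and V0: "\<And>s. \<bar>Im s - \<phi>\<bar> < \<delta> \<Longrightarrow> R < Re s \<Longrightarrow> amp a 0 V s \<le> K * exp (- Re s)"
  shows "V s = 0"
proof (rule recessive_unique [OF V])
  fix j
  have eV: "entire V" using V by (simp add: euler_solution_op)
  obtain K R \<delta> where \<delta>: "0 < \<delta>"
    and le: "\<And>s. \<bar>Im s - \<phi>\<bar> < \<delta> \<Longrightarrow> R < Re s \<Longrightarrow> amp a j V s \<le> K * exp (- Re s)"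
    using strip_decay [OF eV \<delta> V0] by metis
  show "((\<lambda>r. amp a j V (axis r)) \<longlongrightarrow> 0) at_top"
  proof (rule Lim_null_comparison)
    show "((\<lambda>r. K * inverse r) \<longlongrightarrow> 0) at_top"
      using tendsto_mult [OF tendsto_const tendsto_inverse_0_at_top [OF filterlim_ident], of K] by simp
    show "\<forall>\<^sub>F r in at_top. norm (amp a j V (axis r)) \<le> K * inverse r"
      using eventually_gt_at_top [of "exp R"] eventually_gt_at_top [of 0]
    proof eventually_elim
      case (elim r)
      have "amp a j V (axis r) \<le> K * exp (- Re (axis r))"
      proof (rule le)
        have "R < ln r" using elim by (metis exp_less_cancel_iff exp_ln)
        then show "R < Re (axis r)" by (simp add: axis_def)
      qed (use \<delta> in \<open>simp add: axis_def\<close>)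
      then show ?case using elim by (simp add: axis_def exp_minus)
    qed
  qed
qed

text \<open>As |xi| = 1, xi = exp (i arg xi), and i xi exp (i (pi/2 - arg xi)) = -1.\<close>

lemma root_of_unity_direction:
  assumes "n > 0" "\<sigma> \<in> {1, -1}" "uc_proj \<xi> ^ n = \<sigma>"
  shows "norm (bessel_rate n (uc_proj \<xi>)) = real n"
    and "bessel_rate n (uc_proj \<xi>) * cis (pi / 2 - uc_arg \<xi>) = - of_nat n"
    and "bessel_rate n (uc_proj \<xi>) ^ n = \<sigma> * (\<i> * of_nat n) ^ n"
proof -
  have "norm (uc_proj \<xi>) ^ n = 1"
    using assms by (auto simp flip: norm_power)
  then have u: "uc_abs \<xi> = 1"
    using assms(1) power_eq_imp_eq_base [of "uc_abs \<xi>" n 1] by (simp add: uc_proj_def uc_abs_def del: exp_eq_one_iff)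
  then have "uc_proj \<xi> = cis (uc_arg \<xi>)" by (simp add: uc_proj_polar)
  then show "norm (bessel_rate n (uc_proj \<xi>)) = real n"
    and "bessel_rate n (uc_proj \<xi>) * cis (pi / 2 - uc_arg \<xi>) = - of_nat n"
    by (simp_all add: bessel_rate_def mult.assoc cis_mult norm_mult mult.left_commute [of \<i> "of_nat n"])
  show "bessel_rate n (uc_proj \<xi>) ^ n = \<sigma> * (\<i> * of_nat n) ^ n"
    using assms by (simp add: bessel_rate_def power_mult_distrib)
qed

text \<open>z^b W meets the description of J by \<open>solution_expansion\<close>. A competitor has
  the same leading term on the defining sector, so the difference falls under
  \<open>small_solution_eq_0\<close>.\<close>

lemma bessel_J_eq:
  assumes n2: "2 \<le> n" and \<sigma>: "\<sigma> \<in> {1, -1}" "uc_proj \<xi> ^ n = \<sigma>" and lam: "(\<Sum>l<n. lam l) = 0"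
  defines "a \<equiv> bessel_rate n (uc_proj \<xi>)" and "\<phi> \<equiv> pi / 2 - uc_arg \<xi>"
  shows "\<exists>W. euler_solution n a (euler_coeff n lam) W \<and> euler_ode.recessive n a \<phi> W \<and>
    bessel_J n \<sigma> \<xi> lam = (\<lambda>s. exp (bessel_expo n * s) * W s)"
proof -
  have n0: "n > 0" using n2 by simp
  note aeq = root_of_unity_direction [OF n0 \<sigma>, folded a_def \<phi>_def]
  let ?b = "bessel_expo n"
  obtain G where G: "0 \<le> G" "\<And>lam j. j \<le> n \<Longrightarrow> norm (euler_coeff n lam j) \<le> G * index_size n lam ^ (n - j)"
    using euler_coeff_bounded [OF n0] by blast
  interpret euler_ode n a "euler_coeff n lam" G "index_size n lam" \<phi>
    by (rule euler_ode_bessel [OF n2 aeq(1) lam aeq(2) G])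
  obtain W where W: "euler_solution n a (euler_coeff n lam) W" "recessive W"
    using recessive_solution_exists by blast
  have eW: "entire W" using W by (simp add: euler_solution_op)
  define w where "w s = exp (?b * s) * W s" for s
  have B: "bessel_B n \<sigma> (uc_proj \<xi>) lam = bcoef n a lam"
    unfolding a_def by (rule bessel_B_eq [OF n0 lam]) (use \<sigma> in \<open>auto simp: uc_proj_def\<close>)
  have pref: "bessel_prefactor n (uc_proj \<xi>) s = exp (a * exp s) * exp (?b * s)" for s
    by (simp add: bessel_prefactor_def uc_powr_def a_def uc_proj_def)
  have sector: "s \<in> bessel_sector \<xi> \<psi> \<longleftrightarrow> \<bar>Im s - \<phi>\<bar> < \<psi>" for s \<psi>
    by (simp add: bessel_sector_def \<phi>_def uc_arg_def)
  have abs: "uc_abs s = norm (exp s)" for s by (simp add: uc_abs_def)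
  have pin: "pi / real n \<le> pi + pi / real n - pi / 4" "0 < pi / real n" using pi_gt_zero n0 by auto
  \<comment> \<open>With the opening parameter pi/4 the large sector already contains the one that
    defines J.\<close>
  have p4: "0 < pi / 4" "pi / 4 < pi / 2" by simp_all
  obtain c where c: "c > 0" "\<And>M j. M > 0 \<Longrightarrow> \<exists>K. uniform_expansion n (pi / 4) c M j K"
    using solution_expansion [OF n2 p4] by blast
  have exp_w: "\<exists>K. \<forall>s. \<bar>Im s - \<phi>\<bar> < pi / real n \<longrightarrow> c * index_size n lam ^ 2 < norm (exp s) \<longrightarrow>
      norm (w s / (exp (a * exp s) * exp (?b * s)) - (\<Sum>m<M. bcoef n a lam m / exp s ^ m)) \<le> K / norm (exp s) ^ M"
    if M: "M > 0" for M
  proof -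
    from c(2) [OF M, of 0] obtain K where K: "uniform_expansion n (pi / 4) c M 0 K" ..
    show ?thesis
    proof (intro exI [of _ "K * index_size n lam ^ (2 * M)"] allI impI)
      fix s assume "\<bar>Im s - \<phi>\<bar> < pi / real n" "c * index_size n lam ^ 2 < norm (exp s)"
      from uniform_expansionD [OF K aeq(1) lam aeq(2) W less_le_trans [OF this(1) pin(1)] this(2)]
      obtain e where e: "norm e \<le> K * (index_size n lam ^ (2 * M) / norm (exp s) ^ M)"
        "(uc_deriv ^^ 0) (\<lambda>s. exp (?b * s) * W s) s = exp (a * exp s) * exp (?b * s) *
          ((\<Sum>m<M. fps_nth ((formal_deriv a ?b ^^ 0) (Abs_fps (bcoef n a lam))) m / exp s ^ m) + e)" .
      then have "w s = exp (a * exp s) * exp (?b * s) * ((\<Sum>m<M. bcoef n a lam m / exp s ^ m) + e)"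
        by (simp only: funpow.simps id_apply fps_nth_Abs_fps w_def)
      then have "w s / (exp (a * exp s) * exp (?b * s)) - (\<Sum>m<M. bcoef n a lam m / exp s ^ m) = e"
        by simp
      then show "norm (w s / (exp (a * exp s) * exp (?b * s)) - (\<Sum>m<M. bcoef n a lam m / exp s ^ m))
          \<le> K * index_size n lam ^ (2 * M) / norm (exp s) ^ M"
        using e(1) by (simp only: times_divide_eq_right)
    qed
  qed
  have w_exp: "has_bessel_expansion n (uc_proj \<xi>) w (bessel_B n \<sigma> (uc_proj \<xi>) lam) (bessel_sector \<xi> (pi / real n))"
    unfolding has_bessel_expansion_def
  proof
    fix M
    show "\<exists>K R. \<forall>z\<in>bessel_sector \<xi> (pi / real n). uc_abs z > R \<longrightarrow>
        norm (w z / bessel_prefactor n (uc_proj \<xi>) z - (\<Sum>m<M. bessel_B n \<sigma> (uc_proj \<xi>) lam m / uc_proj z ^ m)) \<le> K / uc_abs z ^ M"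
    \<comment> \<open>An expansion in the sense of the definition includes M = 0, that is
      boundedness; it follows from M = 1 where |z| > 1.\<close>
    proof (cases "M = 0")
      case False
      then obtain K where "\<forall>s. \<bar>Im s - \<phi>\<bar> < pi / real n \<longrightarrow> c * index_size n lam ^ 2 < norm (exp s) \<longrightarrow>
          norm (w s / (exp (a * exp s) * exp (?b * s)) - (\<Sum>m<M. bcoef n a lam m / exp s ^ m)) \<le> K / norm (exp s) ^ M"
        using exp_w [of M] by blast
      then show ?thesis
        unfolding B pref abs by (intro exI [of _ K] exI [of _ "c * index_size n lam ^ 2"]) (simp add: sector uc_proj_def del: norm_exp_eq_Re)
    next
      case True
      obtain K where K: "\<And>s. \<bar>Im s - \<phi>\<bar> < pi / real n \<Longrightarrow> c * index_size n lam ^ 2 < norm (exp s) \<Longrightarrow>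
          norm (w s / (exp (a * exp s) * exp (?b * s)) - (\<Sum>m<1. bcoef n a lam m / exp s ^ m)) \<le> K / norm (exp s) ^ 1"
        using exp_w [of 1] by auto
      have "norm (w s / (exp (a * exp s) * exp (?b * s))) \<le> \<bar>K\<bar> + 1"
        if s: "\<bar>Im s - \<phi>\<bar> < pi / real n" "max 1 (c * index_size n lam ^ 2) < norm (exp s)" for s
      proof -
        have "K / norm (exp s) ^ 1 \<le> \<bar>K\<bar> / 1"
          using s by (intro frac_le) auto
        then have "norm (w s / (exp (a * exp s) * exp (?b * s)) - 1) \<le> \<bar>K\<bar>"
          using K [of s] s by (simp del: norm_exp_eq_Re)
        then show ?thesis
          using norm_triangle_ineq [of "w s / (exp (a * exp s) * exp (?b * s)) - 1" 1] by simp
      qed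
      then show ?thesis
        unfolding True B pref abs
        by (intro exI [of _ "\<bar>K\<bar> + 1"] exI [of _ "max 1 (c * index_size n lam ^ 2)"]) (simp add: sector del: norm_exp_eq_Re)
    qed
  qed
  have w_sol: "bessel_solution n \<sigma> lam w"
    unfolding w_def [abs_def] bessel_solution_euler [OF aeq(3) eW] by (rule W)
  have uniq: "w' = w" if w': "bessel_solution n \<sigma> lam w'"
    "has_bessel_expansion n (uc_proj \<xi>) w' (bessel_B n \<sigma> (uc_proj \<xi>) lam) (bessel_sector \<xi> (pi / real n))" for w'
  proof
    fix s
    define W' where "W' s = exp (- (?b * s)) * w' s" for s
    have w'_eq: "w' = (\<lambda>s. exp (?b * s) * W' s)" 
      by (rule ext) (simp add: W'_def exp_minus mult.assoc [symmetric])
    have ew': "entire w'" using w'(1) by (simp add: bessel_solution_def)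
    have eW': "entire W'" unfolding W'_def [abs_def] by (intro holomorphic_intros ew')
    have W': "euler_solution n a (euler_coeff n lam) W'"
      using w'(1) unfolding w'_eq bessel_solution_euler [OF aeq(3) eW'] .
    have V: "euler_solution n a (euler_coeff n lam) (\<lambda>s. W' s - W s)"
      using W(1) W' by (auto simp: euler_solution_op op_diff intro: holomorphic_intros)
    obtain K1 R1 where K1: "\<And>s. \<bar>Im s - \<phi>\<bar> < pi / real n \<Longrightarrow> R1 < norm (exp s) \<Longrightarrow>
        norm (w' s / (exp (a * exp s) * exp (?b * s)) - 1) \<le> K1 / norm (exp s)"
    proof -
      from w'(2) obtain K R where "\<forall>z\<in>bessel_sector \<xi> (pi / real n). uc_abs z > R \<longrightarrow>
        norm (w' z / bessel_prefactor n (uc_proj \<xi>) z - (\<Sum>m<1. bessel_B n \<sigma> (uc_proj \<xi>) lam m / uc_proj z ^ m)) \<le> K / uc_abs z ^ 1"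
        unfolding has_bessel_expansion_def by metis
      then show thesis
        using that [of R K] unfolding B pref abs by (simp add: sector del: norm_exp_eq_Re)
    qed
    obtain K2 where K2: "\<And>s. \<bar>Im s - \<phi>\<bar> < pi / real n \<Longrightarrow> c * index_size n lam ^ 2 < norm (exp s) \<Longrightarrow>
        norm (w s / (exp (a * exp s) * exp (?b * s)) - 1) \<le> K2 / norm (exp s)"
      using exp_w [of 1] by (auto simp del: norm_exp_eq_Re)
    have "W' s - W s = 0"
    proof (rule small_solution_eq_0 [OF V pin(2), where R = "max R1 (c * index_size n lam ^ 2)" and K = "K1 + K2"])
      fix s assume s: "\<bar>Im s - \<phi>\<bar> < pi / real n" "max R1 (c * index_size n lam ^ 2) < Re s"
      \<comment> \<open>Re s = ln |z| <= |z|, so a threshold for Re s also serves for |z|.\<close>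
      have "Re s \<le> norm (exp s)"
        unfolding norm_exp_eq_Re using exp_ge_add_one_self [of "Re s"] by linarith
      then have s': "R1 < norm (exp s)" "c * index_size n lam ^ 2 < norm (exp s)"
        using s(2) by linarith+
      have "exp (- (a * exp s)) * (W' s - W s) = (w' s / (exp (a * exp s) * exp (?b * s)) - 1) - (w s / (exp (a * exp s) * exp (?b * s)) - 1)"
        unfolding w'_eq w_def by (simp add: exp_minus field_simps)
      then have "amp a 0 (\<lambda>s. W' s - W s) s =
          norm ((w' s / (exp (a * exp s) * exp (?b * s)) - 1) - (w s / (exp (a * exp s) * exp (?b * s)) - 1))"
        by (simp only: amp_def funpow.simps id_apply)
      also have "\<dots> \<le> norm (w' s / (exp (a * exp s) * exp (?b * s)) - 1) + norm (w s / (exp (a * exp s) * exp (?b * s)) - 1)"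
        by (rule norm_triangle_ineq4)
      also have "\<dots> \<le> K1 / norm (exp s) + K2 / norm (exp s)"
        by (intro add_mono K1 K2 s s')
      also have "\<dots> = (K1 + K2) * exp (- Re s)"
        by (simp add: exp_minus field_simps)
      finally show "amp a 0 (\<lambda>s. W' s - W s) s \<le> (K1 + K2) * exp (- Re s)" .
    qed
    then show "w' s = w s" unfolding w'_eq w_def by simp
  qed
  have "bessel_J n \<sigma> \<xi> lam = w"
    unfolding bessel_J_def
  proof (rule the_equality)
    fix w' assume "bessel_solution n \<sigma> lam w' \<and>
      has_bessel_expansion n (uc_proj \<xi>) w' (bessel_B n \<sigma> (uc_proj \<xi>) lam) (bessel_sector \<xi> (pi / real n))"
    then show "w' = w" by (elim conjE) (rule uniq)
  qed (intro conjI w_sol w_exp)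
  with W show ?thesis unfolding w_def [abs_def] by blast
qed

theorem theorem11p24:
  fixes n M :: nat and \<theta> :: real
  assumes "n \<ge> 2" and "0 < \<theta>" and "\<theta> < pi / 2" and "M > 0"
  shows "\<exists>c>0.
    (\<exists>K. \<forall>\<sigma> \<xi> lam z.
       \<sigma> \<in> {1, -1} \<longrightarrow> uc_proj \<xi> ^ n = \<sigma> \<longrightarrow> (\<Sum>l<n. lam l) = 0 \<longrightarrow>
       z \<in> bessel_sector \<xi> (pi + pi / real n - \<theta>) \<longrightarrow> uc_abs z > c * index_size n lam ^ 2 \<longrightarrow>
       (\<exists>E. norm E \<le> K * (index_size n lam ^ (2 * M) / uc_abs z ^ M) \<and>
          bessel_J n \<sigma> \<xi> lam z =
            exp (\<i> * of_nat n * uc_proj \<xi> * uc_proj z) * uc_powr z (- (of_nat n - 1) / 2) *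
            ((\<Sum>m<M. bessel_B n \<sigma> (uc_proj \<xi>) lam m / uc_proj z ^ m) + E))) \<and>
    (\<forall>j. \<exists>K. \<forall>\<sigma> \<xi> lam z.
       \<sigma> \<in> {1, -1} \<longrightarrow> uc_proj \<xi> ^ n = \<sigma> \<longrightarrow> (\<Sum>l<n. lam l) = 0 \<longrightarrow>
       z \<in> bessel_sector \<xi> (pi + pi / real n - \<theta>) \<longrightarrow> uc_abs z > c * index_size n lam ^ 2 \<longrightarrow>
       (\<exists>E. norm E \<le> K * (index_size n lam ^ (2 * M) / uc_abs z ^ M) \<and>
          (uc_deriv ^^ j) (bessel_J n \<sigma> \<xi> lam) z =
            exp (\<i> * of_nat n * uc_proj \<xi> * uc_proj z) * uc_powr z (- (of_nat n - 1) / 2) *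
            ((\<Sum>m<M. bessel_B_deriv n \<sigma> (uc_proj \<xi>) lam j m / uc_proj z ^ m) + E)))"
proof -
  have n0: "n > 0" using assms by simp
  obtain c where c: "c > 0" and exp_j: "\<And>j. \<exists>K. uniform_expansion n \<theta> c M j K"
    using solution_expansion [OF assms(1-3)] assms(4) by blast
  have main: "\<exists>K. \<forall>\<sigma> \<xi> lam z.
       \<sigma> \<in> {1, -1} \<longrightarrow> uc_proj \<xi> ^ n = \<sigma> \<longrightarrow> (\<Sum>l<n. lam l) = 0 \<longrightarrow>
       z \<in> bessel_sector \<xi> (pi + pi / real n - \<theta>) \<longrightarrow> uc_abs z > c * index_size n lam ^ 2 \<longrightarrow>
       (\<exists>E. norm E \<le> K * (index_size n lam ^ (2 * M) / uc_abs z ^ M) \<and>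
          (uc_deriv ^^ j) (bessel_J n \<sigma> \<xi> lam) z =
            exp (\<i> * of_nat n * uc_proj \<xi> * uc_proj z) * uc_powr z (- (of_nat n - 1) / 2) *
            ((\<Sum>m<M. bessel_B_deriv n \<sigma> (uc_proj \<xi>) lam j m / uc_proj z ^ m) + E))" for j
  proof -
    from exp_j [of j] obtain K where K: "uniform_expansion n \<theta> c M j K" ..
    show ?thesis
    proof (intro exI [of _ K] allI impI)
      fix \<sigma> \<xi> lam z
      assume \<sigma>: "\<sigma> \<in> {1, -1}" "uc_proj \<xi> ^ n = \<sigma>" and lam: "(\<Sum>l<n. lam l) = 0"
        and z: "z \<in> bessel_sector \<xi> (pi + pi / real n - \<theta>)" "uc_abs z > c * index_size n lam ^ 2"
      let ?a = "bessel_rate n (uc_proj \<xi>)"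
      obtain W where W: "euler_solution n ?a (euler_coeff n lam) W" "euler_ode.recessive n ?a (pi / 2 - uc_arg \<xi>) W"
        and J: "bessel_J n \<sigma> \<xi> lam = (\<lambda>s. exp (bessel_expo n * s) * W s)"
        using bessel_J_eq [OF assms(1) \<sigma> lam] by blast
      have B: "bessel_B n \<sigma> (uc_proj \<xi>) lam = bcoef n ?a lam"
        by (rule bessel_B_eq [OF n0 lam]) (use \<sigma> in \<open>auto simp: uc_proj_def\<close>)
      have z': "\<bar>Im z - (pi / 2 - uc_arg \<xi>)\<bar> < pi + pi / real n - \<theta>" "c * index_size n lam ^ 2 < norm (exp z)"
        using z by (auto simp: bessel_sector_def uc_arg_def uc_abs_def)
      obtain e where e: "norm e \<le> K * (index_size n lam ^ (2 * M) / norm (exp z) ^ M)"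
        "(uc_deriv ^^ j) (\<lambda>s. exp (bessel_expo n * s) * W s) z = exp (?a * exp z) * exp (bessel_expo n * z) *
         ((\<Sum>m<M. fps_nth ((formal_deriv ?a (bessel_expo n) ^^ j) (Abs_fps (bcoef n ?a lam))) m / exp z ^ m) + e)"
        by (rule uniform_expansionD [OF K root_of_unity_direction(1) [OF n0 \<sigma>] lam root_of_unity_direction(2) [OF n0 \<sigma>] W z'])
      show "\<exists>E. norm E \<le> K * (index_size n lam ^ (2 * M) / uc_abs z ^ M) \<and>
          (uc_deriv ^^ j) (bessel_J n \<sigma> \<xi> lam) z =
            exp (\<i> * of_nat n * uc_proj \<xi> * uc_proj z) * uc_powr z (- (of_nat n - 1) / 2) *
            ((\<Sum>m<M. bessel_B_deriv n \<sigma> (uc_proj \<xi>) lam j m / uc_proj z ^ m) + E)"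
      proof (intro exI [of _ e] conjI)
        show "norm e \<le> K * (index_size n lam ^ (2 * M) / uc_abs z ^ M)"
          using e(1) by (simp only: uc_abs_def norm_exp_eq_Re)
        show "(uc_deriv ^^ j) (bessel_J n \<sigma> \<xi> lam) z =
            exp (\<i> * of_nat n * uc_proj \<xi> * uc_proj z) * uc_powr z (- (of_nat n - 1) / 2) *
            ((\<Sum>m<M. bessel_B_deriv n \<sigma> (uc_proj \<xi>) lam j m / uc_proj z ^ m) + e)"
          unfolding J e(2) bessel_B_deriv_def B bessel_formal_deriv_def
          by (simp only: bessel_rate_def bessel_expo_def uc_powr_def uc_proj_def)
      qed
    qed
  qed
  \<comment> \<open>With zero differentiations the formal series is unchanged, which turns the
    general statement into the first conjunct.\<close>
  have "bessel_B_deriv n \<sigma> \<xi> lam 0 m = bessel_B n \<sigma> \<xi> lam m" for \<sigma> \<xi> lam m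
    by (simp add: bessel_B_deriv_def bessel_formal_deriv_def)
  from main [of 0, unfolded this] show ?thesis
    by (intro exI [where P = "\<lambda>c. 0 < c \<and> _ c", of c] conjI c allI main) (simp only: funpow.simps id_apply)
qed

end
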